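(* Let $M$ and $N$ be finite-dimensional smooth manifolds and let $X$ be a smooth manifold modeled on a locally convex space $E$. Let $\mathrm{Prop}_{vS}(M,N)$ denote the set of proper smooth maps $M\to N$ with the subspace topology from $C^\infty_{vS}(M,N)$. Then the composition map $$\Gamma\colon \mathrm{Prop}_{vS}(M,N)\times C^\infty_{vS}(N,X)\to C^\infty_{vS}(M,X),\qquad (f,h)\mapsto h\circ f$$ is continuous.
   Context: Conventions: finite-dimensional manifolds are smooth, Hausdorff and $\sigma$-compact. Locally convex spaces are real Hausdorff locally convex topological vector spaces; differentiability is in the sense of Bastiani (Keller $C^r$-theory): for $U\subseteq E$ open and $f\colon U\to F$, $d^{(k)}f(x;y_1,\dots,y_k)=D_{y_k}\cdots D_{y_1}f(x)$ is the iterated directional derivative, and $f$ is smooth if all these exist and are continuous on $U\times E^k$ (and $f$ is continuous); manifolds modeled on locally convex spaces and smooth maps between them are defined via charts with smooth transition maps. Let $M$ be a finite-dimensional manifold of dimension $m$ and $e_1,\dots,e_m$ the standard basis of $\mathbb{R}^m$. For a locally convex space $E$, a continuous seminorm $p$ on $E$, an open $W\subseteq\mathbb{R}^m$, a smooth $g\colon W\to E$, a compact $A\subseteq W$ and $r\in\mathbb{N}_0$ put $\|g\|(r,A,p)=\sup\{p(d^{(k)}g(a;\alpha)) : a\in A,\ \alpha\in\{e_1,\dots,e_m\}^k,\ 0\le k\le r\}$ (for $E=\mathbb{R}^n$ one takes $p=\|\cdot\|_\infty$ and writes $\|g\|(r,A)$). For a manifold $X$ modeled on $E$, $f\in C^\infty(M,X)$,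 a chart $(U,\phi)$ of $M$, a compact $A\subseteq U$, a chart $(V,\psi)$ of $X$ with $f(A)\subseteq V$, a continuous seminorm $p$ on $E$, $r\in\mathbb{N}_0$ and $\epsilon>0$, the elementary neighborhood is $\mathcal{N}^r(f;A,(U,\phi),(V,\psi),p,\epsilon)=\{h\in C^\infty(M,X): h(A)\subseteq V,\ \|\psi\circ h\circ\phi^{-1}-\psi\circ f\circ\phi^{-1}\|(r,\phi(A),p)<\epsilon\}$. A basic neighborhood of $f$ is an intersection $\bigcap_{i\in\Lambda}\mathcal{N}^{r_i}(f;A_i,(U_i,\phi_i),(V_i,\psi_i),p_i,\epsilon_i)$ of elementary neighborhoods of $f$ such that the family $\{A_i\}_{i\in\Lambda}$ is locally finite in $M$. The very strong topology on $C^\infty(M,X)$ is the topology with the basic neighborhoods (of all $f$) as a basis; $C^\infty_{vS}(M,X)$ denotes $C^\infty(M,X)$ with this topology. When source or target is a vector space, its identity chart is used and omitted from the notation. *)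

theory Defs
  imports "HOL-Analysis.Analysis"
begin

definition seminorm :: "('e::real_vector \<Rightarrow> real) \<Rightarrow> bool" where
  "seminorm p \<longleftrightarrow> (\<forall>x y. p (x + y) \<le> p x + p y) \<and> (\<forall>c x. p (c *\<^sub>R x) = \<bar>c\<bar> * p x)"

definition cont_seminorms :: "('e::{real_vector,topological_space} \<Rightarrow> real) set" where
  "cont_seminorms = {p. seminorm p \<and> continuous_on UNIV p}"

definition lcs :: "'e::{real_vector,topological_space} itself \<Rightarrow> bool" where
  "lcs _ \<longleftrightarrow>
     continuous_on UNIV (\<lambda>(x::'e, y). x + y) \<and>
     continuous_on UNIV (\<lambda>(c::real, x::'e). c *\<^sub>R x) \<and>
     (\<forall>x y::'e. x \<noteq> y \<longrightarrow> (\<exists>U V. open U \<and> open V \<and> x \<in> U \<and> y \<in> V \<and> U \<inter> V = {})) \<and>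
     (\<forall>U (x::'e). open U \<and> x \<in> U \<longrightarrow> (\<exists>p\<in>cont_seminorms. {y. p (y - x) < 1} \<subseteq> U))"

definition finite_basis :: "'a::real_vector set \<Rightarrow> bool" where
  "finite_basis B \<longleftrightarrow> finite B \<and> independent B \<and> span B = UNIV"

definition supnorm :: "'a::real_vector set \<Rightarrow> 'a \<Rightarrow> real" where
  "supnorm B v = Max (insert 0 ((\<lambda>b. \<bar>representation B v b\<bar>) ` B))"

definition has_dirderiv :: "('a::real_vector \<Rightarrow> 'e::{real_vector,topological_space}) \<Rightarrow> 'a \<Rightarrow> 'a \<Rightarrow> 'e \<Rightarrow> bool" where
  "has_dirderiv f x y L \<longleftrightarrow> ((\<lambda>t::real. (1 / t) *\<^sub>R (f (x + t *\<^sub>R y) - f x)) \<longlongrightarrow> L) (at 0)"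

definition dirderiv :: "('a::real_vector \<Rightarrow> 'e::{real_vector,topological_space}) \<Rightarrow> 'a \<Rightarrow> 'a \<Rightarrow> 'e" where
  "dirderiv f x y = (THE L. has_dirderiv f x y L)"

definition dk :: "('a::real_vector \<Rightarrow> 'e::{real_vector,topological_space}) \<Rightarrow> 'a list \<Rightarrow> 'a \<Rightarrow> 'e" where
  "dk f ys = foldl (\<lambda>g y. (\<lambda>x. dirderiv g x y)) f ys"

definition smooth_on :: "'a::{real_vector,topological_space} set \<Rightarrow> ('a \<Rightarrow> 'e::{real_vector,topological_space}) \<Rightarrow> bool" where
  "smooth_on U f \<longleftrightarrow> open U \<and> continuous_on U f \<and>
     (\<forall>ys y. \<forall>x\<in>U. \<exists>L. has_dirderiv (dk f ys) x y L) \<and>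
     (\<forall>k. continuous_map
            (prod_topology (top_of_set U) (product_topology (\<lambda>_. euclidean) {..<k}))
            euclidean (\<lambda>(x, v). dk f (map v [0..<k]) x))"

definition is_chart :: "'x topology \<Rightarrow> ('x set \<times> ('x \<Rightarrow> 'e::{real_vector,topological_space})) \<Rightarrow> bool" where
  "is_chart T c \<longleftrightarrow> (case c of (V, \<psi>) \<Rightarrow>
      openin T V \<and> open (\<psi> ` V) \<and> homeomorphic_map (subtopology T V) (top_of_set (\<psi> ` V)) \<psi>)"

definition compatible :: "('x set \<times> ('x \<Rightarrow> 'e::{real_vector,topological_space})) \<Rightarrow> ('x set \<times> ('x \<Rightarrow> 'e)) \<Rightarrow> bool" where
  "compatible c d \<longleftrightarrow> (case c of (V1, \<psi>1) \<Rightarrow> case d of (V2, \<psi>2) \<Rightarrow>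
      smooth_on (\<psi>1 ` (V1 \<inter> V2)) (\<psi>2 \<circ> inv_into V1 \<psi>1) \<and>
      smooth_on (\<psi>2 ` (V1 \<inter> V2)) (\<psi>1 \<circ> inv_into V2 \<psi>2))"

definition manifold :: "'x topology \<Rightarrow> ('x set \<times> ('x \<Rightarrow> 'e::{real_vector,topological_space})) set \<Rightarrow> bool" where
  "manifold T \<A> \<longleftrightarrow> lcs TYPE('e) \<and> (\<forall>c\<in>\<A>. is_chart T c) \<and>
     topspace T = (\<Union>c\<in>\<A>. fst c) \<and> (\<forall>c\<in>\<A>. \<forall>d\<in>\<A>. compatible c d)"

definition charts_of :: "'x topology \<Rightarrow> ('x set \<times> ('x \<Rightarrow> 'e::{real_vector,topological_space})) set \<Rightarrow> ('x set \<times> ('x \<Rightarrow> 'e)) set" where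
  "charts_of T \<A> = {c. is_chart T c \<and> (\<forall>d\<in>\<A>. compatible c d)}"

text \<open>Finite-dimensional manifold modeled on 'a with basis B (a copy of R^m, m = card B):
  Hausdorff and sigma-compact.\<close>
definition fd_manifold :: "'m topology \<Rightarrow> ('m set \<times> ('m \<Rightarrow> 'a::{real_vector,topological_space})) set \<Rightarrow> 'a set \<Rightarrow> bool" where
  "fd_manifold T \<A> B \<longleftrightarrow> manifold T \<A> \<and> finite_basis B \<and> Hausdorff_space T \<and>
     (\<exists>K::nat \<Rightarrow> 'm set. (\<forall>n. compactin T (K n)) \<and> (\<Union>n. K n) = topspace T)"

definition smooth_maps ::
  "'m topology \<Rightarrow> ('m set \<times> ('m \<Rightarrow> 'a::{real_vector,topological_space})) set \<Rightarrow>
   'x topology \<Rightarrow> ('x set \<times> ('x \<Rightarrow> 'e::{real_vector,topological_space})) set \<Rightarrow> ('m \<Rightarrow> 'x) set" where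
  "smooth_maps TM \<A>M TX \<A>X = {f. continuous_map TM TX f \<and>
     (\<forall>x. x \<notin> topspace TM \<longrightarrow> f x = undefined) \<and>
     (\<forall>(U, \<phi>)\<in>\<A>M. \<forall>(V, \<psi>)\<in>\<A>X.
        smooth_on (\<phi> ` (U \<inter> f -` V)) (\<psi> \<circ> f \<circ> inv_into U \<phi>))}"

definition cnorm :: "'a::real_vector set \<Rightarrow> ('a \<Rightarrow> 'e::{real_vector,topological_space}) \<Rightarrow> nat \<Rightarrow> 'a set \<Rightarrow> ('e \<Rightarrow> real) \<Rightarrow> real" where
  "cnorm B g r A p = Sup (insert 0 {p (dk g \<alpha> a) | a \<alpha>. a \<in> A \<and> set \<alpha> \<subseteq> B \<and> length \<alpha> \<le> r})"

definition elem_nbhd ::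
  "'m topology \<Rightarrow> ('m set \<times> ('m \<Rightarrow> 'a::{real_vector,topological_space})) set \<Rightarrow> 'a set \<Rightarrow>
   'x topology \<Rightarrow> ('x set \<times> ('x \<Rightarrow> 'e::{real_vector,topological_space})) set \<Rightarrow>
   ('m \<Rightarrow> 'x) \<Rightarrow> 'm set \<Rightarrow> ('m set \<times> ('m \<Rightarrow> 'a)) \<Rightarrow> ('x set \<times> ('x \<Rightarrow> 'e)) \<Rightarrow>
   ('e \<Rightarrow> real) \<Rightarrow> nat \<Rightarrow> real \<Rightarrow> ('m \<Rightarrow> 'x) set" where
  "elem_nbhd TM \<A>M B TX \<A>X f A c d p r \<epsilon> = (case c of (U, \<phi>) \<Rightarrow> case d of (V, \<psi>) \<Rightarrow>
     {h \<in> smooth_maps TM \<A>M TX \<A>X. h ` A \<subseteq> V \<and>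
        cnorm B (\<lambda>y. \<psi> (h (inv_into U \<phi> y)) - \<psi> (f (inv_into U \<phi> y))) r (\<phi> ` A) p < \<epsilon>})"

definition elem_data ::
  "'m topology \<Rightarrow> ('m set \<times> ('m \<Rightarrow> 'a::{real_vector,topological_space})) set \<Rightarrow>
   'x topology \<Rightarrow> ('x set \<times> ('x \<Rightarrow> 'e::{real_vector,topological_space})) set \<Rightarrow> ('e \<Rightarrow> real) set \<Rightarrow>
   ('m \<Rightarrow> 'x) \<Rightarrow>
   ('m set \<times> ('m set \<times> ('m \<Rightarrow> 'a)) \<times> ('x set \<times> ('x \<Rightarrow> 'e)) \<times> ('e \<Rightarrow> real) \<times> nat \<times> real) \<Rightarrow> bool" where
  "elem_data TM \<A>M TX \<A>X P f D \<longleftrightarrow> (case D of (A, (U, \<phi>), (V, \<psi>), p, r, \<epsilon>) \<Rightarrow>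
     (U, \<phi>) \<in> charts_of TM \<A>M \<and> compactin TM A \<and> A \<subseteq> U \<and>
     (V, \<psi>) \<in> charts_of TX \<A>X \<and> f ` A \<subseteq> V \<and> p \<in> P \<and> \<epsilon> > 0)"

definition locally_finite_in :: "'m topology \<Rightarrow> 'i set \<Rightarrow> ('i \<Rightarrow> 'm set) \<Rightarrow> bool" where
  "locally_finite_in T I A \<longleftrightarrow> (\<forall>x\<in>topspace T. \<exists>W. openin T W \<and> x \<in> W \<and> finite {i\<in>I. A i \<inter> W \<noteq> {}})"

definition basic_nbhds ::
  "'m topology \<Rightarrow> ('m set \<times> ('m \<Rightarrow> 'a::{real_vector,topological_space})) set \<Rightarrow> 'a set \<Rightarrow>
   'x topology \<Rightarrow> ('x set \<times> ('x \<Rightarrow> 'e::{real_vector,topological_space})) set \<Rightarrow> ('e \<Rightarrow> real) set \<Rightarrow>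
   ('m \<Rightarrow> 'x) set set" where
  "basic_nbhds TM \<A>M B TX \<A>X P =
     {smooth_maps TM \<A>M TX \<A>X \<inter>
        (\<Inter>(A, c, d, p, r, \<epsilon>)\<in>\<Lambda>. elem_nbhd TM \<A>M B TX \<A>X f A c d p r \<epsilon>) | f \<Lambda>.
        f \<in> smooth_maps TM \<A>M TX \<A>X \<and> (\<forall>D\<in>\<Lambda>. elem_data TM \<A>M TX \<A>X P f D) \<and>
        locally_finite_in TM \<Lambda> fst}"

definition vS_top ::
  "'m topology \<Rightarrow> ('m set \<times> ('m \<Rightarrow> 'a::{real_vector,topological_space})) set \<Rightarrow> 'a set \<Rightarrow>
   'x topology \<Rightarrow> ('x set \<times> ('x \<Rightarrow> 'e::{real_vector,topological_space})) set \<Rightarrow> ('e \<Rightarrow> real) set \<Rightarrow>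
   ('m \<Rightarrow> 'x) topology" where
  "vS_top TM \<A>M B TX \<A>X P = topology_generated_by (basic_nbhds TM \<A>M B TX \<A>X P)"

definition proper_smooth_maps ::
  "'m topology \<Rightarrow> ('m set \<times> ('m \<Rightarrow> 'a::{real_vector,topological_space})) set \<Rightarrow>
   'n topology \<Rightarrow> ('n set \<times> ('n \<Rightarrow> 'b::{real_vector,topological_space})) set \<Rightarrow> ('m \<Rightarrow> 'n) set" where
  "proper_smooth_maps TM \<A>M TN \<A>N = {f \<in> smooth_maps TM \<A>M TN \<A>N.
     \<forall>K. compactin TN K \<longrightarrow> compactin TM {x \<in> topspace TM. f x \<in> K}}"

end

theory Submission
  imports Defs
begin

text \<open>
  In charts everything reduces to maps between locally convex spaces. A mean value inequality for
  each continuous seminorm shows that Bastiani-smooth maps are strictly differentiable with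
  multilinear higher derivatives, and hence that the formula of Faa di Bruno
  \[ d^{(k)}(h \circ f)(x; y_1, \dots, y_k) = \sum_\pi d^{(|\pi|)}h(f(x); d^{(|\beta|)}f(x; y_\beta)_{\beta \in \pi}) \]
  holds, the sum ranging over the set partitions \<open>\<pi>\<close> of the directions. Expanding the inner derivatives
  in a basis, uniform convergence on compact sets of the derivatives of \<open>f\<^sub>n\<close> and \<open>h\<^sub>n\<close> up to order \<open>r\<close>
  gives that of the derivatives of \<open>h\<^sub>n \<circ> f\<^sub>n\<close>.

  Given an elementary neighbourhood of \<open>h \<circ> f\<close> over a compact set \<open>A\<close>, cover \<open>A\<close> by finitely many compact
  pieces whose images under \<open>f\<close> lie in the interior of compact sets \<open>L\<close>, each contained in a chart of
  the middle manifold; on each piece the preceding convergence yields the required radius. When \<open>A\<close> runs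
  through a locally finite family, the sets \<open>L\<close> can be chosen locally finite as well: take compact sets
  \<open>C\<^sub>0 \<subseteq> C\<^sub>1 \<subseteq> \<dots>\<close> whose interiors cover the middle manifold and let the \<open>L\<close> belonging to \<open>A\<close> avoid every
  \<open>C\<^sub>i\<close> that does not meet \<open>f(A)\<close>. As \<open>f\<close> is proper, \<open>f\<^sup>-\<^sup>1(C\<^sub>i)\<close> is compact and meets only finitely many of
  the sets \<open>A\<close>.
\<close>

section \<open>Seminorms and locally convex spaces\<close>

text \<open>The target space is neither normed nor assumed complete, so derivatives are directional
  and every estimate uses one seminorm at a time. Directional derivatives alone give no chain rule,
  because \<open>f\<close> bends the line \<open>x + t y\<close> into a curve; strict
  differentiability, with moving base point and moving direction, absorbs the bend and also gives
  additivity in the direction. Partitions are lists of lists in which a new direction always comes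
  last, as it does in \<open>dk\<close>; the order of differentiation is thus kept and the symmetry
  of higher derivatives never enters. The finite-dimensional model spaces are abstract spaces with a
  finite basis, so \<open>supnorm\<close> must first be shown to describe their topology.

  No explicit radius is computed: if none worked, there would be pairs of bad maps at radii tending
  to 0, and the convergence statement refutes them. Moreover, a basic neighbourhood of some
  \<open>g\<close> can contain \<open>h \<circ> f\<close> away from its centre; the new data must
  fit into the gap that the distance from \<open>h \<circ> f\<close> to \<open>g\<close>
  leaves.\<close>

lemma seminorm_triangle: "seminorm p \<Longrightarrow> p (x + y) \<le> p x + p y"
  by (simp add: seminorm_def)

lemma seminorm_scaleR: "seminorm p \<Longrightarrow> p (c *\<^sub>R x) = \<bar>c\<bar> * p x"
  by (simp add: seminorm_def)

lemma seminorm_zero: "seminorm p \<Longrightarrow> p 0 = 0"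
  using seminorm_scaleR[of p 0 0] by simp

lemma seminorm_minus: "seminorm p \<Longrightarrow> p (- x) = p x"
  using seminorm_scaleR[of p "-1" x] by simp

lemma seminorm_diff_commute: "seminorm p \<Longrightarrow> p (x - y) = p (y - x)"
  using seminorm_minus[of p "x - y"] by simp

lemma seminorm_nonneg: "seminorm p \<Longrightarrow> 0 \<le> p x"
  using seminorm_triangle[of p x "- x"] by (simp add: seminorm_zero seminorm_minus)

lemma seminorm_diff_triangle: "seminorm p \<Longrightarrow> p (x - z) \<le> p (x - y) + p (y - z)"
  using seminorm_triangle[of p "x - y" "y - z"] by simp

lemma seminorm_diff_le: "seminorm p \<Longrightarrow> p (x - y) \<le> p x + p y"
  using seminorm_triangle[of p x "- y"] by (simp add: seminorm_minus)

lemma seminorm_le_diff: "seminorm p \<Longrightarrow> p x \<le> p y + p (x - y)"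
  using seminorm_triangle[of p y "x - y"] by simp

lemma seminorm_sum: "seminorm p \<Longrightarrow> p (\<Sum>i\<in>I. f i) \<le> (\<Sum>i\<in>I. p (f i))"
proof (induction I rule: infinite_finite_induct)
  case (insert i I)
  then show ?case
    using seminorm_triangle[of p "f i" "sum f I"] by simp
qed (simp_all add: seminorm_zero)

lemma cont_seminorms_imp_seminorm: "p \<in> cont_seminorms \<Longrightarrow> seminorm p"
  by (simp add: cont_seminorms_def)

context
  assumes lcs: "lcs TYPE('e::{real_vector,topological_space})"
begin

lemma lcs_tendsto_add:
  fixes f g :: "'t \<Rightarrow> 'e"
  assumes "(f \<longlongrightarrow> a) F" "(g \<longlongrightarrow> b) F"
  shows "((\<lambda>t. f t + g t) \<longlongrightarrow> a + b) F"
proof -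
  have "continuous_on UNIV (\<lambda>(x::'e, y). x + y)"
    using lcs by (simp add: lcs_def)
  from continuous_on_tendsto_compose[OF this tendsto_Pair[OF assms]] show ?thesis
    by simp
qed

lemma lcs_tendsto_scaleR:
  fixes g :: "'t \<Rightarrow> 'e"
  assumes "(c \<longlongrightarrow> a) F" "(g \<longlongrightarrow> b) F"
  shows "((\<lambda>t. c t *\<^sub>R g t) \<longlongrightarrow> a *\<^sub>R b) F"
proof -
  have "continuous_on UNIV (\<lambda>(c::real, x::'e). c *\<^sub>R x)"
    using lcs by (simp add: lcs_def)
  from continuous_on_tendsto_compose[OF this tendsto_Pair[OF assms]] show ?thesis
    by simp
qed

lemma lcs_tendsto_diff:
  fixes f g :: "'t \<Rightarrow> 'e"
  assumes "(f \<longlongrightarrow> a) F" "(g \<longlongrightarrow> b) F"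
  shows "((\<lambda>t. f t - g t) \<longlongrightarrow> a - b) F"
  using lcs_tendsto_add[OF assms(1) lcs_tendsto_scaleR[OF tendsto_const[of "-1"] assms(2)]] by simp

lemma lcs_tendsto_sum:
  fixes f :: "'i \<Rightarrow> 't \<Rightarrow> 'e"
  assumes "\<And>i. i \<in> I \<Longrightarrow> (f i \<longlongrightarrow> a i) F"
  shows "((\<lambda>t. \<Sum>i\<in>I. f i t) \<longlongrightarrow> (\<Sum>i\<in>I. a i)) F"
  using assms by (induction I rule: infinite_finite_induct) (simp_all add: lcs_tendsto_add)

lemma lcs_tendsto_sum_list:
  fixes f :: "'i \<Rightarrow> 't \<Rightarrow> 'e"
  assumes "\<And>i. i \<in> set is \<Longrightarrow> (f i \<longlongrightarrow> a i) F"
  shows "((\<lambda>t. \<Sum>i\<leftarrow>is. f i t) \<longlongrightarrow> (\<Sum>i\<leftarrow>is. a i)) F"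
  using assms by (induction "is") (simp_all add: lcs_tendsto_add)

lemma lcs_tendsto_unique:
  fixes f :: "'t \<Rightarrow> 'e"
  assumes "F \<noteq> bot" "(f \<longlongrightarrow> a) F" "(f \<longlongrightarrow> b) F"
  shows "a = b"
proof (rule ccontr)
  assume "a \<noteq> b"
  then obtain U V where UV: "open U" "open V" "a \<in> U" "b \<in> V" "U \<inter> V = {}"
    using lcs unfolding lcs_def by blast
  have "\<forall>\<^sub>F t in F. f t \<in> U" "\<forall>\<^sub>F t in F. f t \<in> V"
    using UV assms topological_tendstoD by blast+
  then have "\<forall>\<^sub>F t in F. False"
    by eventually_elim (use UV in blast)
  with assms(1) show False
    by simp
qed

lemma lcs_open_contains_ball:
  fixes x :: 'e
  assumes "open U" "x \<in> U"
  obtains p where "p \<in> cont_seminorms" "{y. p (y - x) < 1} \<subseteq> U"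
  using lcs assms unfolding lcs_def by blast

lemma lcs_tendsto_iff:
  fixes f :: "'t \<Rightarrow> 'e"
  shows "(f \<longlongrightarrow> a) F \<longleftrightarrow> (\<forall>p\<in>cont_seminorms. \<forall>e>0. \<forall>\<^sub>F t in F. p (f t - a) < e)"
    (is "?L \<longleftrightarrow> ?R")
proof
  assume ?L
  show ?R
  proof (intro ballI allI impI)
    fix p :: "'e \<Rightarrow> real" and e :: real
    assume p: "p \<in> cont_seminorms" and e: "0 < e"
    have "((\<lambda>t. f t - a) \<longlongrightarrow> a - a) F"
      by (intro lcs_tendsto_diff \<open>?L\<close> tendsto_const)
    moreover have "continuous_on UNIV p"
      using p by (simp add: cont_seminorms_def)
    ultimately have "((\<lambda>t. p (f t - a)) \<longlongrightarrow> p (a - a)) F"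
      using continuous_on_tendsto_compose by fastforce
    then show "\<forall>\<^sub>F t in F. p (f t - a) < e"
      using e p by (auto simp: seminorm_zero cont_seminorms_def dest: order_tendstoD(2))
  qed
next
  assume R: ?R
  show ?L
  proof (rule topological_tendstoI)
    fix U assume "open U" "a \<in> U"
    then obtain p where p: "p \<in> cont_seminorms" "{y. p (y - a) < 1} \<subseteq> U"
      by (rule lcs_open_contains_ball)
    with R have "\<forall>\<^sub>F t in F. p (f t - a) < 1"
      by simp
    then show "\<forall>\<^sub>F t in F. f t \<in> U"
      by eventually_elim (use p in blast)
  qed
qed

lemma lcs_open_ball:
  fixes x :: 'e
  assumes "p \<in> cont_seminorms"
  shows "open {y. p (y - x) < r}"
proof -
  have "continuous_on UNIV (\<lambda>y. p (y - x))"
  proof (rule continuous_on_compose2[of UNIV p])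
    show "continuous_on UNIV p"
      using assms by (simp add: cont_seminorms_def)
    show "continuous_on UNIV (\<lambda>y::'e. y - x)"
      by (auto simp: continuous_on_def intro!: lcs_tendsto_diff)
  qed auto
  then show ?thesis
    by (intro open_Collect_less) auto
qed

lemma lcs_eventually_line_in_open:
  fixes x :: 'e
  assumes "open U" "x \<in> U"
  shows "\<forall>\<^sub>F t in at (0::real). x + t *\<^sub>R y \<in> U"
proof -
  have "((\<lambda>t::real. x + t *\<^sub>R y) \<longlongrightarrow> x + 0 *\<^sub>R y) (at 0)"
    by (intro lcs_tendsto_add lcs_tendsto_scaleR tendsto_const tendsto_ident_at)
  then show ?thesis
    using assms topological_tendstoD by fastforce
qed

end

section \<open>Directional derivatives\<close>

text \<open>Bisection takes the place of an integral or of a reduction to scalar functions: the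
  estimate with slope \<open>M + e\<close> is additive over adjacent intervals and holds on every
  short interval around a given point. Comparing with a fixed vector \<open>c\<close>, rather than
  bounding the increment, is what strict differentiability needs later.\<close>

lemma seminorm_mean_value_inequality:
  fixes \<gamma> \<gamma>' :: "real \<Rightarrow> 'e::{real_vector,topological_space}"
  assumes lcs: "lcs TYPE('e)" and p: "p \<in> cont_seminorms"
    and deriv: "\<And>x. 0 \<le> x \<Longrightarrow> x \<le> 1 \<Longrightarrow> ((\<lambda>t. (1 / t) *\<^sub>R (\<gamma> (x + t) - \<gamma> x)) \<longlongrightarrow> \<gamma>' x) (at 0)"
    and bound: "\<And>x. 0 \<le> x \<Longrightarrow> x \<le> 1 \<Longrightarrow> p (\<gamma>' x - c) \<le> M"
  shows "p (\<gamma> 1 - \<gamma> 0 - c) \<le> M"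
proof (rule field_le_epsilon)
  note [simp] = cont_seminorms_imp_seminorm[OF p]
  fix e :: real assume e: "0 < e"
  define P where "P a b \<longleftrightarrow> p (\<gamma> b - \<gamma> a - (b - a) *\<^sub>R c) \<le> (M + e) * (b - a)" for a b
  have "P 0 1"
  proof (rule Bolzano)
    show "(0::real) \<le> 1" by simp
    fix a b d assume ab: "P a b" and bd: "P b d"
    have "\<gamma> d - \<gamma> a - (d - a) *\<^sub>R c = (\<gamma> b - \<gamma> a - (b - a) *\<^sub>R c) + (\<gamma> d - \<gamma> b - (d - b) *\<^sub>R c)"
      by (simp add: algebra_simps)
    then have "p (\<gamma> d - \<gamma> a - (d - a) *\<^sub>R c)
        \<le> p (\<gamma> b - \<gamma> a - (b - a) *\<^sub>R c) + p (\<gamma> d - \<gamma> b - (d - b) *\<^sub>R c)"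
      by (simp only: seminorm_triangle[OF cont_seminorms_imp_seminorm[OF p]])
    also have "\<dots> \<le> (M + e) * (b - a) + (M + e) * (d - b)"
      using ab bd unfolding P_def by (rule add_mono)
    finally show "P a d"
      by (simp add: P_def algebra_simps)
  next
    fix x :: real assume x: "0 \<le> x" "x \<le> 1"
    from deriv[OF x] have "\<forall>\<^sub>F t in at 0. p ((1 / t) *\<^sub>R (\<gamma> (x + t) - \<gamma> x) - \<gamma>' x) < e"
      using e p unfolding lcs_tendsto_iff[OF lcs] by blast
    then obtain d where d: "0 < d"
      and dd: "\<And>t. t \<noteq> 0 \<Longrightarrow> \<bar>t\<bar> < d \<Longrightarrow> p ((1 / t) *\<^sub>R (\<gamma> (x + t) - \<gamma> x) - \<gamma>' x) < e"
      unfolding eventually_at by (auto simp: dist_real_def)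
    have est: "p (\<gamma> (x + t) - \<gamma> x - t *\<^sub>R c) \<le> (M + e) * \<bar>t\<bar>" if "\<bar>t\<bar> < d" for t
    proof (cases "t = 0")
      case False
      have "\<gamma> (x + t) - \<gamma> x - t *\<^sub>R c
          = t *\<^sub>R (((1 / t) *\<^sub>R (\<gamma> (x + t) - \<gamma> x) - \<gamma>' x) + (\<gamma>' x - c))"
        using False by (simp add: algebra_simps)
      then have "p (\<gamma> (x + t) - \<gamma> x - t *\<^sub>R c)
          = \<bar>t\<bar> * p (((1 / t) *\<^sub>R (\<gamma> (x + t) - \<gamma> x) - \<gamma>' x) + (\<gamma>' x - c))"
        by (simp only: seminorm_scaleR[OF cont_seminorms_imp_seminorm[OF p]])
      also have "\<dots> \<le> \<bar>t\<bar> * (e + M)"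
        using dd[OF False that] bound[OF x]
          seminorm_triangle[of p "(1 / t) *\<^sub>R (\<gamma> (x + t) - \<gamma> x) - \<gamma>' x" "\<gamma>' x - c"]
        by (intro mult_left_mono) auto
      finally show ?thesis
        by (simp add: algebra_simps)
    qed (simp add: seminorm_zero)
    show "\<exists>d>0. \<forall>a b. a \<le> x \<and> x \<le> b \<and> b - a < d \<longrightarrow> P a b"
    proof (intro exI[of _ d] conjI allI impI)
      fix a b assume ab: "a \<le> x \<and> x \<le> b \<and> b - a < d"
      \<comment> \<open>The derivative is under control at \<open>x\<close> only, so the increment
        from \<open>a\<close> to \<open>b\<close> becomes a difference of two increments based at
        \<open>x\<close>. As \<open>x\<close> lies between \<open>a\<close> and \<open>b\<close>,
        their lengths add up to exactly \<open>b - a\<close>.\<close>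
      have "\<gamma> b - \<gamma> a - (b - a) *\<^sub>R c
          = (\<gamma> (x + (b - x)) - \<gamma> x - (b - x) *\<^sub>R c) - (\<gamma> (x + (a - x)) - \<gamma> x - (a - x) *\<^sub>R c)"
        by (simp add: algebra_simps)
      then have "p (\<gamma> b - \<gamma> a - (b - a) *\<^sub>R c)
          \<le> p (\<gamma> (x + (b - x)) - \<gamma> x - (b - x) *\<^sub>R c) + p (\<gamma> (x + (a - x)) - \<gamma> x - (a - x) *\<^sub>R c)"
        by (simp only: seminorm_diff_le[OF cont_seminorms_imp_seminorm[OF p]])
      also have "\<dots> \<le> (M + e) * \<bar>b - x\<bar> + (M + e) * \<bar>a - x\<bar>"
        using ab by (intro add_mono est) auto
      also have "\<dots> = (M + e) * (b - a)"
        using ab by (simp add: algebra_simps)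
      finally show "P a b"
        by (simp add: P_def)
    qed (fact d)
  qed
  then show "p (\<gamma> 1 - \<gamma> 0 - c) \<le> M + e"
    by (simp add: P_def)
qed

lemma dk_Nil [simp]: "dk f [] = f"
  by (simp add: dk_def)

lemma dk_append: "dk f (us @ vs) = dk (dk f us) vs"
  by (simp add: dk_def)

lemma dk_snoc: "dk f (us @ [v]) x = dirderiv (dk f us) x v"
  by (simp add: dk_def)

lemma dirderiv_eqI:
  fixes f :: "'a::real_vector \<Rightarrow> 'e::{real_vector,topological_space}"
  assumes "lcs TYPE('e)" "has_dirderiv f x y L"
  shows "dirderiv f x y = L"
  unfolding dirderiv_def
proof (rule the_equality)
  fix L' assume "has_dirderiv f x y L'"
  with assms show "L' = L"
    unfolding has_dirderiv_def by (metis at_neq_bot lcs_tendsto_unique)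
qed (fact assms(2))

lemma has_dirderiv_cong_open:
  fixes f g :: "'a::{real_vector,topological_space} \<Rightarrow> 'e::{real_vector,topological_space}"
  assumes "lcs TYPE('a)" "open U" "x \<in> U" "\<And>z. z \<in> U \<Longrightarrow> f z = g z"
  shows "has_dirderiv f x y L \<longleftrightarrow> has_dirderiv g x y L"
  unfolding has_dirderiv_def
proof (rule tendsto_cong)
  show "\<forall>\<^sub>F t in at 0. (1 / t) *\<^sub>R (f (x + t *\<^sub>R y) - f x) = (1 / t) *\<^sub>R (g (x + t *\<^sub>R y) - g x)"
    using lcs_eventually_line_in_open[OF assms(1-3), of y] by eventually_elim (simp add: assms)
qed

lemma dk_cong_open:
  fixes f g :: "'a::{real_vector,topological_space} \<Rightarrow> 'e::{real_vector,topological_space}"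
  assumes "lcs TYPE('a)" "open U" "\<And>z. z \<in> U \<Longrightarrow> f z = g z" "x \<in> U"
  shows "dk f ys x = dk g ys x"
  using assms(4)
proof (induction ys arbitrary: x rule: rev_induct)
  case (snoc y ys)
  then have "has_dirderiv (dk f ys) x y = has_dirderiv (dk g ys) x y"
    by (intro ext has_dirderiv_cong_open[OF assms(1,2)])
  then show ?case
    by (simp add: dk_snoc dirderiv_def)
qed (simp add: assms)

lemma has_dirderiv_scaleR_direction:
  fixes f :: "'a::real_vector \<Rightarrow> 'e::{real_vector,topological_space}"
  assumes lcs: "lcs TYPE('e)" and f: "has_dirderiv f x y L"
  shows "has_dirderiv f x (c *\<^sub>R y) (c *\<^sub>R L)"
proof (cases "c = 0")
  case False
  have "filterlim (\<lambda>t. t * c) (at 0) (at (0::real))"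
    using False by (auto simp: filterlim_at eventually_at_filter intro!: tendsto_eq_intros)
  from filterlim_compose[OF f[unfolded has_dirderiv_def] this]
  have "((\<lambda>t. c *\<^sub>R ((1 / (t * c)) *\<^sub>R (f (x + (t * c) *\<^sub>R y) - f x))) \<longlongrightarrow> c *\<^sub>R L) (at 0)"
    by (intro lcs_tendsto_scaleR[OF lcs] tendsto_const)
  then show ?thesis
    using False by (simp add: has_dirderiv_def)
qed (simp add: has_dirderiv_def)

lemma has_dirderiv_lin:
  fixes f g :: "'a::real_vector \<Rightarrow> 'e::{real_vector,topological_space}"
  assumes lcs: "lcs TYPE('e)" and fg: "has_dirderiv f x y L" "has_dirderiv g x y K"
  shows "has_dirderiv (\<lambda>x. a *\<^sub>R f x + b *\<^sub>R g x) x y (a *\<^sub>R L + b *\<^sub>R K)"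
proof -
  have "((\<lambda>t. a *\<^sub>R ((1 / t) *\<^sub>R (f (x + t *\<^sub>R y) - f x)) + b *\<^sub>R ((1 / t) *\<^sub>R (g (x + t *\<^sub>R y) - g x)))
      \<longlongrightarrow> a *\<^sub>R L + b *\<^sub>R K) (at 0)"
    using fg unfolding has_dirderiv_def
    by (intro lcs_tendsto_add[OF lcs] lcs_tendsto_scaleR[OF lcs] tendsto_const)
  then show ?thesis
    unfolding has_dirderiv_def by (simp add: algebra_simps)
qed

lemma has_dirderiv_sum_list:
  fixes f :: "'i \<Rightarrow> 'a::real_vector \<Rightarrow> 'e::{real_vector,topological_space}"
  assumes lcs: "lcs TYPE('e)" and "\<And>i. i \<in> set is \<Longrightarrow> has_dirderiv (f i) x y (L i)"
  shows "has_dirderiv (\<lambda>x. \<Sum>i\<leftarrow>is. f i x) x y (\<Sum>i\<leftarrow>is. L i)"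
  using assms(2)
proof (induction "is")
  case (Cons i "is")
  then show ?case
    using has_dirderiv_lin[OF lcs, of "f i" x y "L i" _ _ 1 1] by simp
qed (simp add: has_dirderiv_def)

lemma has_dirderiv_tendsto:
  fixes f :: "'a::real_vector \<Rightarrow> 'e::{real_vector,topological_space}"
  assumes lcs: "lcs TYPE('e)" and "has_dirderiv f x y L"
  shows "((\<lambda>t. f (x + t *\<^sub>R y)) \<longlongrightarrow> f x) (at 0)"
proof -
  have "((\<lambda>t. f x + t *\<^sub>R ((1 / t) *\<^sub>R (f (x + t *\<^sub>R y) - f x))) \<longlongrightarrow> f x + 0 *\<^sub>R L) (at 0)"
    using assms(2) unfolding has_dirderiv_def
    by (intro lcs_tendsto_add[OF lcs] lcs_tendsto_scaleR[OF lcs] tendsto_const tendsto_ident_at)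
  moreover have "\<forall>\<^sub>F t in at (0::real).
      f x + t *\<^sub>R ((1 / t) *\<^sub>R (f (x + t *\<^sub>R y) - f x)) = f (x + t *\<^sub>R y)"
    by (auto simp: eventually_at_filter)
  ultimately show ?thesis
    using tendsto_cong by fastforce
qed

section \<open>Smooth maps\<close>

text \<open>Convergence in the product topology of \<open>smooth_on\<close>, restated for the lists
  of directions that \<open>dk\<close> takes. The length is the same for all \<open>t\<close>, so
  that a single order of differentiation is involved.\<close>

definition list_tendsto :: "('t \<Rightarrow> 'a::topological_space list) \<Rightarrow> 'a list \<Rightarrow> 't filter \<Rightarrow> bool" where
  "list_tendsto Vs vs F \<longleftrightarrow> (\<forall>t. length (Vs t) = length vs) \<and>
     (\<forall>i<length vs. ((\<lambda>t. Vs t ! i) \<longlongrightarrow> vs ! i) F)"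

lemma list_tendsto_const: "list_tendsto (\<lambda>_. vs) vs F"
  by (simp add: list_tendsto_def)

lemma list_tendsto_Nil: "list_tendsto (\<lambda>_. []) [] F"
  by (simp add: list_tendsto_def)

lemma list_tendsto_singleton: "(V \<longlongrightarrow> v) F \<Longrightarrow> list_tendsto (\<lambda>t. [V t]) [v] F"
  by (simp add: list_tendsto_def)

lemma list_tendsto_append:
  assumes "list_tendsto Us us F" "list_tendsto Vs vs F"
  shows "list_tendsto (\<lambda>t. Us t @ Vs t) (us @ vs) F"
  unfolding list_tendsto_def
proof (intro conjI allI impI)
  fix i assume "i < length (us @ vs)"
  then show "((\<lambda>t. (Us t @ Vs t) ! i) \<longlongrightarrow> (us @ vs) ! i) F"
    using assms by (cases "i < length us") (auto simp: list_tendsto_def nth_append)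
qed (use assms in \<open>auto simp: list_tendsto_def\<close>)

lemma list_tendsto_drop:
  assumes "list_tendsto Vs vs F"
  shows "list_tendsto (\<lambda>t. drop n (Vs t)) (drop n vs) F"
  using assms by (auto simp: list_tendsto_def)

lemma list_tendsto_map:
  assumes "\<And>z. z \<in> set zs \<Longrightarrow> (G z \<longlongrightarrow> g z) F"
  shows "list_tendsto (\<lambda>t. map (\<lambda>z. G z t) zs) (map g zs) F"
  using assms by (auto simp: list_tendsto_def)

lemma list_tendsto_compose:
  assumes "list_tendsto Vs vs F" "filterlim h F G"
  shows "list_tendsto (\<lambda>t. Vs (h t)) vs G"
  using assms by (auto simp: list_tendsto_def intro: filterlim_compose[where f = h])

lemma smooth_on_open: "smooth_on U f \<Longrightarrow> open U"
  by (simp add: smooth_on_def)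

lemma smooth_on_ex_dirderiv: "smooth_on U f \<Longrightarrow> x \<in> U \<Longrightarrow> \<exists>L. has_dirderiv (dk f ys) x y L"
  by (simp add: smooth_on_def)

lemma smooth_on_has_dirderiv:
  fixes f :: "'a::{real_vector,topological_space} \<Rightarrow> 'e::{real_vector,topological_space}"
  assumes "lcs TYPE('e)" "smooth_on U f" "x \<in> U"
  shows "has_dirderiv (dk f ys) x y (dk f (ys @ [y]) x)"
  using assms unfolding smooth_on_def dk_snoc by (metis dirderiv_eqI)

lemma smooth_on_dk_tendsto:
  fixes f :: "'a::{real_vector,topological_space} \<Rightarrow> 'e::{real_vector,topological_space}"
  assumes f: "smooth_on U f" and x: "x \<in> U" and X: "(X \<longlongrightarrow> x) F" and V: "list_tendsto Vs vs F"
  shows "((\<lambda>t. dk f (Vs t) (X t)) \<longlongrightarrow> dk f vs x) F"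
proof -
  define k where "k = length vs"
  let ?T = "prod_topology (top_of_set U) (product_topology (\<lambda>_. euclidean) {..<k}) :: ('a \<times> (nat \<Rightarrow> 'a)) topology"
  have U: "open U" and cont: "continuous_map ?T euclidean (\<lambda>(x, v). dk f (map v [0..<k]) x)"
    using f by (simp_all add: smooth_on_def)
  \<comment> \<open>Points of the product topology are extensional functions, so a list has to be
    restricted to its index range before it becomes such a point.\<close>
  define r where "r ws = restrict ((!) ws) {..<k}" for ws :: "'a list"
  have r: "map (r ws) [0..<k] = ws" if "length ws = k" for ws
    using that by (auto simp: r_def intro!: nth_equalityI)
  have "limitin ?T (\<lambda>t. (X t, r (Vs t))) (x, r vs) F"
    unfolding limitin_pairwise o_def fst_conv snd_conv limitin_componentwise limitin_subtopology
  proof (intro conjI ballI)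
    show "\<forall>\<^sub>F t in F. X t \<in> U"
      using X U x topological_tendstoD by blast
    show "limitin euclidean (\<lambda>t. r (Vs t) i) (r vs i) F" if "i \<in> {..<k}" for i
      using V that by (auto simp: list_tendsto_def r_def k_def)
  qed (use x X in \<open>auto simp: r_def\<close>)
  from continuous_map_limit[OF cont this] show ?thesis
    using r V by (simp add: o_def k_def list_tendsto_def)
qed

lemma smooth_on_tendsto:
  fixes f :: "'a::{real_vector,topological_space} \<Rightarrow> 'e::{real_vector,topological_space}"
  assumes "smooth_on U f" "x \<in> U" "(X \<longlongrightarrow> x) F"
  shows "((\<lambda>t. f (X t)) \<longlongrightarrow> f x) F"
  using smooth_on_dk_tendsto[OF assms list_tendsto_Nil] by simp

lemma smooth_on_dk_continuous_on:
  fixes f :: "'a::{real_vector,topological_space} \<Rightarrow> 'e::{real_vector,topological_space}"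
  assumes "smooth_on U f"
  shows "continuous_on U (dk f ys)"
  unfolding continuous_on_def
  using smooth_on_dk_tendsto[OF assms _ tendsto_ident_at list_tendsto_const] by blast

text \<open>A premise cannot quantify over types, so the filter lives on the one type where it is
  needed: the points of \<open>?T k\<close>, on which continuity is tested with the filters
  \<open>atin\<close>.\<close>

lemma smooth_onI:
  fixes f :: "'a::{real_vector,topological_space} \<Rightarrow> 'e::{real_vector,topological_space}"
  assumes U: "open U"
    and deriv: "\<And>ys y x. x \<in> U \<Longrightarrow> \<exists>L. has_dirderiv (dk f ys) x y L"
    and cont: "\<And>(F::('a \<times> (nat \<Rightarrow> 'a)) filter) X x Vs vs. x \<in> U \<Longrightarrow> (X \<longlongrightarrow> x) F \<Longrightarrow> list_tendsto Vs vs F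
      \<Longrightarrow> ((\<lambda>t. dk f (Vs t) (X t)) \<longlongrightarrow> dk f vs x) F"
  shows "smooth_on U f"
proof -
  let ?T = "\<lambda>k. prod_topology (top_of_set U) (product_topology (\<lambda>_. euclidean) {..<k}) :: ('a \<times> (nat \<Rightarrow> 'a)) topology"
  have *: "continuous_map (?T k) euclidean (\<lambda>(x, v). dk f (map v [0..<k]) x)" for k
    unfolding continuous_map_atin
  proof
    fix z assume z: "z \<in> topspace (?T k)"
    let ?F = "atin (?T k) z"
    have "limitin (top_of_set U) fst (fst z) ?F"
      by (rule limitin_continuous_map[OF continuous_map_fst z refl])
    then have 1: "(fst \<longlongrightarrow> fst z) ?F"
      by (simp add: limitin_subtopology)
    have "limitin euclidean (\<lambda>w. snd w i) (snd z i) ?F" if "i < k" for i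
    proof (rule limitin_continuous_map[OF _ z refl])
      show "continuous_map (?T k) euclidean (\<lambda>w. snd w i)"
        using that continuous_map_compose[OF continuous_map_snd continuous_map_product_projection, of i "{..<k}"]
        by (auto simp: o_def)
    qed
    then have 2: "list_tendsto (\<lambda>w. map (snd w) [0..<k]) (map (snd z) [0..<k]) ?F"
      by (auto simp: list_tendsto_def)
    have "fst z \<in> U"
      using z by (simp add: mem_Times_iff)
    from cont[OF this 1 2]
    show "limitin euclidean (\<lambda>(x, v). dk f (map v [0..<k]) x) ((\<lambda>(x, v). dk f (map v [0..<k]) x) z) ?F"
      by (simp add: case_prod_unfold)
  qed
  \<comment> \<open>The case \<open>k = 0\<close>: with no directions, joint continuity of the
    derivative is continuity of \<open>f\<close> itself.\<close>
  have "continuous_map (top_of_set U) (?T 0) (\<lambda>x. (x, \<lambda>_. undefined))"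
    by (auto simp: continuous_map_pairwise o_def continuous_map_componentwise)
  from continuous_map_compose[OF this *[of 0]] have "continuous_on U f"
    by (simp add: o_def)
  then show ?thesis
    using U deriv * by (simp add: smooth_on_def)
qed

lemma smooth_on_subset:
  fixes f :: "'a::{real_vector,topological_space} \<Rightarrow> 'e::{real_vector,topological_space}"
  assumes "smooth_on U f" "open V" "V \<subseteq> U"
  shows "smooth_on V f"
proof (rule smooth_onI)
  show "\<exists>L. has_dirderiv (dk f ys) x y L" if "x \<in> V" for ys y x
    using assms that by (intro smooth_on_ex_dirderiv[of U]) auto
  show "((\<lambda>t. dk f (Vs t) (X t)) \<longlongrightarrow> dk f vs x) F"
    if x: "x \<in> V" and X: "(X \<longlongrightarrow> x) F" and V: "list_tendsto Vs vs F"
    for F :: "('a \<times> (nat \<Rightarrow> 'a)) filter" and X x Vs vs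
    using assms(3) x by (intro smooth_on_dk_tendsto[OF assms(1) _ X V]) auto
qed (fact assms(2))

lemma smooth_on_local:
  fixes f :: "'a::{real_vector,topological_space} \<Rightarrow> 'e::{real_vector,topological_space}"
  assumes "\<And>x. x \<in> U \<Longrightarrow> \<exists>V. x \<in> V \<and> V \<subseteq> U \<and> smooth_on V f"
  shows "smooth_on U f"
proof (rule smooth_onI)
  show "open U"
    by (subst open_subopen) (meson assms smooth_on_open)
  show "\<exists>L. has_dirderiv (dk f ys) x y L" if "x \<in> U" for ys y x
    using assms[OF that] smooth_on_ex_dirderiv by blast
  show "((\<lambda>t. dk f (Vs t) (X t)) \<longlongrightarrow> dk f vs x) F"
    if x: "x \<in> U" and X: "(X \<longlongrightarrow> x) F" and V: "list_tendsto Vs vs F"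
    for F :: "('a \<times> (nat \<Rightarrow> 'a)) filter" and X x Vs vs
    using assms[OF x] smooth_on_dk_tendsto[OF _ _ X V] by blast
qed

lemma smooth_on_cong:
  fixes f g :: "'a::{real_vector,topological_space} \<Rightarrow> 'e::{real_vector,topological_space}"
  assumes lcs: "lcs TYPE('a)" and f: "smooth_on U f" and eq: "\<And>x. x \<in> U \<Longrightarrow> f x = g x"
  shows "smooth_on U g"
proof -
  note U = smooth_on_open[OF f]
  have dk: "dk f ys x = dk g ys x" if "x \<in> U" for ys x
    using dk_cong_open[OF lcs U eq that] .
  show ?thesis
  proof (rule smooth_onI)
    show "\<exists>L. has_dirderiv (dk g ys) x y L" if "x \<in> U" for ys y x
      using smooth_on_ex_dirderiv[OF f that, of ys y]
        has_dirderiv_cong_open[OF lcs U that, of "dk f ys" "dk g ys" y] dk by simp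
    show "((\<lambda>t. dk g (Vs t) (X t)) \<longlongrightarrow> dk g vs x) F"
      if x: "x \<in> U" and X: "(X \<longlongrightarrow> x) F" and V: "list_tendsto Vs vs F"
      for F :: "('a \<times> (nat \<Rightarrow> 'a)) filter" and X x Vs vs
    proof -
      have "\<forall>\<^sub>F t in F. X t \<in> U"
        using X U x topological_tendstoD by blast
      then have "\<forall>\<^sub>F t in F. dk f (Vs t) (X t) = dk g (Vs t) (X t)"
        by eventually_elim (rule dk)
      then show ?thesis
        using smooth_on_dk_tendsto[OF f x X V] dk[OF x] tendsto_cong by fastforce
    qed
  qed (fact U)
qed

lemma smooth_on_dk:
  fixes f :: "'a::{real_vector,topological_space} \<Rightarrow> 'e::{real_vector,topological_space}"
  assumes f: "smooth_on U f"
  shows "smooth_on U (dk f us)"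
proof (rule smooth_onI)
  show "\<exists>L. has_dirderiv (dk (dk f us) ys) x y L" if "x \<in> U" for ys y x
    using smooth_on_ex_dirderiv[OF f that, of "us @ ys" y] by (simp add: dk_append)
  show "((\<lambda>t. dk (dk f us) (Vs t) (X t)) \<longlongrightarrow> dk (dk f us) vs x) F"
    if x: "x \<in> U" and X: "(X \<longlongrightarrow> x) F" and V: "list_tendsto Vs vs F"
    for F :: "('a \<times> (nat \<Rightarrow> 'a)) filter" and X x Vs vs
    using smooth_on_dk_tendsto[OF f x X list_tendsto_append[OF list_tendsto_const V]]
    by (simp add: dk_append)
qed (fact smooth_on_open[OF f])

context
  fixes f g :: "'a::{real_vector,topological_space} \<Rightarrow> 'e::{real_vector,topological_space}" and U
  assumes lcs: "lcs TYPE('a)" "lcs TYPE('e)" and smooth: "smooth_on U f" "smooth_on U g"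
begin

lemma dk_lin:
  assumes "x \<in> U"
  shows "dk (\<lambda>x. a *\<^sub>R f x + b *\<^sub>R g x) ys x = a *\<^sub>R dk f ys x + b *\<^sub>R dk g ys x"
  using assms
proof (induction ys arbitrary: x rule: rev_induct)
  case (snoc y ys)
  have "has_dirderiv (\<lambda>x. a *\<^sub>R dk f ys x + b *\<^sub>R dk g ys x) x y
      (a *\<^sub>R dk f (ys @ [y]) x + b *\<^sub>R dk g (ys @ [y]) x)"
    using snoc.prems lcs smooth by (intro has_dirderiv_lin smooth_on_has_dirderiv)
  then have "has_dirderiv (dk (\<lambda>x. a *\<^sub>R f x + b *\<^sub>R g x) ys) x y
      (a *\<^sub>R dk f (ys @ [y]) x + b *\<^sub>R dk g (ys @ [y]) x)"
    using has_dirderiv_cong_open[OF lcs(1) smooth_on_open[OF smooth(1)] snoc.prems,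
        of "dk (\<lambda>x. a *\<^sub>R f x + b *\<^sub>R g x) ys" "\<lambda>x. a *\<^sub>R dk f ys x + b *\<^sub>R dk g ys x"] snoc.IH by simp
  then show ?case
    unfolding dk_snoc[of "\<lambda>x. a *\<^sub>R f x + b *\<^sub>R g x"] by (intro dirderiv_eqI lcs)
qed simp

lemma smooth_on_lin: "smooth_on U (\<lambda>x. a *\<^sub>R f x + b *\<^sub>R g x)"
proof (rule smooth_onI)
  note U = smooth_on_open[OF smooth(1)]
  show "open U" by (fact U)
  show "\<exists>L. has_dirderiv (dk (\<lambda>x. a *\<^sub>R f x + b *\<^sub>R g x) ys) x y L" if "x \<in> U" for ys y x
    using has_dirderiv_lin[OF lcs(2) smooth_on_has_dirderiv[OF lcs(2) smooth(1) that, of ys y]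
        smooth_on_has_dirderiv[OF lcs(2) smooth(2) that, of ys y], of a b]
      has_dirderiv_cong_open[OF lcs(1) U that,
        of "dk (\<lambda>x. a *\<^sub>R f x + b *\<^sub>R g x) ys" "\<lambda>x. a *\<^sub>R dk f ys x + b *\<^sub>R dk g ys x"] dk_lin
    by auto
  show "((\<lambda>t. dk (\<lambda>x. a *\<^sub>R f x + b *\<^sub>R g x) (Vs t) (X t)) \<longlongrightarrow> dk (\<lambda>x. a *\<^sub>R f x + b *\<^sub>R g x) vs x) F"
    if x: "x \<in> U" and X: "(X \<longlongrightarrow> x) F" and V: "list_tendsto Vs vs F"
    for F :: "('a \<times> (nat \<Rightarrow> 'a)) filter" and X x Vs vs
  proof -
    have "((\<lambda>t. a *\<^sub>R dk f (Vs t) (X t) + b *\<^sub>R dk g (Vs t) (X t))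
        \<longlongrightarrow> a *\<^sub>R dk f vs x + b *\<^sub>R dk g vs x) F"
      by (intro lcs_tendsto_add[OF lcs(2)] lcs_tendsto_scaleR[OF lcs(2)] tendsto_const
          smooth_on_dk_tendsto[OF smooth(1) x X V] smooth_on_dk_tendsto[OF smooth(2) x X V])
    moreover have "\<forall>\<^sub>F t in F. X t \<in> U"
      using X U x topological_tendstoD by blast
    then have "\<forall>\<^sub>F t in F. a *\<^sub>R dk f (Vs t) (X t) + b *\<^sub>R dk g (Vs t) (X t)
        = dk (\<lambda>x. a *\<^sub>R f x + b *\<^sub>R g x) (Vs t) (X t)"
      by eventually_elim (simp add: dk_lin)
    ultimately show ?thesis
      using tendsto_cong dk_lin[OF x] by fastforce
  qed
qed

lemma dk_diff: "x \<in> U \<Longrightarrow> dk (\<lambda>x. f x - g x) ys x = dk f ys x - dk g ys x"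
  using dk_lin[of x 1 "-1" ys] by simp

lemma smooth_on_diff: "smooth_on U (\<lambda>x. f x - g x)"
  using smooth_on_lin[of 1 "-1"] by simp

end

text \<open>Turns uniformity over \<open>S\<close> into ordinary convergence along a product filter.
  Joint continuity then produces estimates that are uniform along a whole segment, with no separate
  compactness argument.\<close>

lemma eventually_prod_principal_Ball:
  "eventually (\<lambda>(t, s). P t s) (F \<times>\<^sub>F principal S) \<longleftrightarrow> (\<forall>\<^sub>F t in F. \<forall>s\<in>S. P t s)"
proof
  assume "eventually (\<lambda>(t, s). P t s) (F \<times>\<^sub>F principal S)"
  then obtain Q R where "eventually Q F" and R: "\<forall>s\<in>S. R s" "\<forall>t s. Q t \<longrightarrow> R s \<longrightarrow> P t s"
    unfolding eventually_prod_filter eventually_principal by auto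
  from this(1) show "\<forall>\<^sub>F t in F. \<forall>s\<in>S. P t s"
    by eventually_elim (use R in blast)
next
  assume "\<forall>\<^sub>F t in F. \<forall>s\<in>S. P t s"
  then show "eventually (\<lambda>(t, s). P t s) (F \<times>\<^sub>F principal S)"
    unfolding eventually_prod_filter eventually_principal
    by (intro exI[of _ "\<lambda>t. \<forall>s\<in>S. P t s"] exI[of _ "\<lambda>s. s \<in> S"]) auto
qed

text \<open>The directions vary with the parameter because in the formula of Faa di Bruno the directions of
  the outer derivatives move together with the base point.\<close>
lemma smooth_on_strict_dirderiv:
  fixes f :: "'a::{real_vector,topological_space} \<Rightarrow> 'e::{real_vector,topological_space}"
  assumes lcs: "lcs TYPE('a)" "lcs TYPE('e)" and f: "smooth_on U f" and x: "x \<in> U"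
    and X: "(X \<longlongrightarrow> x) F" and V: "list_tendsto Vs vs F" and W: "(W \<longlongrightarrow> w) F"
    and s: "(s \<longlongrightarrow> (0::real)) F" and s0: "\<forall>\<^sub>F t in F. s t \<noteq> 0"
  shows "((\<lambda>t. (1 / s t) *\<^sub>R (dk f (Vs t) (X t + s t *\<^sub>R W t) - dk f (Vs t) (X t)))
    \<longlongrightarrow> dk f (vs @ [w]) x) F"
  unfolding lcs_tendsto_iff[OF lcs(2)]
proof (intro ballI allI impI)
  fix p :: "'e \<Rightarrow> real" and e :: real
  assume p: "p \<in> cont_seminorms" and e: "0 < e"
  \<comment> \<open>The second coordinate is the position on the segment from \<open>X t\<close> to
    \<open>X t + s t W t\<close>. Along \<open>?G\<close> this position tends to \<open>x\<close>,
    so the derivative is close to its limit on the entire segment and the mean value inequality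
    applies.\<close>
  let ?G = "F \<times>\<^sub>F principal {0..1::real}"
  let ?L = "dk f (vs @ [w]) x"
  have fst: "filterlim fst F ?G"
    by (rule filterlim_fst)
  have "((\<lambda>z. snd z * s (fst z)) \<longlongrightarrow> 0) ?G"
  proof (rule Lim_null_comparison)
    show "((\<lambda>z. \<bar>s (fst z)\<bar>) \<longlongrightarrow> 0) ?G"
      using filterlim_compose[OF tendsto_rabs_zero[OF s] fst] .
    show "\<forall>\<^sub>F z in ?G. norm (snd z * s (fst z)) \<le> \<bar>s (fst z)\<bar>"
      unfolding eventually_prod_filter eventually_principal
      by (rule exI[of _ "\<lambda>_. True"], rule exI[of _ "\<lambda>r. r \<in> {0..1}"])
        (auto simp: abs_mult intro: mult_left_le_one_le)
  qed
  then have "((\<lambda>z. X (fst z) + (snd z * s (fst z)) *\<^sub>R W (fst z)) \<longlongrightarrow> x + 0 *\<^sub>R w) ?G"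
    by (intro lcs_tendsto_add[OF lcs(1)] lcs_tendsto_scaleR[OF lcs(1)]
        filterlim_compose[OF X fst] filterlim_compose[OF W fst])
  then have Z: "((\<lambda>z. X (fst z) + (snd z * s (fst z)) *\<^sub>R W (fst z)) \<longlongrightarrow> x) ?G"
    by simp
  have "list_tendsto (\<lambda>z. Vs (fst z) @ [W (fst z)]) (vs @ [w]) ?G"
    using list_tendsto_compose[OF list_tendsto_append[OF V list_tendsto_singleton[OF W]] fst] .
  from smooth_on_dk_tendsto[OF f x Z this]
  have "\<forall>\<^sub>F z in ?G. p (dk f (Vs (fst z) @ [W (fst z)]) (X (fst z) + (snd z * s (fst z)) *\<^sub>R W (fst z)) - ?L) < e / 2"
    using p half_gt_zero[OF e] unfolding lcs_tendsto_iff[OF lcs(2)] by blast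
  moreover have "\<forall>\<^sub>F z in ?G. X (fst z) + (snd z * s (fst z)) *\<^sub>R W (fst z) \<in> U"
    using Z smooth_on_open[OF f] x topological_tendstoD by blast
  ultimately have "\<forall>\<^sub>F (t, r) in ?G. X t + (r * s t) *\<^sub>R W t \<in> U \<and>
      p (dk f (Vs t @ [W t]) (X t + (r * s t) *\<^sub>R W t) - ?L) < e / 2"
    by eventually_elim (simp add: case_prod_beta)
  then have "\<forall>\<^sub>F t in F. \<forall>r\<in>{0..1}. X t + (r * s t) *\<^sub>R W t \<in> U \<and>
      p (dk f (Vs t @ [W t]) (X t + (r * s t) *\<^sub>R W t) - ?L) < e / 2"
    unfolding eventually_prod_principal_Ball .
  with s0 show "\<forall>\<^sub>F t in F. p ((1 / s t) *\<^sub>R (dk f (Vs t) (X t + s t *\<^sub>R W t) - dk f (Vs t) (X t)) - ?L) < e"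
  proof eventually_elim
    case (elim t)
    define \<gamma> where "\<gamma> r = dk f (Vs t) (X t + (r * s t) *\<^sub>R W t)" for r
    define \<gamma>' where "\<gamma>' r = s t *\<^sub>R dk f (Vs t @ [W t]) (X t + (r * s t) *\<^sub>R W t)" for r
    have "p (\<gamma> 1 - \<gamma> 0 - s t *\<^sub>R ?L) \<le> \<bar>s t\<bar> * (e / 2)"
    proof (rule seminorm_mean_value_inequality[OF lcs(2) p])
      fix r :: real assume r: "0 \<le> r" "r \<le> 1"
      then have "X t + (r * s t) *\<^sub>R W t \<in> U"
        using elim by simp
      from has_dirderiv_scaleR_direction[OF lcs(2) smooth_on_has_dirderiv[OF lcs(2) f this, of "Vs t" "W t"], of "s t"]
      show "((\<lambda>q. (1 / q) *\<^sub>R (\<gamma> (r + q) - \<gamma> r)) \<longlongrightarrow> \<gamma>' r) (at 0)"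
        by (simp add: has_dirderiv_def \<gamma>_def \<gamma>'_def algebra_simps)
      have "\<gamma>' r - s t *\<^sub>R ?L = s t *\<^sub>R (dk f (Vs t @ [W t]) (X t + (r * s t) *\<^sub>R W t) - ?L)"
        by (simp add: \<gamma>'_def algebra_simps)
      then have "p (\<gamma>' r - s t *\<^sub>R ?L) = \<bar>s t\<bar> * p (dk f (Vs t @ [W t]) (X t + (r * s t) *\<^sub>R W t) - ?L)"
        by (simp only: seminorm_scaleR[OF cont_seminorms_imp_seminorm[OF p]])
      then show "p (\<gamma>' r - s t *\<^sub>R ?L) \<le> \<bar>s t\<bar> * (e / 2)"
        using elim r by (auto intro!: mult_left_mono less_imp_le)
    qed
    moreover have "\<gamma> 1 - \<gamma> 0 - s t *\<^sub>R ?L = s t *\<^sub>R ((1 / s t) *\<^sub>R (\<gamma> 1 - \<gamma> 0) - ?L)"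
      using elim by (simp add: algebra_simps)
    then have "p (\<gamma> 1 - \<gamma> 0 - s t *\<^sub>R ?L) = \<bar>s t\<bar> * p ((1 / s t) *\<^sub>R (\<gamma> 1 - \<gamma> 0) - ?L)"
      by (simp only: seminorm_scaleR[OF cont_seminorms_imp_seminorm[OF p]])
    ultimately have "p ((1 / s t) *\<^sub>R (\<gamma> 1 - \<gamma> 0) - ?L) \<le> e / 2"
      using elim by simp
    then show ?case
      using e by (simp add: \<gamma>_def)
  qed
qed

section \<open>Multilinearity of the higher derivatives in their directions\<close>

context
  fixes f :: "'a::{real_vector,topological_space} \<Rightarrow> 'e::{real_vector,topological_space}" and U
  assumes lcs: "lcs TYPE('a)" "lcs TYPE('e)" and smooth: "smooth_on U f"
begin

text \<open>Homogeneity is a change of variable in the difference quotient. For additivity the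
  quotient in direction \<open>v + w\<close> is split at the point \<open>x + t v\<close>; its
  second half has a moving base point, hence the appeal to strict differentiability.\<close>

lemma dk_snoc_lin:
  assumes x: "x \<in> U"
  shows "dk f (us @ [a *\<^sub>R v + b *\<^sub>R w]) x = a *\<^sub>R dk f (us @ [v]) x + b *\<^sub>R dk f (us @ [w]) x"
proof -
  note deriv = smooth_on_has_dirderiv[OF lcs(2) smooth x, of us]
  have scale: "dk f (us @ [c *\<^sub>R u]) x = c *\<^sub>R dk f (us @ [u]) x" for c u
    using has_dirderiv_scaleR_direction[OF lcs(2) deriv[of u]] unfolding dk_snoc
    by (rule dirderiv_eqI[OF lcs(2)])
  have add: "dk f (us @ [v + w]) x = dk f (us @ [v]) x + dk f (us @ [w]) x" for v w
  proof -
    have X: "((\<lambda>t. x + t *\<^sub>R v) \<longlongrightarrow> x + 0 *\<^sub>R v) (at (0::real))"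
      by (intro lcs_tendsto_add[OF lcs(1)] lcs_tendsto_scaleR[OF lcs(1)] tendsto_const tendsto_ident_at)
    have "((\<lambda>t. (1 / t) *\<^sub>R (dk f us (x + t *\<^sub>R v + t *\<^sub>R w) - dk f us (x + t *\<^sub>R v))) \<longlongrightarrow> dk f (us @ [w]) x) (at 0)"
      using smooth_on_strict_dirderiv[OF lcs smooth x X[simplified] list_tendsto_const tendsto_const tendsto_ident_at]
      by (simp add: eventually_at_filter)
    from lcs_tendsto_add[OF lcs(2) this deriv[of v, unfolded has_dirderiv_def]]
    have "has_dirderiv (dk f us) x (v + w) (dk f (us @ [w]) x + dk f (us @ [v]) x)"
      by (simp add: has_dirderiv_def algebra_simps)
    then show ?thesis
      unfolding dk_snoc by (simp add: dirderiv_eqI[OF lcs(2)] add.commute)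
  qed
  show ?thesis
    by (simp add: add scale)
qed

text \<open>Linearity in an inner slot follows from linearity in the last one without permuting
  directions: the identity of \<open>dk_snoc_lin\<close> holds on all of the open set
  \<open>U\<close> and can be differentiated further along \<open>ws\<close>.\<close>

lemma dk_multilinear:
  assumes x: "x \<in> U"
  shows "dk f (us @ (a *\<^sub>R v + b *\<^sub>R w) # ws) x
    = a *\<^sub>R dk f (us @ v # ws) x + b *\<^sub>R dk f (us @ w # ws) x"
proof -
  have "dk f (us @ (a *\<^sub>R v + b *\<^sub>R w) # ws) x = dk (dk f (us @ [a *\<^sub>R v + b *\<^sub>R w])) ws x"
    by (simp flip: dk_append)
  also have "\<dots> = dk (\<lambda>x. a *\<^sub>R dk f (us @ [v]) x + b *\<^sub>R dk f (us @ [w]) x) ws x"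
    by (rule dk_cong_open[OF lcs(1) smooth_on_open[OF smooth] dk_snoc_lin x])
  also have "\<dots> = a *\<^sub>R dk (dk f (us @ [v])) ws x + b *\<^sub>R dk (dk f (us @ [w])) ws x"
    by (rule dk_lin[OF lcs smooth_on_dk[OF smooth] smooth_on_dk[OF smooth] x])
  finally show ?thesis
    by (simp flip: dk_append)
qed

lemma dk_multilinear_sum:
  assumes x: "x \<in> U" and "finite I"
  shows "dk f (us @ (\<Sum>i\<in>I. c i *\<^sub>R v i) # ws) x = (\<Sum>i\<in>I. c i *\<^sub>R dk f (us @ v i # ws) x)"
  using assms(2)
proof induction
  case empty
  show ?case
    using dk_multilinear[OF x, of us 0 0 0 0 ws] by simp
next
  case (insert i I)
  then show ?case
    using dk_multilinear[OF x, of us "c i" "v i" 1 "\<Sum>i\<in>I. c i *\<^sub>R v i" ws] by simp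
qed

text \<open>The product rule for the multilinear map \<open>dk f _ x\<close> at a fixed base point,
  along a curve of direction lists.\<close>

lemma dk_multilinear_quotient_tendsto:
  assumes x: "x \<in> U" and V: "list_tendsto Vs vs (at (0::real))"
    and W: "\<And>i. i < length vs \<Longrightarrow> ((\<lambda>t. (1 / t) *\<^sub>R (Vs t ! i - vs ! i)) \<longlongrightarrow> ws ! i) (at 0)"
  shows "((\<lambda>t. (1 / t) *\<^sub>R (dk f (Vs t) x - dk f vs x)) \<longlongrightarrow> (\<Sum>i<length vs. dk f (vs[i := ws ! i]) x)) (at 0)"
proof -
  \<comment> \<open>The telescope: the first \<open>j\<close> entries are already at their limits,
    the others still move. Consecutive members differ in a single slot, where multilinearity
    applies.\<close>
  define M where "M t j = take j vs @ drop j (Vs t)" for t j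
  have len: "length (Vs t) = length vs" for t
    using V unfolding list_tendsto_def by blast
  have "(1 / t) *\<^sub>R (dk f (Vs t) x - dk f vs x)
    = (\<Sum>j<length vs. dk f (take j vs @ ((1 / t) *\<^sub>R (Vs t ! j - vs ! j)) # drop (Suc j) (Vs t)) x)" for t
  proof -
    have "dk f (Vs t) x - dk f vs x = dk f (M t 0) x - dk f (M t (length vs)) x"
      by (simp add: M_def len)
    also have "\<dots> = (\<Sum>j<length vs. dk f (M t j) x - dk f (M t (Suc j)) x)"
      by (rule sum_lessThan_telescope'[symmetric])
    finally have "dk f (Vs t) x - dk f vs x = (\<Sum>j<length vs. dk f (M t j) x - dk f (M t (Suc j)) x)" .
    moreover have "(1 / t) *\<^sub>R (dk f (M t j) x - dk f (M t (Suc j)) x)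
        = dk f (take j vs @ ((1 / t) *\<^sub>R (Vs t ! j - vs ! j)) # drop (Suc j) (Vs t)) x" if "j < length vs" for j
    proof -
      have "M t j = take j vs @ (Vs t ! j) # drop (Suc j) (Vs t)"
        "M t (Suc j) = take j vs @ (vs ! j) # drop (Suc j) (Vs t)"
        using that by (simp_all add: M_def len Cons_nth_drop_Suc take_Suc_conv_app_nth)
      then show ?thesis
        using dk_multilinear[OF x, of "take j vs" "1 / t" "Vs t ! j" "- (1 / t)" "vs ! j" "drop (Suc j) (Vs t)"]
        by (simp add: algebra_simps)
    qed
    ultimately show ?thesis
      by (simp add: scaleR_sum_right)
  qed
  moreover have "((\<lambda>t. \<Sum>j<length vs. dk f (take j vs @ ((1 / t) *\<^sub>R (Vs t ! j - vs ! j)) # drop (Suc j) (Vs t)) x)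
      \<longlongrightarrow> (\<Sum>i<length vs. dk f (vs[i := ws ! i]) x)) (at 0)"
  proof (rule lcs_tendsto_sum[OF lcs(2)])
    fix j assume "j \<in> {..<length vs}"
    then have j: "j < length vs" by simp
    have "list_tendsto (\<lambda>t. take j vs @ [(1 / t) *\<^sub>R (Vs t ! j - vs ! j)] @ drop (Suc j) (Vs t))
        (take j vs @ [ws ! j] @ drop (Suc j) vs) (at 0)"
      by (intro list_tendsto_append list_tendsto_const list_tendsto_singleton list_tendsto_drop V W j)
    from smooth_on_dk_tendsto[OF smooth x tendsto_const this]
    show "((\<lambda>t. dk f (take j vs @ ((1 / t) *\<^sub>R (Vs t ! j - vs ! j)) # drop (Suc j) (Vs t)) x)
        \<longlongrightarrow> dk f (vs[j := ws ! j]) x) (at 0)"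
      using j by (simp add: upd_conv_take_nth_drop)
  qed
  ultimately show ?thesis
    by simp
qed

end

section \<open>The formula of Faa di Bruno\<close>

text \<open>The increment is split into two: first the base point moves while the directions are
  already the new ones, then the directions move at the fixed base point \<open>c x\<close>. Strict
  differentiability settles the former, the product rule the latter.\<close>

lemma has_dirderiv_dk_compose:
  fixes h :: "'b::{real_vector,topological_space} \<Rightarrow> 'e::{real_vector,topological_space}"
    and c :: "'a::real_vector \<Rightarrow> 'b"
  assumes lcs: "lcs TYPE('b)" "lcs TYPE('e)" and h: "smooth_on V h" and cx: "c x \<in> V"
    and c: "has_dirderiv c x y w"
    and len: "\<And>z. length (vs z) = n"
    and vs: "\<And>i. i < n \<Longrightarrow> has_dirderiv (\<lambda>z. vs z ! i) x y (ws ! i)"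
  shows "has_dirderiv (\<lambda>z. dk h (vs z) (c z)) x y
    (dk h (vs x @ [w]) (c x) + (\<Sum>i<n. dk h ((vs x)[i := ws ! i]) (c x)))"
proof -
  have V: "list_tendsto (\<lambda>t. vs (x + t *\<^sub>R y)) (vs x) (at 0)"
    using has_dirderiv_tendsto[OF lcs(1) vs] by (simp add: list_tendsto_def len)
  \<comment> \<open>With this choice \<open>c (x + t y) = c x + t W t\<close> for nonzero
    \<open>t\<close>, so the bent curve is read as a straight step in a varying direction that tends
    to \<open>w\<close>.\<close>
  define W where "W t = (1 / t) *\<^sub>R (c (x + t *\<^sub>R y) - c x)" for t
  have "(W \<longlongrightarrow> w) (at 0)"
    using c by (simp add: has_dirderiv_def W_def[abs_def])
  from smooth_on_strict_dirderiv[OF lcs h cx tendsto_const V this tendsto_ident_at]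
  have "((\<lambda>t. (1 / t) *\<^sub>R (dk h (vs (x + t *\<^sub>R y)) (c x + t *\<^sub>R W t) - dk h (vs (x + t *\<^sub>R y)) (c x)))
      \<longlongrightarrow> dk h (vs x @ [w]) (c x)) (at 0)"
    by (simp add: eventually_at_filter)
  moreover have "((\<lambda>t. (1 / t) *\<^sub>R (dk h (vs (x + t *\<^sub>R y)) (c x) - dk h (vs x) (c x)))
      \<longlongrightarrow> (\<Sum>i<length (vs x). dk h ((vs x)[i := ws ! i]) (c x))) (at 0)"
    using vs by (intro dk_multilinear_quotient_tendsto[OF lcs h cx V]) (simp add: has_dirderiv_def len)
  ultimately have "((\<lambda>t. (1 / t) *\<^sub>R (dk h (vs (x + t *\<^sub>R y)) (c x + t *\<^sub>R W t) - dk h (vs (x + t *\<^sub>R y)) (c x))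
        + (1 / t) *\<^sub>R (dk h (vs (x + t *\<^sub>R y)) (c x) - dk h (vs x) (c x)))
      \<longlongrightarrow> dk h (vs x @ [w]) (c x) + (\<Sum>i<n. dk h ((vs x)[i := ws ! i]) (c x))) (at 0)"
    unfolding len by (rule lcs_tendsto_add[OF lcs(2)])
  moreover have "\<forall>\<^sub>F t in at 0.
      (1 / t) *\<^sub>R (dk h (vs (x + t *\<^sub>R y)) (c x + t *\<^sub>R W t) - dk h (vs (x + t *\<^sub>R y)) (c x))
        + (1 / t) *\<^sub>R (dk h (vs (x + t *\<^sub>R y)) (c x) - dk h (vs x) (c x))
      = (1 / t) *\<^sub>R (dk h (vs (x + t *\<^sub>R y)) (c (x + t *\<^sub>R y)) - dk h (vs x) (c x))"
    by (simp add: eventually_at_filter W_def flip: scaleR_add_right)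
  ultimately show ?thesis
    unfolding has_dirderiv_def by (rule Lim_transform_eventually)
qed

text \<open>The set partitions of a list of directions, each partition being a list of blocks: a new
  direction either forms a block of its own or is appended to one of the existing blocks.\<close>

definition partition_step :: "'i \<Rightarrow> 'i list list \<Rightarrow> 'i list list list" where
  "partition_step y \<pi> = (\<pi> @ [[y]]) # map (\<lambda>i. \<pi>[i := \<pi> ! i @ [y]]) [0..<length \<pi>]"

definition list_partitions :: "'i list \<Rightarrow> 'i list list list" where
  "list_partitions = foldl (\<lambda>\<pi>s y. concat (map (partition_step y) \<pi>s)) [[]]"

lemma list_partitions_Nil: "list_partitions [] = [[]]"
  by (simp add: list_partitions_def)

lemma list_partitions_snoc:
  "list_partitions (ys @ [y]) = concat (map (partition_step y) (list_partitions ys))"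
  by (simp add: list_partitions_def)

lemma map_partition_step:
  "partition_step (v y) (map (map v) \<pi>) = map (map (map v)) (partition_step y \<pi>)"
  by (auto simp: partition_step_def map_update)

text \<open>Blocks are formed by position and not by value. A sum over the partitions of varying
  directions can thus be indexed by the fixed partitions of \<open>[0..<k]\<close>, which is what
  limits in the directions require.\<close>

lemma list_partitions_map: "list_partitions (map v ys) = map (map (map v)) (list_partitions ys)"
  by (induction ys rule: rev_induct)
    (simp_all add: list_partitions_Nil list_partitions_snoc map_concat o_def map_partition_step)

lemma sum_list_map_concat: "(\<Sum>x\<leftarrow>concat xss. g x) = (\<Sum>xs\<leftarrow>xss. \<Sum>x\<leftarrow>xs. g x)"
  by (induction xss) simp_all

text \<open>The number of blocks is the order of the outer derivative and the length of a block that
  of an inner one; both bounds together show that derivatives up to order \<open>r\<close> of the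
  factors control those of the composition.\<close>

lemma list_partitions_bounds:
  assumes "\<pi> \<in> set (list_partitions ys)"
  shows "length \<pi> \<le> length ys" "zs \<in> set \<pi> \<Longrightarrow> set zs \<subseteq> set ys \<and> length zs \<le> length ys"
proof -
  have "length \<pi> \<le> length ys \<and> (\<forall>zs\<in>set \<pi>. set zs \<subseteq> set ys \<and> length zs \<le> length ys)"
    using assms
  proof (induction ys arbitrary: \<pi> rule: rev_induct)
    case Nil
    then show ?case
      by (simp add: list_partitions_Nil)
  next
    case (snoc y ys)
    then obtain \<rho> where \<rho>: "\<rho> \<in> set (list_partitions ys)" and \<pi>: "\<pi> \<in> set (partition_step y \<rho>)"
      by (auto simp: list_partitions_snoc)
    note IH = snoc.IH[OF \<rho>]
    consider "\<pi> = \<rho> @ [[y]]" | i where "i < length \<rho>" "\<pi> = \<rho>[i := \<rho> ! i @ [y]]"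
      using \<pi> by (auto simp: partition_step_def)
    then show ?case
    proof cases
      case 1
      then show ?thesis
        using IH by (auto simp: le_SucI)
    next
      case 2
      then have "set \<pi> \<subseteq> insert (\<rho> ! i @ [y]) (set \<rho>)" "\<rho> ! i \<in> set \<rho>"
        by (auto simp: set_update_subset_insert)
      then show ?thesis
        using IH 2 by (fastforce simp: le_SucI)
    qed
  qed
  then show "length \<pi> \<le> length ys" "zs \<in> set \<pi> \<Longrightarrow> set zs \<subseteq> set ys \<and> length zs \<le> length ys"
    by blast+
qed

context
  fixes f :: "'a::{real_vector,topological_space} \<Rightarrow> 'b::{real_vector,topological_space}"
    and h :: "'b \<Rightarrow> 'e::{real_vector,topological_space}" and U V
  assumes lcs: "lcs TYPE('a)" "lcs TYPE('b)" "lcs TYPE('e)"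
    and f: "smooth_on U f" and h: "smooth_on V h" and fU: "f ` U \<subseteq> V"
begin

text \<open>The two summands of \<open>has_dirderiv_dk_compose\<close> match the two ways in which
  \<open>partition_step\<close> places \<open>y\<close>: motion of the base point opens a new block,
  motion of a direction enlarges its block.\<close>

lemma has_dirderiv_partition:
  assumes x: "x \<in> U"
  shows "has_dirderiv (\<lambda>x. dk h (map (\<lambda>zs. dk f zs x) \<pi>) (f x)) x y
    (\<Sum>\<rho>\<leftarrow>partition_step y \<pi>. dk h (map (\<lambda>zs. dk f zs x) \<rho>) (f x))"
proof -
  have "has_dirderiv (\<lambda>x. dk h (map (\<lambda>zs. dk f zs x) \<pi>) (f x)) x y
    (dk h (map (\<lambda>zs. dk f zs x) \<pi> @ [dk f [y] x]) (f x) +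
     (\<Sum>i<length \<pi>. dk h ((map (\<lambda>zs. dk f zs x) \<pi>)[i := map (\<lambda>zs. dk f (zs @ [y]) x) \<pi> ! i]) (f x)))"
  proof (rule has_dirderiv_dk_compose[OF lcs(2,3) h])
    show "f x \<in> V"
      using x fU by blast
    show "has_dirderiv f x y (dk f [y] x)"
      using smooth_on_has_dirderiv[OF lcs(2) f x, of "[]" y] by simp
    show "has_dirderiv (\<lambda>z. map (\<lambda>zs. dk f zs z) \<pi> ! i) x y (map (\<lambda>zs. dk f (zs @ [y]) x) \<pi> ! i)"
      if "i < length \<pi>" for i
      using smooth_on_has_dirderiv[OF lcs(2) f x, of "\<pi> ! i" y] that by simp
  qed simp
  moreover have "(\<Sum>i<length \<pi>. dk h ((map (\<lambda>zs. dk f zs x) \<pi>)[i := map (\<lambda>zs. dk f (zs @ [y]) x) \<pi> ! i]) (f x))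
      = (\<Sum>\<rho>\<leftarrow>map (\<lambda>i. \<pi>[i := \<pi> ! i @ [y]]) [0..<length \<pi>]. dk h (map (\<lambda>zs. dk f zs x) \<rho>) (f x))"
    by (simp add: o_def interv_sum_list_conv_sum_set_nat map_update atLeast0LessThan)
  ultimately show ?thesis
    by (simp add: partition_step_def)
qed

text \<open>Existence of the derivatives is a claim of its own, because \<open>dirderiv\<close> is a
  definite description and an equation about it guarantees no limit. The right-hand side
  \<open>S\<close> is differentiated first; equality on the open set \<open>U\<close> then transfers
  its derivatives to \<open>dk (h \<circ> f)\<close>.\<close>

lemma faa_di_bruno:
  assumes "x \<in> U"
  shows "dk (h \<circ> f) ys x = (\<Sum>\<pi>\<leftarrow>list_partitions ys. dk h (map (\<lambda>zs. dk f zs x) \<pi>) (f x))"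
    and "has_dirderiv (dk (h \<circ> f) ys) x y (dk (h \<circ> f) (ys @ [y]) x)"
proof -
  define S where "S ys x = (\<Sum>\<pi>\<leftarrow>list_partitions ys. dk h (map (\<lambda>zs. dk f zs x) \<pi>) (f x))" for ys x
  have S_deriv: "has_dirderiv (S ys) x y (S (ys @ [y]) x)" if "x \<in> U" for ys y x
  proof -
    have "S (ys @ [y]) x = (\<Sum>\<pi>\<leftarrow>list_partitions ys. \<Sum>\<rho>\<leftarrow>partition_step y \<pi>. dk h (map (\<lambda>zs. dk f zs x) \<rho>) (f x))"
      by (simp add: S_def list_partitions_snoc sum_list_map_concat o_def)
    moreover have "S ys = (\<lambda>x. \<Sum>\<pi>\<leftarrow>list_partitions ys. dk h (map (\<lambda>zs. dk f zs x) \<pi>) (f x))"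
      by (simp add: S_def[abs_def])
    ultimately show ?thesis
      using has_dirderiv_sum_list[OF lcs(3) has_dirderiv_partition[OF that]] by simp
  qed
  have eq: "dk (h \<circ> f) ys x = S ys x" if "x \<in> U" for ys x
    using that
  proof (induction ys arbitrary: x rule: rev_induct)
    case Nil
    then show ?case
      by (simp add: S_def list_partitions_Nil)
  next
    case (snoc y ys)
    have "has_dirderiv (dk (h \<circ> f) ys) x y (S (ys @ [y]) x)"
      using has_dirderiv_cong_open[OF lcs(1) smooth_on_open[OF f] snoc.prems, of "dk (h \<circ> f) ys" "S ys"]
        snoc.IH S_deriv[OF snoc.prems] by simp
    then show ?case
      unfolding dk_snoc by (rule dirderiv_eqI[OF lcs(3)])
  qed
  show "dk (h \<circ> f) ys x = (\<Sum>\<pi>\<leftarrow>list_partitions ys. dk h (map (\<lambda>zs. dk f zs x) \<pi>) (f x))"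
    using eq[OF assms] by (simp add: S_def)
  show "has_dirderiv (dk (h \<circ> f) ys) x y (dk (h \<circ> f) (ys @ [y]) x)"
    using has_dirderiv_cong_open[OF lcs(1) smooth_on_open[OF f] assms, of "dk (h \<circ> f) ys" "S ys"]
      S_deriv[OF assms] eq assms by simp
qed

lemma smooth_on_compose: "smooth_on U (h \<circ> f)"
proof (rule smooth_onI)
  note U = smooth_on_open[OF f]
  show "open U" by (fact U)
  show "\<exists>L. has_dirderiv (dk (h \<circ> f) ys) x y L" if "x \<in> U" for ys y x
    using faa_di_bruno(2)[OF that] by blast
  show "((\<lambda>t. dk (h \<circ> f) (Vs t) (X t)) \<longlongrightarrow> dk (h \<circ> f) vs x) F"
    if x: "x \<in> U" and X: "(X \<longlongrightarrow> x) F" and Vs: "list_tendsto Vs vs F"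
    for F :: "('a \<times> (nat \<Rightarrow> 'a)) filter" and X x Vs vs
  proof -
    define k where "k = length vs"
    \<comment> \<open>The index list no longer mentions the directions \<open>ws\<close>, so the
      limit can be taken term by term.\<close>
    define T where "T ws z = (\<Sum>\<pi>\<leftarrow>list_partitions [0..<k]. dk h (map (\<lambda>zs. dk f (map ((!) ws) zs) z) \<pi>) (f z))"
      for ws z
    have T: "dk (h \<circ> f) ws z = T ws z" if "length ws = k" "z \<in> U" for ws z
    proof -
      have "ws = map ((!) ws) [0..<k]"
        using map_nth[of ws] that(1) by simp
      then have "list_partitions ws = map (map (map ((!) ws))) (list_partitions [0..<k])"
        using list_partitions_map by metis
      then show ?thesis
        unfolding faa_di_bruno(1)[OF that(2)] T_def by (simp add: o_def)
    qed
    have len: "length (Vs t) = k" for t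
      using Vs unfolding list_tendsto_def k_def by blast
    have fx: "f x \<in> V"
      using x fU by blast
    have "((\<lambda>t. T (Vs t) (X t)) \<longlongrightarrow> T vs x) F"
      unfolding T_def
    proof (intro lcs_tendsto_sum_list[OF lcs(3)] smooth_on_dk_tendsto[OF h fx] list_tendsto_map
        smooth_on_tendsto[OF f x X] smooth_on_dk_tendsto[OF f x X])
      fix \<pi> zs i assume "\<pi> \<in> set (list_partitions [0..<k])" "zs \<in> set \<pi>" "i \<in> set zs"
      then have "i < k"
        using list_partitions_bounds(2) by fastforce
      then show "((\<lambda>t. Vs t ! i) \<longlongrightarrow> vs ! i) F"
        using Vs by (simp add: list_tendsto_def k_def)
    qed
    moreover have "\<forall>\<^sub>F t in F. X t \<in> U"
      using X U x topological_tendstoD by blast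
    then have "\<forall>\<^sub>F t in F. T (Vs t) (X t) = dk (h \<circ> f) (Vs t) (X t)"
      by eventually_elim (simp add: T len)
    ultimately show ?thesis
      using T[OF _ x] by (simp add: k_def Lim_transform_eventually)
  qed
qed

end

section \<open>Finite-dimensional spaces\<close>

lemma cont_seminorms_dominated:
  fixes q :: "'e::{real_vector,topological_space} \<Rightarrow> real"
  assumes lcs: "lcs TYPE('e)" and p: "p \<in> cont_seminorms" and q: "seminorm q"
    and le: "\<And>x. q x \<le> C * p x"
  shows "q \<in> cont_seminorms"
proof -
  have "(q \<longlongrightarrow> q x) (at x within UNIV)" for x
  proof (rule LIM_zero_cancel, rule Lim_null_comparison)
    show "\<forall>\<^sub>F y in at x. norm (q y - q x) \<le> C * p (y - x)"
    proof (intro always_eventually allI)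
      fix y
      show "norm (q y - q x) \<le> C * p (y - x)"
        using le[of "y - x"] seminorm_le_diff[OF q, of y x] seminorm_le_diff[OF q, of x y]
          seminorm_diff_commute[OF q, of x y] by (auto simp: abs_le_iff)
    qed
    have "((\<lambda>y. p (y - x)) \<longlongrightarrow> p (x - x)) (at x)"
      using p by (intro continuous_on_tendsto_compose[of UNIV p] lcs_tendsto_diff[OF lcs] tendsto_const tendsto_ident_at)
        (auto simp: cont_seminorms_def)
    then have "((\<lambda>y. p (y - x)) \<longlongrightarrow> 0) (at x)"
      by (simp add: seminorm_zero[OF cont_seminorms_imp_seminorm[OF p]])
    then show "((\<lambda>y. C * p (y - x)) \<longlongrightarrow> 0) (at x)"
      by (rule tendsto_mult_right_zero)
  qed
  then show ?thesis
    using q by (simp add: cont_seminorms_def continuous_on_def)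
qed

lemma cont_seminorms_sum:
  assumes "\<And>i. i \<in> I \<Longrightarrow> p i \<in> cont_seminorms"
  shows "(\<lambda>x. \<Sum>i\<in>I. p i x) \<in> cont_seminorms"
  using assms
  by (auto simp: cont_seminorms_def seminorm_def sum_distrib_left simp flip: sum.distrib
      intro!: continuous_on_sum sum_mono)

context
  fixes B :: "'b::{real_vector,topological_space} set"
  assumes lcs: "lcs TYPE('b)" and B: "finite_basis B"
begin

lemma basis_sum_representation: "(\<Sum>b\<in>B. representation B v b *\<^sub>R b) = v"
  using B by (intro sum_representation_eq) (auto simp: finite_basis_def)

lemma basis_representation_lin:
  "representation B (a *\<^sub>R v + c *\<^sub>R w) b = a * representation B v b + c * representation B w b"
  using B by (simp add: finite_basis_def representation_add representation_scale)

lemma basis_representation_diff: "representation B (v - w) b = representation B v b - representation B w b"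
  using basis_representation_lin[of 1 v "-1" w b] by simp

lemma basis_representation_sum:
  assumes "b \<in> B"
  shows "representation B (\<Sum>b\<in>B. c b *\<^sub>R b) b = c b"
proof -
  have ind: "independent B" and fin: "finite B" and sp: "v \<in> span B" for v
    using B by (auto simp: finite_basis_def)
  have "representation B (\<Sum>b\<in>B. c b *\<^sub>R b) b = (\<Sum>b'\<in>B. representation B (c b' *\<^sub>R b') b)"
    using representation_sum[OF ind, of B "\<lambda>b. c b *\<^sub>R b"] sp by simp
  also have "\<dots> = (\<Sum>b'\<in>B. if b' = b then c b' else 0)"
    by (intro sum.cong refl) (simp add: representation_scale[OF ind sp] representation_basis[OF ind])
  finally show ?thesis
    using assms fin by simp
qed

lemma representation_outside: "b \<notin> B \<Longrightarrow> representation B v b = 0"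
  using representation_ne_zero by blast

lemma representation_le_supnorm: "b \<in> B \<Longrightarrow> \<bar>representation B v b\<bar> \<le> supnorm B v"
  using B unfolding supnorm_def by (intro Max_ge) (auto simp: finite_basis_def)

lemma supnorm_nonneg: "0 \<le> supnorm B v"
  using B unfolding supnorm_def by (intro Max_ge) (auto simp: finite_basis_def)

lemma supnorm_le_iff: "supnorm B v \<le> c \<longleftrightarrow> 0 \<le> c \<and> (\<forall>b\<in>B. \<bar>representation B v b\<bar> \<le> c)"
  using B unfolding supnorm_def by (subst Max_le_iff) (auto simp: finite_basis_def)

lemma seminorm_supnorm: "seminorm (supnorm B)"
proof -
  have add: "supnorm B (x + y) \<le> supnorm B x + supnorm B y" for x y
    unfolding supnorm_le_iff
    using basis_representation_lin[of 1 x 1 y] representation_le_supnorm[of _ x] representation_le_supnorm[of _ y]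
    by (auto simp: supnorm_nonneg intro: order_trans[OF abs_triangle_ineq add_mono])
  have le: "supnorm B (c *\<^sub>R x) \<le> \<bar>c\<bar> * supnorm B x" for c x
    unfolding supnorm_le_iff
    using basis_representation_lin[of c x 0 0] representation_le_supnorm[of _ x]
    by (auto simp: supnorm_nonneg abs_mult intro: mult_left_mono)
  have "supnorm B (c *\<^sub>R x) = \<bar>c\<bar> * supnorm B x" for c x
  proof (cases "c = 0")
    case True
    then show ?thesis
      using le[of 0 x] supnorm_nonneg[of 0] by simp
  next
    case False
    then have "\<bar>c\<bar> * supnorm B x \<le> \<bar>c\<bar> * (\<bar>inverse c\<bar> * supnorm B (c *\<^sub>R x))"
      using le[of "inverse c" "c *\<^sub>R x"] by (intro mult_left_mono) auto
    also have "\<dots> = supnorm B (c *\<^sub>R x)"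
      using False by (simp add: abs_mult[symmetric] flip: mult.assoc)
    finally show ?thesis
      using le[of c x] by simp
  qed
  with add show ?thesis
    by (simp add: seminorm_def)
qed

lemma seminorm_le_supnorm:
  assumes p: "seminorm p"
  shows "p v \<le> (\<Sum>b\<in>B. p b) * supnorm B v"
proof -
  have "p v = p (\<Sum>b\<in>B. representation B v b *\<^sub>R b)"
    by (simp add: basis_sum_representation)
  also have "\<dots> \<le> (\<Sum>b\<in>B. \<bar>representation B v b\<bar> * p b)"
    using seminorm_sum[OF p, of "\<lambda>b. representation B v b *\<^sub>R b" B] by (simp add: seminorm_scaleR[OF p])
  also have "\<dots> \<le> (\<Sum>b\<in>B. supnorm B v * p b)"
    by (intro sum_mono mult_right_mono representation_le_supnorm seminorm_nonneg[OF p])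
  finally show ?thesis
    by (simp add: sum_distrib_left mult.commute)
qed

text \<open>Coordinate vectors are functions on the whole type; the value 0 off \<open>B\<close>
  makes every factor compact, so that the cube is a product of compact sets.\<close>

definition basis_cube :: "real \<Rightarrow> ('b \<Rightarrow> real) set" where
  "basis_cube e = (\<Pi>\<^sub>E b\<in>UNIV. if b \<in> B then {- e..e} else {0})"

lemma compact_basis_cube: "compact (basis_cube e)"
proof -
  have "compactin (product_topology (\<lambda>_. euclidean) UNIV) (basis_cube e)"
    unfolding basis_cube_def compactin_PiE by auto
  then show ?thesis
    by (simp add: euclidean_product_topology)
qed

lemma basis_combination_tendsto:
  "((\<lambda>c. \<Sum>b\<in>B. c b *\<^sub>R b) \<longlongrightarrow> (\<Sum>b\<in>B. c b *\<^sub>R b)) (at c within S)"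
proof (intro lcs_tendsto_sum[OF lcs] lcs_tendsto_scaleR[OF lcs] tendsto_const)
  show "((\<lambda>c. c b) \<longlongrightarrow> c b) (at c within S)" for b :: 'b
    using continuous_on_product_coordinates[of b] unfolding continuous_on_def
    by (blast intro: tendsto_within_subset)
qed

text \<open>The classical reason why a finite-dimensional Hausdorff space carries only one vector
  topology: the coordinate vectors of sup norm 1 form a compact set on which the linear combination
  never vanishes, each value is separated from 0 by some continuous seminorm, and finitely many of
  these suffice. Their sum dominates \<open>supnorm\<close> up to a factor.\<close>

lemma basis_separating_seminorm:
  obtains p where "p \<in> cont_seminorms" "\<And>v. supnorm B v \<le> 2 * p v"
proof -
  define T where "T c = (\<Sum>b\<in>B. c b *\<^sub>R b)" for c :: "'b \<Rightarrow> real"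
  define S where "S = basis_cube 1 \<inter> (\<Union>b\<in>B. {c. \<bar>c b\<bar> = 1})"
  have "closed {c :: 'b \<Rightarrow> real. \<bar>c b\<bar> = 1}" for b
    by (intro closed_Collect_eq continuous_intros continuous_on_product_coordinates)
  then have "compact S"
    unfolding S_def using B by (intro compact_Int_closed compact_basis_cube closed_UN) (auto simp: finite_basis_def)
  have "\<exists>p\<in>cont_seminorms. 1 \<le> p (T c)" if "c \<in> S" for c
  proof -
    obtain b where b: "b \<in> B" "\<bar>c b\<bar> = 1"
      using \<open>c \<in> S\<close> by (auto simp: S_def)
    have "T c \<noteq> 0"
    proof
      assume "T c = 0"
      then have "representation B 0 b = c b"
        using basis_representation_sum[OF b(1), of c] by (simp add: T_def)
      then show False
        using b by (simp add: representation_zero)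
    qed
    then obtain U where U: "open U" "0 \<in> U" "T c \<notin> U"
      using lcs unfolding lcs_def by blast
    then obtain p where p: "p \<in> cont_seminorms" "{y. p (y - 0) < 1} \<subseteq> U"
      using lcs_open_contains_ball[OF lcs] by blast
    then have "\<not> p (T c) < 1"
      using U(3) by auto
    then show ?thesis
      using p(1) by (auto simp: not_less)
  qed
  then obtain P where P: "\<And>c. c \<in> S \<Longrightarrow> P c \<in> cont_seminorms \<and> 1 \<le> P c (T c)"
    by metis
  \<comment> \<open>The threshold drops from 1 to 1/2 to obtain open sets around the points of
    \<open>S\<close>; this is the origin of the factor 2 in the conclusion.\<close>
  have op: "open {z. 1 / 2 < P c (T z)}" if "c \<in> S" for c
  proof -
    have "continuous_on UNIV (\<lambda>z. P c (T z))"
    proof (rule continuous_on_compose2[of UNIV "P c"])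
      show "continuous_on UNIV (P c)"
        using P[OF that] by (simp add: cont_seminorms_def)
      show "continuous_on UNIV T"
        using basis_combination_tendsto by (simp add: T_def[abs_def] continuous_on_def)
    qed simp
    then show ?thesis
      by (intro open_Collect_less) auto
  qed
  have cov: "S \<subseteq> (\<Union>c\<in>S. {z. 1 / 2 < P c (T z)})"
    using P by force
  obtain D where D: "D \<subseteq> S" "finite D" "S \<subseteq> (\<Union>c\<in>D. {z. 1 / 2 < P c (T z)})"
    using compactE_image[OF \<open>compact S\<close> op cov] by blast
  define p where "p v = (\<Sum>c\<in>D. P c v)" for v
  have p: "p \<in> cont_seminorms"
    using D P unfolding p_def[abs_def] by (intro cont_seminorms_sum) blast
  have "supnorm B v \<le> 2 * p v" for v
  proof (cases "supnorm B v = 0")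
    case True
    then show ?thesis
      using seminorm_nonneg[OF cont_seminorms_imp_seminorm[OF p], of v] by simp
  next
    case False
    define m where "m = supnorm B v"
    have m: "0 < m"
      using False supnorm_nonneg[of v] by (simp add: m_def)
    \<comment> \<open>The coordinates of \<open>v\<close>, normalised to have sup norm 1 and
      therefore to lie in \<open>S\<close>.\<close>
    define c where "c b = representation B v b / m" for b
    have "m \<in> insert 0 ((\<lambda>b. \<bar>representation B v b\<bar>) ` B)"
      unfolding m_def supnorm_def using B by (intro Max_in) (auto simp: finite_basis_def)
    then obtain b where "b \<in> B" "m = \<bar>representation B v b\<bar>"
      using m by auto
    then have "\<exists>b\<in>B. \<bar>c b\<bar> = 1"
      using m by (auto simp: c_def intro!: bexI[of _ b])
    have "\<bar>c b\<bar> \<le> 1" if "b \<in> B" for b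
      using representation_le_supnorm[OF that, of v] m by (simp add: c_def m_def)
    moreover have "c b = 0" if "b \<notin> B" for b
      using representation_outside[OF that] by (simp add: c_def)
    ultimately have "c \<in> basis_cube 1"
      by (auto simp: basis_cube_def abs_le_iff minus_le_iff)
    with \<open>\<exists>b\<in>B. \<bar>c b\<bar> = 1\<close> have "c \<in> S"
      by (auto simp: S_def)
    then obtain d where d: "d \<in> D" "1 / 2 < P d (T c)"
      using D by blast
    have "T c = (1 / m) *\<^sub>R v"
      by (simp add: T_def c_def basis_sum_representation divide_inverse mult.commute
          flip: scaleR_scaleR scaleR_sum_right)
    moreover have "0 \<le> P x (T c)" if "x \<in> D" for x
      using P[OF subsetD[OF D(1) that]] by (simp add: seminorm_nonneg cont_seminorms_imp_seminorm)
    then have "P d (T c) \<le> p (T c)"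
      unfolding p_def using d D by (intro member_le_sum) auto
    ultimately have "1 / 2 < p ((1 / m) *\<^sub>R v)"
      using d(2) by simp
    also have "\<dots> = p v / m"
      using m seminorm_scaleR[OF cont_seminorms_imp_seminorm[OF p], of "1 / m" v] by simp
    finally have "1 / 2 < p v / m" .
    then show ?thesis
      using m by (simp add: field_simps m_def)
  qed
  with p show thesis
    by (rule that)
qed

lemma supnorm_cont_seminorm: "supnorm B \<in> cont_seminorms"
  using basis_separating_seminorm cont_seminorms_dominated[OF lcs _ seminorm_supnorm] by metis

lemma open_contains_supnorm_ball:
  assumes "open U" "x \<in> U"
  obtains e where "0 < e" "{y. supnorm B (y - x) < e} \<subseteq> U"
proof -
  obtain p where p: "p \<in> cont_seminorms" "{y. p (y - x) < 1} \<subseteq> U"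
    using lcs_open_contains_ball[OF lcs assms] .
  let ?C = "\<Sum>b\<in>B. p b"
  have C: "0 \<le> ?C"
    by (intro sum_nonneg seminorm_nonneg cont_seminorms_imp_seminorm p)
  \<comment> \<open>The summand 1 avoids a division by zero when \<open>?C\<close> vanishes and
    makes the final estimate strict.\<close>
  have "p (y - x) < 1" if "supnorm B (y - x) < 1 / (?C + 1)" for y
  proof -
    have "p (y - x) \<le> ?C * supnorm B (y - x)"
      using p by (intro seminorm_le_supnorm cont_seminorms_imp_seminorm)
    also have "\<dots> \<le> ?C * (1 / (?C + 1))"
      using that C by (intro mult_left_mono) auto
    also have "\<dots> < 1"
      using C by (simp add: field_simps)
    finally show ?thesis .
  qed
  with p(2) C show thesis
    by (intro that[of "1 / (?C + 1)"]) auto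
qed

text \<open>Coordinates parametrise the ball continuously by a compact cube. This is the source of
  the compact neighbourhoods in the manifolds.\<close>

lemma compact_supnorm_cball: "compact {y. supnorm B (y - x) \<le> e}"
proof (cases "0 \<le> e")
  case True
  have "compact ((\<lambda>c. x + (\<Sum>b\<in>B. c b *\<^sub>R b)) ` basis_cube e)"
  proof (rule compact_continuous_image[OF _ compact_basis_cube])
    show "continuous_on (basis_cube e) (\<lambda>c. x + (\<Sum>b\<in>B. c b *\<^sub>R b))"
      unfolding continuous_on_def
      by (intro ballI lcs_tendsto_add[OF lcs] tendsto_const basis_combination_tendsto)
  qed
  also have "(\<lambda>c. x + (\<Sum>b\<in>B. c b *\<^sub>R b)) ` basis_cube e = {y. supnorm B (y - x) \<le> e}"
  proof safe
    fix c assume "c \<in> basis_cube e"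
    then have c: "\<bar>c b\<bar> \<le> e" if "b \<in> B" for b
      using that by (auto simp: basis_cube_def PiE_iff abs_le_iff dest!: spec[of _ b])
    show "supnorm B (x + (\<Sum>b\<in>B. c b *\<^sub>R b) - x) \<le> e"
      unfolding supnorm_le_iff using True c by (simp add: basis_representation_sum)
  next
    fix y assume y: "supnorm B (y - x) \<le> e"
    have "representation B (y - x) \<in> basis_cube e"
      using y unfolding supnorm_le_iff
      by (auto simp: basis_cube_def abs_le_iff minus_le_iff representation_outside)
    moreover have "y = x + (\<Sum>b\<in>B. representation B (y - x) b *\<^sub>R b)"
      by (simp add: basis_sum_representation)
    ultimately show "y \<in> (\<lambda>c. x + (\<Sum>b\<in>B. c b *\<^sub>R b)) ` basis_cube e"
      by blast
  qed
  finally show ?thesis .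
next
  case False
  then have "{y. supnorm B (y - x) \<le> e} = {}"
    using supnorm_nonneg by (auto simp: not_le intro: less_le_trans)
  then show ?thesis
    by simp
qed

end

section \<open>Uniform convergence of derivatives\<close>

text \<open>The pattern behind Lebesgue numbers and uniform continuity: a property that survives
  shrinking the radius and holds locally with some radius holds on a compact set with the least of
  finitely many radii.\<close>

lemma compact_uniform_radius:
  fixes Q :: "real \<Rightarrow> 'b::topological_space \<Rightarrow> bool"
  assumes K: "compact K"
    and local: "\<And>x. x \<in> K \<Longrightarrow> \<exists>d>0. \<exists>W. open W \<and> x \<in> W \<and> (\<forall>k\<in>W \<inter> K. Q d k)"
    and mono: "\<And>d d' k. Q d k \<Longrightarrow> 0 < d' \<Longrightarrow> d' \<le> d \<Longrightarrow> Q d' k"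
  shows "\<exists>d>0. \<forall>k\<in>K. Q d k"
proof -
  obtain d W where dW: "\<And>x. x \<in> K \<Longrightarrow> 0 < d x \<and> open (W x) \<and> x \<in> W x \<and> (\<forall>k\<in>W x \<inter> K. Q (d x) k)"
    using local by metis
  have op: "open (W x)" if "x \<in> K" for x
    using dW that by blast
  have cov: "K \<subseteq> (\<Union>x\<in>K. W x)"
    using dW by blast
  obtain D where D: "D \<subseteq> K" "finite D" "K \<subseteq> (\<Union>x\<in>D. W x)"
    using compactE_image[OF K op cov] by blast
  \<comment> \<open>The extra 1 keeps the minimum meaningful and positive when the finite cover is
    empty.\<close>
  let ?d = "Min (insert 1 (d ` D))"
  have pos: "0 < ?d"
    using D dW by (subst Min_gr_iff) auto
  have "Q ?d k" if k: "k \<in> K" for k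
  proof -
    obtain x where x: "x \<in> D" "k \<in> W x"
      using D k by blast
    then have "Q (d x) k"
      using dW D k by blast
    then show ?thesis
      using pos x D by (elim mono) auto
  qed
  with pos show ?thesis
    by blast
qed

lemma seminorm_bounded_on_compact:
  fixes g :: "'b::topological_space \<Rightarrow> 'e::{real_vector,topological_space}"
  assumes "compact K" "continuous_on K g" "p \<in> cont_seminorms"
  shows "\<exists>M. \<forall>k\<in>K. p (g k) \<le> M"
proof -
  have "continuous_on K (\<lambda>k. p (g k))"
    using assms(2,3) by (intro continuous_on_compose2[of UNIV p K g]) (auto simp: cont_seminorms_def)
  then have "compact ((\<lambda>k. p (g k)) ` K)"
    using assms(1) by (rule compact_continuous_image)
  then have "bdd_above ((\<lambda>k. p (g k)) ` K)"
    by (intro bounded_imp_bdd_above compact_imp_bounded)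
  then show ?thesis
    by (auto simp: bdd_above_def)
qed

context
  fixes B :: "'b::{real_vector,topological_space} set"
  assumes lcs: "lcs TYPE('b)" and B: "finite_basis B"
begin

lemma compact_supnorm_neighbourhood:
  assumes K: "compact K" and U: "open U" "K \<subseteq> U"
  obtains d where "0 < d" "\<And>k y. k \<in> K \<Longrightarrow> supnorm B (y - k) < d \<Longrightarrow> y \<in> U"
proof -
  note sn = seminorm_supnorm[OF lcs B]
  have "\<exists>d>0. \<forall>k\<in>K. \<forall>y. supnorm B (y - k) < d \<longrightarrow> y \<in> U"
  proof (rule compact_uniform_radius[OF K])
    fix x assume "x \<in> K"
    then obtain e where e: "0 < e" "{y. supnorm B (y - x) < e} \<subseteq> U"
      using open_contains_supnorm_ball[OF lcs B U(1)] U(2) by blast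
    let ?W = "{y. supnorm B (y - x) < e / 2}"
    have "y \<in> U" if "k \<in> ?W" "supnorm B (y - k) < e / 2" for k y
      using seminorm_diff_triangle[OF sn, of y x k] that e(2) by auto
    then show "\<exists>d>0. \<exists>W. open W \<and> x \<in> W \<and> (\<forall>k\<in>W \<inter> K. \<forall>y. supnorm B (y - k) < d \<longrightarrow> y \<in> U)"
      using e(1) lcs_open_ball[OF lcs supnorm_cont_seminorm[OF lcs B], of x "e / 2"]
      by (intro exI[of _ "e / 2"] conjI exI[of _ ?W]) (auto simp: seminorm_zero[OF sn])
  qed force
  then show thesis
    using that by blast
qed

text \<open>Heine-Cantor in one seminorm, by halving both radii around each point of
  \<open>K\<close>. Only \<open>k\<close> has to lie in the compact set, while \<open>y\<close> may
  be any point of \<open>U\<close> nearby.\<close>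

lemma compact_uniformly_continuous_seminorm:
  fixes g :: "'b \<Rightarrow> 'e::{real_vector,topological_space}"
  assumes lcse: "lcs TYPE('e)" and K: "compact K" and U: "open U" "K \<subseteq> U" and g: "continuous_on U g"
    and p: "p \<in> cont_seminorms" and e: "0 < e"
  obtains d where "0 < d" "\<And>k y. k \<in> K \<Longrightarrow> y \<in> U \<Longrightarrow> supnorm B (y - k) < d \<Longrightarrow> p (g y - g k) < e"
proof -
  note sn = seminorm_supnorm[OF lcs B]
  note pn = cont_seminorms_imp_seminorm[OF p]
  have "\<exists>d>0. \<forall>k\<in>K. \<forall>y\<in>U. supnorm B (y - k) < d \<longrightarrow> p (g y - g k) < e"
  proof (rule compact_uniform_radius[OF K])
    fix x assume "x \<in> K"
    then have x: "x \<in> U"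
      using U by blast
    have "open ((g -` {z. p (z - g x) < e / 2}) \<inter> U)"
      using continuous_on_open_vimage[OF U(1)] g lcs_open_ball[OF lcse p] by blast
    moreover have "x \<in> (g -` {z. p (z - g x) < e / 2}) \<inter> U"
      using x e by (simp add: seminorm_zero[OF pn])
    ultimately obtain d where d: "0 < d" "{y. supnorm B (y - x) < d} \<subseteq> (g -` {z. p (z - g x) < e / 2}) \<inter> U"
      using open_contains_supnorm_ball[OF lcs B] by blast
    let ?W = "{y. supnorm B (y - x) < d / 2}"
    have "p (g y - g k) < e" if "k \<in> ?W" "supnorm B (y - k) < d / 2" for k y
    proof -
      have "supnorm B (y - x) < d" "supnorm B (k - x) < d"
        using seminorm_diff_triangle[OF sn, of y x k] that d(1) by auto
      then have "p (g y - g x) < e / 2" "p (g k - g x) < e / 2"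
        using d(2) by auto
      then show ?thesis
        using seminorm_diff_triangle[OF pn, of "g y" "g k" "g x"] seminorm_diff_commute[OF pn, of "g k" "g x"]
        by simp
    qed
    then show "\<exists>d>0. \<exists>W. open W \<and> x \<in> W \<and> (\<forall>k\<in>W \<inter> K. \<forall>y\<in>U. supnorm B (y - k) < d \<longrightarrow> p (g y - g k) < e)"
      using d(1) lcs_open_ball[OF lcs supnorm_cont_seminorm[OF lcs B], of x "d / 2"]
      by (intro exI[of _ "d / 2"] conjI exI[of _ ?W]) (auto simp: seminorm_zero[OF sn])
  qed force
  then show thesis
    using that by blast
qed

end

text \<open>Uniform convergence with respect to a single seminorm, just as an elementary
  neighbourhood constrains a map through a single seminorm.\<close>

definition unif_tendsto ::
  "('e::real_vector \<Rightarrow> real) \<Rightarrow> 'x set \<Rightarrow> ('t \<Rightarrow> 'x \<Rightarrow> 'e) \<Rightarrow> ('x \<Rightarrow> 'e) \<Rightarrow> 't filter \<Rightarrow> bool" where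
  "unif_tendsto p A u l F \<longleftrightarrow> (\<forall>e>0. \<forall>\<^sub>F t in F. \<forall>a\<in>A. p (u t a - l a) < e)"

lemma unif_tendstoD: "unif_tendsto p A u l F \<Longrightarrow> 0 < e \<Longrightarrow> \<forall>\<^sub>F t in F. \<forall>a\<in>A. p (u t a - l a) < e"
  by (simp add: unif_tendsto_def)

lemma unif_tendsto_cong:
  assumes "unif_tendsto p A u l F"
    and "\<And>t a. a \<in> A \<Longrightarrow> u t a = u' t a" "\<And>a. a \<in> A \<Longrightarrow> l a = l' a"
  shows "unif_tendsto p A u' l' F"
  using assms by (simp add: unif_tendsto_def)

lemma unif_tendsto_zero: "seminorm p \<Longrightarrow> unif_tendsto p A (\<lambda>_ _. 0) (\<lambda>_. 0) F"
  by (simp add: unif_tendsto_def seminorm_zero)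

lemma unif_tendsto_add:
  assumes p: "seminorm p" and "unif_tendsto p A u l F" "unif_tendsto p A v m F"
  shows "unif_tendsto p A (\<lambda>t a. u t a + v t a) (\<lambda>a. l a + m a) F"
  unfolding unif_tendsto_def
proof (intro allI impI)
  fix e :: real assume "0 < e"
  then have "0 < e / 2" by simp
  then have "\<forall>\<^sub>F t in F. \<forall>a\<in>A. p (u t a - l a) < e / 2" "\<forall>\<^sub>F t in F. \<forall>a\<in>A. p (v t a - m a) < e / 2"
    using assms(2,3) unif_tendstoD by blast+
  then show "\<forall>\<^sub>F t in F. \<forall>a\<in>A. p (u t a + v t a - (l a + m a)) < e"
  proof eventually_elim
    case (elim t)
    show ?case
    proof
      fix a assume "a \<in> A"
      then have "p ((u t a - l a) + (v t a - m a)) < e"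
        using elim seminorm_triangle[OF p, of "u t a - l a" "v t a - m a"] by fastforce
      then show "p (u t a + v t a - (l a + m a)) < e"
        by (simp add: algebra_simps)
    qed
  qed
qed

lemma unif_tendsto_sum:
  assumes p: "seminorm p" and "\<And>i. i \<in> I \<Longrightarrow> unif_tendsto p A (u i) (l i) F"
  shows "unif_tendsto p A (\<lambda>t a. \<Sum>i\<in>I. u i t a) (\<lambda>a. \<Sum>i\<in>I. l i a) F"
  using assms(2)
  by (induction I rule: infinite_finite_induct) (auto simp: unif_tendsto_zero[OF p] intro: unif_tendsto_add[OF p])

lemma unif_tendsto_sum_list:
  assumes p: "seminorm p" and "\<And>i. i \<in> set is \<Longrightarrow> unif_tendsto p A (u i) (l i) F"
  shows "unif_tendsto p A (\<lambda>t a. \<Sum>i\<leftarrow>is. u i t a) (\<lambda>a. \<Sum>i\<leftarrow>is. l i a) F"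
  using assms(2)
  by (induction "is") (auto simp: unif_tendsto_zero[OF p] intro: unif_tendsto_add[OF p])

lemma unif_tendsto_scaleR:
  assumes p: "seminorm p" and c: "unif_tendsto abs A c c' F" and u: "unif_tendsto p A u l F"
    and M: "\<And>a. a \<in> A \<Longrightarrow> \<bar>c' a\<bar> \<le> M" and N: "\<And>a. a \<in> A \<Longrightarrow> p (l a) \<le> N"
  shows "unif_tendsto p A (\<lambda>t a. c t a *\<^sub>R u t a) (\<lambda>a. c' a *\<^sub>R l a) F"
  unfolding unif_tendsto_def
proof (intro allI impI)
  fix e :: real assume e: "0 < e"
  \<comment> \<open>Chosen so that the two error terms \<open>d (\<bar>N\<bar> + 1)\<close> and
    \<open>\<bar>M\<bar> d\<close> add up to \<open>d K\<close>. The bound \<open>d \<le> 1\<close>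
    keeps \<open>p (u t a)\<close> below \<open>\<bar>N\<bar> + 1\<close>, and the absolute values
    cover an empty \<open>A\<close>, where \<open>M\<close> and \<open>N\<close> may be
    negative.\<close>
  define K where "K = \<bar>M\<bar> + \<bar>N\<bar> + 1"
  define d where "d = min 1 (e / (2 * K))"
  have K: "0 < K"
    by (simp add: K_def add_nonneg_pos)
  then have d: "0 < d"
    using e by (simp add: d_def)
  from unif_tendstoD[OF c d] unif_tendstoD[OF u d]
  show "\<forall>\<^sub>F t in F. \<forall>a\<in>A. p (c t a *\<^sub>R u t a - c' a *\<^sub>R l a) < e"
  proof eventually_elim
    case (elim t)
    show ?case
    proof
      fix a assume a: "a \<in> A"
      have ua: "p (u t a) \<le> \<bar>N\<bar> + 1"
        using seminorm_le_diff[OF p, of "u t a" "l a"] elim a N[OF a] by (force simp: d_def)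
      have "c t a *\<^sub>R u t a - c' a *\<^sub>R l a = (c t a - c' a) *\<^sub>R u t a + c' a *\<^sub>R (u t a - l a)"
        by (simp add: algebra_simps)
      then have "p (c t a *\<^sub>R u t a - c' a *\<^sub>R l a) \<le> \<bar>c t a - c' a\<bar> * p (u t a) + \<bar>c' a\<bar> * p (u t a - l a)"
        using seminorm_triangle[OF p, of "(c t a - c' a) *\<^sub>R u t a" "c' a *\<^sub>R (u t a - l a)"]
        by (simp add: seminorm_scaleR[OF p])
      also have "\<dots> \<le> d * (\<bar>N\<bar> + 1) + \<bar>M\<bar> * d"
        using elim a ua M[OF a] d
        by (intro add_mono mult_mono) (auto simp: seminorm_nonneg[OF p] intro: less_imp_le order_trans)
      also have "\<dots> = d * K"
        by (simp add: K_def algebra_simps)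
      also have "\<dots> \<le> e / (2 * K) * K"
        using K by (intro mult_right_mono) (auto simp: d_def)
      also have "\<dots> < e"
        using K e by simp
      finally show "p (c t a *\<^sub>R u t a - c' a *\<^sub>R l a) < e" .
    qed
  qed
qed

lemma dk_basis_expansion:
  fixes h :: "'b::{real_vector,topological_space} \<Rightarrow> 'e::{real_vector,topological_space}"
  assumes lcs: "lcs TYPE('b)" "lcs TYPE('e)" and B: "finite_basis B" and h: "smooth_on V h" and y: "y \<in> V"
  shows "dk h (us @ v # ws) y = (\<Sum>b\<in>B. representation B v b *\<^sub>R dk h ((us @ [b]) @ ws) y)"
proof -
  have "dk h (us @ v # ws) y = dk h (us @ (\<Sum>b\<in>B. representation B v b *\<^sub>R b) # ws) y"
    by (simp add: basis_sum_representation[OF lcs(1) B])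
  also have "\<dots> = (\<Sum>b\<in>B. representation B v b *\<^sub>R dk h ((us @ [b]) @ ws) y)"
    using B dk_multilinear_sum[OF lcs h y, of B] by (simp add: finite_basis_def)
  finally show ?thesis .
qed

text \<open>Convergence is known for outer derivatives in basis directions only, whereas the inner
  derivatives \<open>g z a\<close> are arbitrary vectors. The induction expands one of them at a
  time: \<open>us\<close> collects the basis directions already produced, and
  \<open>length us + length zs\<close> stays constant. Boundedness of the limit is carried along
  because convergence of the products with coefficients relies on it.\<close>

lemma unif_tendsto_dk_multilinear:
  fixes h :: "'b::{real_vector,topological_space} \<Rightarrow> 'e::{real_vector,topological_space}"
    and g :: "'z \<Rightarrow> 'x \<Rightarrow> 'b"
  assumes lcs: "lcs TYPE('b)" "lcs TYPE('e)" and B: "finite_basis B" and p: "seminorm p"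
    and h: "smooth_on V h" and y: "\<And>a. a \<in> A \<Longrightarrow> y a \<in> V"
    and ht: "\<And>t. smooth_on (Vt t) (ht t)" and yt: "\<And>t a. a \<in> A \<Longrightarrow> yt t a \<in> Vt t"
    and conv: "\<And>\<beta>. set \<beta> \<subseteq> B \<Longrightarrow> length \<beta> \<le> r \<Longrightarrow>
      unif_tendsto p A (\<lambda>t a. dk (ht t) \<beta> (yt t a)) (\<lambda>a. dk h \<beta> (y a)) F"
    and bound: "\<And>\<beta>. set \<beta> \<subseteq> B \<Longrightarrow> length \<beta> \<le> r \<Longrightarrow> \<exists>M. \<forall>a\<in>A. p (dk h \<beta> (y a)) \<le> M"
    and g: "\<And>z b. z \<in> set zs \<Longrightarrow> b \<in> B \<Longrightarrow>
      unif_tendsto abs A (\<lambda>t a. representation B (gt t z a) b) (\<lambda>a. representation B (g z a) b) F"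
    and g_bound: "\<And>z b. z \<in> set zs \<Longrightarrow> b \<in> B \<Longrightarrow> \<exists>M. \<forall>a\<in>A. \<bar>representation B (g z a) b\<bar> \<le> M"
    and us: "set us \<subseteq> B" "length us + length zs \<le> r"
  shows "unif_tendsto p A (\<lambda>t a. dk (ht t) (us @ map (\<lambda>z. gt t z a) zs) (yt t a))
      (\<lambda>a. dk h (us @ map (\<lambda>z. g z a) zs) (y a)) F \<and>
    (\<exists>M. \<forall>a\<in>A. p (dk h (us @ map (\<lambda>z. g z a) zs) (y a)) \<le> M)"
  using g g_bound us
proof (induction zs arbitrary: us)
  case Nil
  then show ?case
    using conv bound by simp
next
  case (Cons z zs)
  let ?u = "\<lambda>b t a. dk (ht t) ((us @ [b]) @ map (\<lambda>z. gt t z a) zs) (yt t a)"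
  let ?l = "\<lambda>b a. dk h ((us @ [b]) @ map (\<lambda>z. g z a) zs) (y a)"
  have IH: "unif_tendsto p A (?u b) (?l b) F \<and> (\<exists>M. \<forall>a\<in>A. p (?l b a) \<le> M)" if "b \<in> B" for b
    using Cons.prems that by (intro Cons.IH) auto
  obtain N where N: "\<And>a b. b \<in> B \<Longrightarrow> a \<in> A \<Longrightarrow> p (?l b a) \<le> N b"
    using IH by metis
  obtain M where M: "\<And>a b. b \<in> B \<Longrightarrow> a \<in> A \<Longrightarrow> \<bar>representation B (g z a) b\<bar> \<le> M b"
    using Cons.prems(2)[of z] by (metis list.set_intros(1))
  have expand: "dk h (us @ map (\<lambda>z. g z a) (z # zs)) (y a) = (\<Sum>b\<in>B. representation B (g z a) b *\<^sub>R ?l b a)"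
    if "a \<in> A" for a
    using dk_basis_expansion[OF lcs B h y[OF that], where us = us and v = "g z a"] by simp
  have expandt: "dk (ht t) (us @ map (\<lambda>z. gt t z a) (z # zs)) (yt t a)
      = (\<Sum>b\<in>B. representation B (gt t z a) b *\<^sub>R ?u b t a)" if "a \<in> A" for a t
    using dk_basis_expansion[OF lcs B ht yt[OF that], where us = us and v = "gt t z a"] by simp
  have "unif_tendsto p A (\<lambda>t a. \<Sum>b\<in>B. representation B (gt t z a) b *\<^sub>R ?u b t a)
      (\<lambda>a. \<Sum>b\<in>B. representation B (g z a) b *\<^sub>R ?l b a) F"
  proof (rule unif_tendsto_sum[OF p])
    fix b assume b: "b \<in> B"
    show "unif_tendsto p A (\<lambda>t a. representation B (gt t z a) b *\<^sub>R ?u b t a)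
        (\<lambda>a. representation B (g z a) b *\<^sub>R ?l b a) F"
      using IH[OF b] Cons.prems(1)[of z b] b M[OF b] N[OF b] by (intro unif_tendsto_scaleR[OF p]) auto
  qed
  then have 1: "unif_tendsto p A (\<lambda>t a. dk (ht t) (us @ map (\<lambda>z. gt t z a) (z # zs)) (yt t a))
      (\<lambda>a. dk h (us @ map (\<lambda>z. g z a) (z # zs)) (y a)) F"
    by (rule unif_tendsto_cong) (simp_all only: expand expandt)
  have "p (dk h (us @ map (\<lambda>z. g z a) (z # zs)) (y a)) \<le> (\<Sum>b\<in>B. \<bar>M b\<bar> * \<bar>N b\<bar>)" if a: "a \<in> A" for a
  proof -
    have "p (dk h (us @ map (\<lambda>z. g z a) (z # zs)) (y a)) \<le> (\<Sum>b\<in>B. p (representation B (g z a) b *\<^sub>R ?l b a))"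
      unfolding expand[OF a] by (rule seminorm_sum[OF p])
    also have "\<dots> \<le> (\<Sum>b\<in>B. \<bar>M b\<bar> * \<bar>N b\<bar>)"
      unfolding seminorm_scaleR[OF p] using M[OF _ a] N[OF _ a]
      by (intro sum_mono mult_mono) (auto simp: seminorm_nonneg[OF p] intro: order_trans[OF _ abs_ge_self])
    finally show ?thesis .
  qed
  with 1 show ?case
    by blast
qed

text \<open>All the maps \<open>ft t\<close> have to send \<open>A\<close> into \<open>L\<close>,
  since the outer maps converge uniformly on \<open>L\<close> only. The formula of Faa di Bruno
  reduces the claim to sums of multilinear terms.\<close>

lemma unif_tendsto_dk_compose:
  fixes f :: "'a::{real_vector,topological_space} \<Rightarrow> 'b::{real_vector,topological_space}"
    and h :: "'b \<Rightarrow> 'e::{real_vector,topological_space}"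
  assumes lcs: "lcs TYPE('a)" "lcs TYPE('b)" "lcs TYPE('e)" and B: "finite_basis B"
    and p: "p \<in> cont_seminorms" and A: "compact A" and L: "compact L"
    and f: "smooth_on U f" "A \<subseteq> U" "f ` A \<subseteq> L" and h: "smooth_on V h" "L \<subseteq> V"
    and ft: "\<And>t. smooth_on (Ut t) (ft t)" "\<And>t. A \<subseteq> Ut t" "\<And>t. ft t ` A \<subseteq> L"
    and ht: "\<And>t. smooth_on (Vt t) (ht t)" "\<And>t. L \<subseteq> Vt t"
    and f_conv: "\<And>\<alpha>. set \<alpha> \<subseteq> Z \<Longrightarrow> length \<alpha> \<le> r \<Longrightarrow> unif_tendsto (supnorm B) A (\<lambda>t. dk (ft t) \<alpha>) (dk f \<alpha>) F"
    and h_conv: "\<And>\<beta>. set \<beta> \<subseteq> B \<Longrightarrow> length \<beta> \<le> r \<Longrightarrow> unif_tendsto p L (\<lambda>t. dk (ht t) \<beta>) (dk h \<beta>) F"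
    and \<alpha>: "set \<alpha> \<subseteq> Z" "length \<alpha> \<le> r"
  shows "unif_tendsto p A (\<lambda>t. dk (ht t \<circ> ft t) \<alpha>) (dk (h \<circ> f) \<alpha>) F"
proof -
  note pn = cont_seminorms_imp_seminorm[OF p]
  \<comment> \<open>The domain of \<open>g\<close> need not be mapped into that of \<open>k\<close>;
    it is cut down to the open preimage, which still contains \<open>A\<close>.\<close>
  have FdB: "dk (k \<circ> g) \<alpha> a = (\<Sum>\<pi>\<leftarrow>list_partitions \<alpha>. dk k (map (\<lambda>zs. dk g zs a) \<pi>) (g a))"
    if "smooth_on U' g" "A \<subseteq> U'" "g ` A \<subseteq> L" "smooth_on V' k" "L \<subseteq> V'" "a \<in> A"
    for g :: "'a \<Rightarrow> 'b" and k :: "'b \<Rightarrow> 'e" and U' V' a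
  proof -
    have "continuous_on U' g"
      using smooth_on_dk_continuous_on[OF that(1), of "[]"] by simp
    then have "open (g -` V' \<inter> U')"
      using continuous_on_open_vimage[OF smooth_on_open[OF that(1)]] smooth_on_open[OF that(4)] by blast
    then have g: "smooth_on (g -` V' \<inter> U') g"
      by (rule smooth_on_subset[OF that(1)]) simp
    show ?thesis
      by (rule faa_di_bruno(1)[OF lcs g that(4)]) (use that in auto)
  qed
  \<comment> \<open>The triangle inequality through \<open>dk h \<beta> (ft t a)\<close>: uniform
    convergence on \<open>L\<close> bounds one half, uniform continuity of
    \<open>dk h \<beta>\<close> near \<open>L\<close> the other.\<close>
  have base: "unif_tendsto p A (\<lambda>t a. dk (ht t) \<beta> (ft t a)) (\<lambda>a. dk h \<beta> (f a)) F"
    if \<beta>: "set \<beta> \<subseteq> B" "length \<beta> \<le> r" for \<beta>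
    unfolding unif_tendsto_def
  proof (intro allI impI)
    fix e :: real assume "0 < e"
    then have e: "0 < e / 2" by simp
    obtain d where d: "0 < d"
      "\<And>k y. k \<in> L \<Longrightarrow> y \<in> V \<Longrightarrow> supnorm B (y - k) < d \<Longrightarrow> p (dk h \<beta> y - dk h \<beta> k) < e / 2"
      using compact_uniformly_continuous_seminorm[OF lcs(2) B lcs(3) L smooth_on_open[OF h(1)] h(2)
          smooth_on_dk_continuous_on[OF h(1)] p e] by blast
    have "\<forall>\<^sub>F t in F. \<forall>a\<in>A. supnorm B (ft t a - f a) < d"
      using unif_tendstoD[OF f_conv[of "[]"] d(1)] by simp
    with unif_tendstoD[OF h_conv[OF \<beta>] e] show "\<forall>\<^sub>F t in F. \<forall>a\<in>A. p (dk (ht t) \<beta> (ft t a) - dk h \<beta> (f a)) < e"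
    proof eventually_elim
      case (elim t)
      show ?case
      proof
        fix a assume a: "a \<in> A"
        have "ft t a \<in> L" "f a \<in> L"
          using a ft(3) f(3) by blast+
        then have "p (dk (ht t) \<beta> (ft t a) - dk h \<beta> (ft t a)) < e / 2" "p (dk h \<beta> (ft t a) - dk h \<beta> (f a)) < e / 2"
          using elim a d(2) h(2) by blast+
        then show "p (dk (ht t) \<beta> (ft t a) - dk h \<beta> (f a)) < e"
          using seminorm_diff_triangle[OF pn, of "dk (ht t) \<beta> (ft t a)" "dk h \<beta> (f a)" "dk h \<beta> (ft t a)"] by simp
      qed
    qed
  qed
  have bound: "\<exists>M. \<forall>a\<in>A. p (dk h \<beta> (f a)) \<le> M" for \<beta>
    using seminorm_bounded_on_compact[OF L continuous_on_subset[OF smooth_on_dk_continuous_on[OF h(1)] h(2)] p]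
      f(3) by (meson image_subset_iff)
  have rep_conv: "unif_tendsto abs A (\<lambda>t a. representation B (dk (ft t) zs a) b) (\<lambda>a. representation B (dk f zs a) b) F"
    if "set zs \<subseteq> Z" "length zs \<le> r" "b \<in> B" for zs b
    unfolding unif_tendsto_def
  proof (intro allI impI)
    fix e :: real assume "0 < e"
    from unif_tendstoD[OF f_conv[OF that(1,2)] this]
    show "\<forall>\<^sub>F t in F. \<forall>a\<in>A. \<bar>representation B (dk (ft t) zs a) b - representation B (dk f zs a) b\<bar> < e"
    proof eventually_elim
      case (elim t)
      then show ?case
        using representation_le_supnorm[OF lcs(2) B that(3)]
        by (auto simp: basis_representation_diff[OF lcs(2) B, symmetric] intro: le_less_trans)
    qed
  qed
  have rep_bound: "\<exists>M. \<forall>a\<in>A. \<bar>representation B (dk f zs a) b\<bar> \<le> M" if "b \<in> B" for zs b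
    using seminorm_bounded_on_compact[OF A continuous_on_subset[OF smooth_on_dk_continuous_on[OF f(1)] f(2)]
        supnorm_cont_seminorm[OF lcs(2) B]] representation_le_supnorm[OF lcs(2) B that]
    by (meson order_trans)
  have "unif_tendsto p A (\<lambda>t a. \<Sum>\<pi>\<leftarrow>list_partitions \<alpha>. dk (ht t) (map (\<lambda>zs. dk (ft t) zs a) \<pi>) (ft t a))
      (\<lambda>a. \<Sum>\<pi>\<leftarrow>list_partitions \<alpha>. dk h (map (\<lambda>zs. dk f zs a) \<pi>) (f a)) F"
  proof (rule unif_tendsto_sum_list[OF pn])
    fix \<pi> assume \<pi>: "\<pi> \<in> set (list_partitions \<alpha>)"
    note bds = list_partitions_bounds[OF \<pi>]
    have zs: "set zs \<subseteq> Z \<and> length zs \<le> r" if "zs \<in> set \<pi>" for zs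
      using bds(2)[OF that] \<alpha> by auto
    have "unif_tendsto p A (\<lambda>t a. dk (ht t) ([] @ map (\<lambda>zs. dk (ft t) zs a) \<pi>) (ft t a))
        (\<lambda>a. dk h ([] @ map (\<lambda>zs. dk f zs a) \<pi>) (f a)) F \<and>
      (\<exists>M. \<forall>a\<in>A. p (dk h ([] @ map (\<lambda>zs. dk f zs a) \<pi>) (f a)) \<le> M)"
    proof (rule unif_tendsto_dk_multilinear[OF lcs(2,3) B pn h(1) _ ht(1) _ base bound])
      show "f a \<in> V" "ft t a \<in> Vt t" if "a \<in> A" for a t
        using that f(3) h(2) ft(3) ht(2) by blast+
      show "length [] + length \<pi> \<le> r"
        using bds(1) \<alpha>(2) by simp
    qed (use zs rep_conv rep_bound in auto)
    then show "unif_tendsto p A (\<lambda>t a. dk (ht t) (map (\<lambda>zs. dk (ft t) zs a) \<pi>) (ft t a))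
        (\<lambda>a. dk h (map (\<lambda>zs. dk f zs a) \<pi>) (f a)) F"
      by simp
  qed
  then show ?thesis
    by (rule unif_tendsto_cong)
      (simp_all add: FdB[OF f h] FdB[OF ft ht])
qed

section \<open>Smooth maps in charts\<close>

context
  fixes T :: "'m topology" and U and \<phi> :: "'m \<Rightarrow> 'a::{real_vector,topological_space}"
  assumes chart: "is_chart T (U, \<phi>)"
begin

lemma chart_openin: "openin T U"
  and chart_open_image_domain: "open (\<phi> ` U)"
  and chart_homeomorphic: "homeomorphic_map (subtopology T U) (top_of_set (\<phi> ` U)) \<phi>"
  using chart by (auto simp: is_chart_def)

lemma chart_subset_topspace: "U \<subseteq> topspace T"
  using chart_openin by (rule openin_subset)

lemma chart_inj_on: "inj_on \<phi> U"
  using homeomorphic_imp_injective_map[OF chart_homeomorphic] chart_subset_topspace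
  by (simp add: inf.absorb2)

lemma chart_inv: "x \<in> U \<Longrightarrow> inv_into U \<phi> (\<phi> x) = x"
  using chart_inj_on by simp

lemma chart_open_image_iff:
  assumes "S \<subseteq> U"
  shows "open (\<phi> ` S) \<longleftrightarrow> openin T S"
proof -
  have "openin (top_of_set (\<phi> ` U)) (\<phi> ` S) \<longleftrightarrow> openin (subtopology T U) S"
    using homeomorphic_map_openness[OF chart_homeomorphic] assms chart_subset_topspace
    by (simp add: inf.absorb2)
  then show ?thesis
    using assms chart_openin chart_open_image_domain
    by (simp add: openin_open_subtopology openin_open_eq image_mono)
qed

lemma chart_compact_image_iff:
  assumes "S \<subseteq> U"
  shows "compact (\<phi> ` S) \<longleftrightarrow> compactin T S"
proof -
  have "compactin (top_of_set (\<phi> ` U)) (\<phi> ` S) \<longleftrightarrow> compactin (subtopology T U) S"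
    using homeomorphic_map_compactness[OF chart_homeomorphic] assms chart_subset_topspace
    by (simp add: inf.absorb2)
  then show ?thesis
    using assms by (simp add: compactin_subtopology image_mono)
qed

end

text \<open>The condition of \<open>smooth_maps\<close> for one pair of charts, isolated so that
  compatibility of charts is the same condition for the identity and changes of charts are instances
  of composition.\<close>

definition chart_smooth ::
  "('m set \<times> ('m \<Rightarrow> 'a::{real_vector,topological_space})) \<Rightarrow> ('x set \<times> ('x \<Rightarrow> 'e::{real_vector,topological_space}))
    \<Rightarrow> ('m \<Rightarrow> 'x) \<Rightarrow> bool" where
  "chart_smooth c d f \<longleftrightarrow> (case c of (U, \<phi>) \<Rightarrow> case d of (V, \<psi>) \<Rightarrow>
     smooth_on (\<phi> ` (U \<inter> f -` V)) (\<psi> \<circ> f \<circ> inv_into U \<phi>))"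

lemma compatible_iff_chart_smooth: "compatible c d \<longleftrightarrow> chart_smooth c d id \<and> chart_smooth d c id"
  by (auto simp: compatible_def chart_smooth_def Int_commute split: prod.splits)

lemma chart_smooth_cong:
  fixes \<phi> :: "'m \<Rightarrow> 'a::{real_vector,topological_space}" and d :: "'x set \<times> ('x \<Rightarrow> 'e::{real_vector,topological_space})"
  assumes lcs: "lcs TYPE('a)" and f: "chart_smooth (U, \<phi>) d f" and eq: "\<And>x. x \<in> U \<Longrightarrow> f x = g x"
  shows "chart_smooth (U, \<phi>) d g"
proof -
  obtain V \<psi> where d: "d = (V, \<psi>)"
    by (cases d)
  have eqU: "U \<inter> g -` V = U \<inter> f -` V"
    using eq by auto
  have "smooth_on (\<phi> ` (U \<inter> f -` V)) (\<psi> \<circ> g \<circ> inv_into U \<phi>)"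
  proof (rule smooth_on_cong[OF lcs])
    show "smooth_on (\<phi> ` (U \<inter> f -` V)) (\<psi> \<circ> f \<circ> inv_into U \<phi>)"
      using f by (simp add: chart_smooth_def d)
    fix y assume "y \<in> \<phi> ` (U \<inter> f -` V)"
    then have "inv_into U \<phi> y \<in> U"
      by (auto intro: inv_into_into)
    then show "(\<psi> \<circ> f \<circ> inv_into U \<phi>) y = (\<psi> \<circ> g \<circ> inv_into U \<phi>) y"
      by (simp add: eq)
  qed
  then show ?thesis
    by (simp add: chart_smooth_def d eqU)
qed

text \<open>The middle chart may depend on the point, because smoothness is local. With
  \<open>f\<close> or \<open>h\<close> the identity the lemma changes charts in the source or in the
  target; in general it composes smooth maps.\<close>

lemma chart_smooth_compose:
  fixes \<phi> :: "'m \<Rightarrow> 'a::{real_vector,topological_space}" and \<psi> :: "'x \<Rightarrow> 'e::{real_vector,topological_space}"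
    and TN :: "'n topology"
  assumes lcs: "lcs TYPE('a)" "lcs TYPE('b::{real_vector,topological_space})" "lcs TYPE('e)"
    and c: "is_chart TM (U, \<phi>)" and V: "openin TX V"
    and f: "continuous_map TM TN f" and h: "continuous_map TN TX h"
    and factor: "\<And>x. x \<in> U \<Longrightarrow> h (f x) \<in> V \<Longrightarrow> \<exists>W (\<xi>::'n \<Rightarrow> 'b). is_chart TN (W, \<xi>) \<and> f x \<in> W \<and>
      chart_smooth (U, \<phi>) (W, \<xi>) f \<and> chart_smooth (W, \<xi>) (V, \<psi>) h"
  shows "chart_smooth (U, \<phi>) (V, \<psi>) (h \<circ> f)"
  unfolding chart_smooth_def prod.case
proof (rule smooth_on_local)
  fix y assume "y \<in> \<phi> ` (U \<inter> (h \<circ> f) -` V)"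
  then obtain x where x: "x \<in> U" "h (f x) \<in> V" "y = \<phi> x"
    by auto
  obtain W and \<xi> :: "'n \<Rightarrow> 'b" where W: "is_chart TN (W, \<xi>)" "f x \<in> W"
    "chart_smooth (U, \<phi>) (W, \<xi>) f" "chart_smooth (W, \<xi>) (V, \<psi>) h"
    using factor[OF x(1,2)] by blast
  define S where "S = U \<inter> ({x \<in> topspace TM. f x \<in> W} \<inter> {x \<in> topspace TM. h (f x) \<in> V})"
  have "openin TM S"
    unfolding S_def
    using openin_continuous_map_preimage[OF f chart_openin[OF W(1)]] chart_openin[OF c]
      openin_continuous_map_preimage[OF continuous_map_compose[OF f h] V]
    by (intro openin_Int) auto
  moreover have SU: "S \<subseteq> U"
    by (auto simp: S_def)
  ultimately have S: "open (\<phi> ` S)"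
    using chart_open_image_iff[OF c] by blast
  have "smooth_on (\<phi> ` S) (\<xi> \<circ> f \<circ> inv_into U \<phi>)"
    by (rule smooth_on_subset[OF W(3)[unfolded chart_smooth_def prod.case] S]) (auto simp: S_def)
  moreover have "smooth_on (\<xi> ` (W \<inter> h -` V)) (\<psi> \<circ> h \<circ> inv_into W \<xi>)"
    using W(4) by (simp add: chart_smooth_def)
  moreover have "(\<xi> \<circ> f \<circ> inv_into U \<phi>) ` (\<phi> ` S) \<subseteq> \<xi> ` (W \<inter> h -` V)"
    by (auto simp: S_def chart_inv[OF c])
  ultimately have "smooth_on (\<phi> ` S) ((\<psi> \<circ> h \<circ> inv_into W \<xi>) \<circ> (\<xi> \<circ> f \<circ> inv_into U \<phi>))"
    by (rule smooth_on_compose[OF lcs])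
  then have "smooth_on (\<phi> ` S) (\<psi> \<circ> (h \<circ> f) \<circ> inv_into U \<phi>)"
    by (rule smooth_on_cong[OF lcs(1)]) (auto simp: S_def chart_inv[OF c] chart_inv[OF W(1)])
  moreover have "y \<in> \<phi> ` S" "\<phi> ` S \<subseteq> \<phi> ` (U \<inter> (h \<circ> f) -` V)"
    using x W(2) chart_subset_topspace[OF c] by (auto simp: S_def)
  ultimately show "\<exists>S. y \<in> S \<and> S \<subseteq> \<phi> ` (U \<inter> (h \<circ> f) -` V) \<and> smooth_on S (\<psi> \<circ> (h \<circ> f) \<circ> inv_into U \<phi>)"
    by blast
qed

section \<open>Smooth maps in arbitrary compatible charts\<close>

lemma manifold_lcs: "manifold T (\<A> :: ('x set \<times> ('x \<Rightarrow> 'e::{real_vector,topological_space})) set) \<Longrightarrow> lcs TYPE('e)"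
  by (simp add: manifold_def)

lemma manifold_atlas_subset: "manifold T \<A> \<Longrightarrow> \<A> \<subseteq> charts_of T \<A>"
  by (auto simp: manifold_def charts_of_def)

lemma manifold_atlas_is_chart: "manifold T \<A> \<Longrightarrow> c \<in> \<A> \<Longrightarrow> is_chart T c"
  by (simp add: manifold_def)

lemma manifold_chart_at:
  assumes T: "manifold T \<A>" and x: "x \<in> topspace T"
  obtains U \<phi> where "(U, \<phi>) \<in> \<A>" "x \<in> U" "is_chart T (U, \<phi>)"
proof -
  have "topspace T = (\<Union>c\<in>\<A>. fst c)"
    using T by (simp add: manifold_def)
  with x obtain c where "c \<in> \<A>" "x \<in> fst c"
    by blast
  then show thesis
    using that[of "fst c" "snd c"] manifold_atlas_is_chart[OF T] by simp
qed

lemma charts_of_is_chart: "c \<in> charts_of T \<A> \<Longrightarrow> is_chart T c"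
  by (simp add: charts_of_def)

lemma smooth_maps_continuous_map: "f \<in> smooth_maps TM \<A>M TX \<A>X \<Longrightarrow> continuous_map TM TX f"
  by (simp add: smooth_maps_def)

lemma smooth_maps_in_topspace:
  "f \<in> smooth_maps TM \<A>M TX \<A>X \<Longrightarrow> x \<in> topspace TM \<Longrightarrow> f x \<in> topspace TX"
  by (meson smooth_maps_continuous_map continuous_map_image_subset_topspace image_subset_iff)

lemma smooth_maps_atlas:
  "f \<in> smooth_maps TM \<A>M TX \<A>X \<Longrightarrow> c \<in> \<A>M \<Longrightarrow> d \<in> \<A>X \<Longrightarrow> chart_smooth c d f"
  by (cases c; cases d) (simp add: smooth_maps_def chart_smooth_def split_beta Ball_def)

text \<open>Smoothness is tested on the atlases, but elementary neighbourhoods use any compatible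
  charts. The source chart is replaced first (composition with the identity on the right), then the
  target chart (on the left).\<close>

lemma smooth_maps_charts:
  fixes \<A>M :: "('m set \<times> ('m \<Rightarrow> 'a::{real_vector,topological_space})) set"
    and \<A>X :: "('x set \<times> ('x \<Rightarrow> 'e::{real_vector,topological_space})) set"
  assumes M: "manifold TM \<A>M" and X: "manifold TX \<A>X" and f: "f \<in> smooth_maps TM \<A>M TX \<A>X"
    and c: "c \<in> charts_of TM \<A>M" and d: "d \<in> charts_of TX \<A>X"
  shows "chart_smooth c d f"
proof -
  obtain U \<phi> V \<psi> where cd: "c = (U, \<phi>)" "d = (V, \<psi>)"
    by (cases c, cases d)
  have cch: "is_chart TM (U, \<phi>)" and dch: "is_chart TX (V, \<psi>)"
    using c d charts_of_is_chart cd by blast+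
  note lcs = manifold_lcs[OF M] manifold_lcs[OF X]
  note contf = smooth_maps_continuous_map[OF f]
  have step: "chart_smooth (U, \<phi>) (V', \<psi>') f" if d': "(V', \<psi>') \<in> \<A>X" for V' \<psi>'
  proof -
    have "openin TX V'"
      by (rule chart_openin[OF manifold_atlas_is_chart[OF X d']])
    then have "chart_smooth (U, \<phi>) (V', \<psi>') (f \<circ> id)"
    proof (rule chart_smooth_compose[OF lcs(1) lcs(1) lcs(2) cch _ continuous_map_id contf])
      fix x assume "x \<in> U"
      then have "x \<in> topspace TM"
        using chart_subset_topspace[OF cch] by blast
      then obtain U0 \<phi>0 where "(U0, \<phi>0) \<in> \<A>M" "x \<in> U0" "is_chart TM (U0, \<phi>0)"
        using manifold_chart_at[OF M] by blast
      moreover from this have "chart_smooth (U, \<phi>) (U0, \<phi>0) id"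
        using c cd by (simp add: charts_of_def compatible_iff_chart_smooth)
      ultimately show "\<exists>W (\<xi>::'m \<Rightarrow> 'a). is_chart TM (W, \<xi>) \<and> id x \<in> W \<and> chart_smooth (U, \<phi>) (W, \<xi>) id \<and>
          chart_smooth (W, \<xi>) (V', \<psi>') f"
        using smooth_maps_atlas[OF f _ d'] by auto
    qed
    then show ?thesis
      by simp
  qed
  have "chart_smooth (U, \<phi>) (V, \<psi>) (id \<circ> f)"
  proof (rule chart_smooth_compose[OF lcs(1) lcs(2) lcs(2) cch chart_openin[OF dch] contf continuous_map_id])
    fix x assume "x \<in> U"
    then have "f x \<in> topspace TX"
      using chart_subset_topspace[OF cch] smooth_maps_in_topspace[OF f] by blast
    then obtain V0 \<psi>0 where "(V0, \<psi>0) \<in> \<A>X" "f x \<in> V0" "is_chart TX (V0, \<psi>0)"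
      using manifold_chart_at[OF X] by blast
    moreover from this have "chart_smooth (V0, \<psi>0) (V, \<psi>) id"
      using d cd by (simp add: charts_of_def compatible_iff_chart_smooth)
    ultimately show "\<exists>W (\<xi>::'x \<Rightarrow> 'e). is_chart TX (W, \<xi>) \<and> f x \<in> W \<and> chart_smooth (U, \<phi>) (W, \<xi>) f \<and>
        chart_smooth (W, \<xi>) (V, \<psi>) id"
      using step by blast
  qed
  then show ?thesis
    by (simp add: cd)
qed

text \<open>The restriction restores the convention that smooth maps are \<open>undefined\<close>
  off the carrier, which makes equality of functions the equality of maps on the manifold.\<close>

lemma smooth_maps_compose:
  fixes \<A>M :: "('m set \<times> ('m \<Rightarrow> 'a::{real_vector,topological_space})) set"
    and \<A>N :: "('n set \<times> ('n \<Rightarrow> 'b::{real_vector,topological_space})) set"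
    and \<A>X :: "('x set \<times> ('x \<Rightarrow> 'e::{real_vector,topological_space})) set"
  assumes M: "manifold TM \<A>M" and N: "manifold TN \<A>N" and X: "manifold TX \<A>X"
    and f: "f \<in> smooth_maps TM \<A>M TN \<A>N" and h: "h \<in> smooth_maps TN \<A>N TX \<A>X"
  shows "restrict (h \<circ> f) (topspace TM) \<in> smooth_maps TM \<A>M TX \<A>X"
proof -
  note contf = smooth_maps_continuous_map[OF f] and conth = smooth_maps_continuous_map[OF h]
  have "continuous_map TM TX (h \<circ> f)"
    by (rule continuous_map_compose[OF contf conth])
  then have 1: "continuous_map TM TX (restrict (h \<circ> f) (topspace TM))"
    by (rule continuous_map_eq) simp
  have 2: "chart_smooth (U, \<phi>) (V, \<psi>) (restrict (h \<circ> f) (topspace TM))"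
    if c: "(U, \<phi>) \<in> \<A>M" and d: "(V, \<psi>) \<in> \<A>X" for U \<phi> V \<psi>
  proof (rule chart_smooth_cong[OF manifold_lcs[OF M]])
    have cch: "is_chart TM (U, \<phi>)" and dch: "is_chart TX (V, \<psi>)"
      using manifold_atlas_is_chart[OF M c] manifold_atlas_is_chart[OF X d] .
    show "chart_smooth (U, \<phi>) (V, \<psi>) (h \<circ> f)"
    proof (rule chart_smooth_compose[OF manifold_lcs[OF M] manifold_lcs[OF N] manifold_lcs[OF X] cch
          chart_openin[OF dch] contf conth])
      fix x assume "x \<in> U"
      then have "f x \<in> topspace TN"
        using chart_subset_topspace[OF cch] smooth_maps_in_topspace[OF f] by blast
      then obtain W \<xi> where "(W, \<xi>) \<in> \<A>N" "f x \<in> W" "is_chart TN (W, \<xi>)"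
        using manifold_chart_at[OF N] by blast
      then show "\<exists>W (\<xi>::'n \<Rightarrow> 'b). is_chart TN (W, \<xi>) \<and> f x \<in> W \<and> chart_smooth (U, \<phi>) (W, \<xi>) f \<and>
          chart_smooth (W, \<xi>) (V, \<psi>) h"
        using smooth_maps_atlas[OF f c] smooth_maps_atlas[OF h _ d] by blast
    qed
    show "(h \<circ> f) x = restrict (h \<circ> f) (topspace TM) x" if "x \<in> U" for x
      using that chart_subset_topspace[OF cch] by auto
  qed
  show ?thesis
    using 1 2 by (auto simp: smooth_maps_def chart_smooth_def)
qed

section \<open>Elementary neighbourhoods\<close>

lemma cnorm_le:
  assumes "0 \<le> M" "\<And>a \<alpha>. a \<in> A \<Longrightarrow> set \<alpha> \<subseteq> B \<Longrightarrow> length \<alpha> \<le> r \<Longrightarrow> p (dk g \<alpha> a) \<le> M"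
  shows "cnorm B g r A p \<le> M"
  unfolding cnorm_def using assms by (intro cSup_least) auto

text \<open>A real \<open>Sup\<close> bounds its members only if the set is bounded. Each derivative
  is bounded on the compact set, and there are finitely many lists of basis directions of length at
  most \<open>r\<close>.\<close>

lemma le_cnorm:
  fixes g :: "'a::{real_vector,topological_space} \<Rightarrow> 'e::{real_vector,topological_space}"
  assumes g: "smooth_on U g" and A: "compact A" "A \<subseteq> U" and B: "finite B" and p: "p \<in> cont_seminorms"
    and a: "a \<in> A" and \<alpha>: "set \<alpha> \<subseteq> B" "length \<alpha> \<le> r"
  shows "p (dk g \<alpha> a) \<le> cnorm B g r A p"
  unfolding cnorm_def
proof (rule cSup_upper)
  have "\<exists>M. \<forall>a\<in>A. p (dk g \<alpha> a) \<le> M" for \<alpha>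
    using seminorm_bounded_on_compact[OF A(1) continuous_on_subset[OF smooth_on_dk_continuous_on[OF g] A(2)] p] .
  then obtain M where M: "\<And>a \<alpha>. a \<in> A \<Longrightarrow> p (dk g \<alpha> a) \<le> M \<alpha>"
    by metis
  let ?L = "{\<alpha>. set \<alpha> \<subseteq> B \<and> length \<alpha> \<le> r}"
  have fin: "finite ?L"
    by (rule finite_lists_length_le[OF B])
  show "bdd_above (insert 0 {p (dk g \<alpha> a) |a \<alpha>. a \<in> A \<and> set \<alpha> \<subseteq> B \<and> length \<alpha> \<le> r})"
  proof (rule bdd_aboveI)
    fix x assume "x \<in> insert 0 {p (dk g \<alpha> a) |a \<alpha>. a \<in> A \<and> set \<alpha> \<subseteq> B \<and> length \<alpha> \<le> r}"
    then consider "x = 0" | a \<alpha> where "x = p (dk g \<alpha> a)" "a \<in> A" "\<alpha> \<in> ?L"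
      by blast
    then show "x \<le> Max (insert 0 (M ` ?L))"
    proof cases
      case 2
      then have "x \<le> M \<alpha>"
        using M by blast
      also have "\<dots> \<le> Max (insert 0 (M ` ?L))"
        using fin 2 by (intro Max_ge) auto
      finally show ?thesis .
    qed (use fin in simp)
  qed
qed (use a \<alpha> in blast)

context
  fixes TM :: "'m topology" and \<A>M and B :: "'a::{real_vector,topological_space} set"
    and TX :: "'x topology" and \<A>X and U V and \<phi> :: "'m \<Rightarrow> 'a" and \<psi> :: "'x \<Rightarrow> 'e::{real_vector,topological_space}"
    and f and A
  assumes M: "manifold TM \<A>M" and X: "manifold TX \<A>X" and f: "f \<in> smooth_maps TM \<A>M TX \<A>X"
    and c: "(U, \<phi>) \<in> charts_of TM \<A>M" and d: "(V, \<psi>) \<in> charts_of TX \<A>X"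
    and A: "compactin TM A" "A \<subseteq> U" and fA: "f ` A \<subseteq> V"
begin

lemma smooth_maps_local_representative:
  "smooth_on (\<phi> ` (U \<inter> f -` V)) (\<psi> \<circ> f \<circ> inv_into U \<phi>)" "\<phi> ` A \<subseteq> \<phi> ` (U \<inter> f -` V)"
  using smooth_maps_charts[OF M X f c d] A fA unfolding chart_smooth_def prod.case by blast+

lemma compact_chart_image: "compact (\<phi> ` A)"
  using chart_compact_image_iff[OF charts_of_is_chart[OF c] A(2)] A(1) by simp

text \<open>The two representatives have different domains. On the intersection \<open>S\<close>, an
  open set that contains the image of \<open>A\<close>, the derivatives of the difference
  split.\<close>

lemma local_representative_diff:
  assumes h: "h \<in> smooth_maps TM \<A>M TX \<A>X" and hA: "h ` A \<subseteq> V"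
  shows "\<exists>S. \<phi> ` A \<subseteq> S \<and> smooth_on S (\<lambda>y. \<psi> (h (inv_into U \<phi> y)) - \<psi> (f (inv_into U \<phi> y))) \<and>
    (\<forall>\<alpha>. \<forall>y\<in>S. dk (\<lambda>y. \<psi> (h (inv_into U \<phi> y)) - \<psi> (f (inv_into U \<phi> y))) \<alpha> y
      = dk (\<psi> \<circ> h \<circ> inv_into U \<phi>) \<alpha> y - dk (\<psi> \<circ> f \<circ> inv_into U \<phi>) \<alpha> y)"
proof -
  note lcs = manifold_lcs[OF M] manifold_lcs[OF X]
  have hs: "smooth_on (\<phi> ` (U \<inter> h -` V)) (\<psi> \<circ> h \<circ> inv_into U \<phi>)"
    using smooth_maps_charts[OF M X h c d] by (simp add: chart_smooth_def)
  let ?S = "\<phi> ` (U \<inter> f -` V) \<inter> \<phi> ` (U \<inter> h -` V)"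
  have op: "open ?S"
    using smooth_on_open[OF hs] smooth_on_open[OF smooth_maps_local_representative(1)] by (rule open_Int[rotated])
  have 1: "smooth_on ?S (\<psi> \<circ> h \<circ> inv_into U \<phi>)" "smooth_on ?S (\<psi> \<circ> f \<circ> inv_into U \<phi>)"
    using smooth_on_subset[OF hs op] smooth_on_subset[OF smooth_maps_local_representative(1) op] by auto
  show ?thesis
  proof (intro exI[of _ ?S] conjI allI ballI)
    show "\<phi> ` A \<subseteq> ?S"
      using A(2) fA hA by blast
    show "smooth_on ?S (\<lambda>y. \<psi> (h (inv_into U \<phi> y)) - \<psi> (f (inv_into U \<phi> y)))"
      using smooth_on_diff[OF lcs 1] by (simp add: o_def)
    show "dk (\<lambda>y. \<psi> (h (inv_into U \<phi> y)) - \<psi> (f (inv_into U \<phi> y))) \<alpha> y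
      = dk (\<psi> \<circ> h \<circ> inv_into U \<phi>) \<alpha> y - dk (\<psi> \<circ> f \<circ> inv_into U \<phi>) \<alpha> y" if "y \<in> ?S" for \<alpha> y
      using dk_diff[OF lcs 1 that] by (simp add: o_def)
  qed
qed

lemma elem_nbhd_le_cnorm:
  assumes h: "h \<in> smooth_maps TM \<A>M TX \<A>X" and hA: "h ` A \<subseteq> V"
    and B: "finite B" and p: "p \<in> cont_seminorms" and y: "y \<in> \<phi> ` A" and \<alpha>: "set \<alpha> \<subseteq> B" "length \<alpha> \<le> r"
  shows "p (dk (\<psi> \<circ> h \<circ> inv_into U \<phi>) \<alpha> y - dk (\<psi> \<circ> f \<circ> inv_into U \<phi>) \<alpha> y)
    \<le> cnorm B (\<lambda>y. \<psi> (h (inv_into U \<phi> y)) - \<psi> (f (inv_into U \<phi> y))) r (\<phi> ` A) p"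
proof -
  obtain S where S: "\<phi> ` A \<subseteq> S" "smooth_on S (\<lambda>y. \<psi> (h (inv_into U \<phi> y)) - \<psi> (f (inv_into U \<phi> y)))"
    "\<And>\<alpha> y. y \<in> S \<Longrightarrow> dk (\<lambda>y. \<psi> (h (inv_into U \<phi> y)) - \<psi> (f (inv_into U \<phi> y))) \<alpha> y
      = dk (\<psi> \<circ> h \<circ> inv_into U \<phi>) \<alpha> y - dk (\<psi> \<circ> f \<circ> inv_into U \<phi>) \<alpha> y"
    using local_representative_diff[OF h hA] by blast
  from le_cnorm[OF S(2) compact_chart_image S(1) B p y \<alpha>] show ?thesis
    using S(1,3) y by auto
qed

lemma elem_nbhd_dk_less:
  assumes h: "h \<in> elem_nbhd TM \<A>M B TX \<A>X f A (U, \<phi>) (V, \<psi>) p r \<epsilon>"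
    and B: "finite B" and p: "p \<in> cont_seminorms" and y: "y \<in> \<phi> ` A" and \<alpha>: "set \<alpha> \<subseteq> B" "length \<alpha> \<le> r"
  shows "p (dk (\<psi> \<circ> h \<circ> inv_into U \<phi>) \<alpha> y - dk (\<psi> \<circ> f \<circ> inv_into U \<phi>) \<alpha> y) < \<epsilon>"
proof -
  have "h \<in> smooth_maps TM \<A>M TX \<A>X" "h ` A \<subseteq> V"
    and less: "cnorm B (\<lambda>y. \<psi> (h (inv_into U \<phi> y)) - \<psi> (f (inv_into U \<phi> y))) r (\<phi> ` A) p < \<epsilon>"
    using h by (simp_all add: elem_nbhd_def)
  from elem_nbhd_le_cnorm[OF this(1,2) B p y \<alpha>] less show ?thesis
    by (rule le_less_trans)
qed

text \<open>A supremum of values below \<open>\<epsilon>\<close> may equal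
  \<open>\<epsilon>\<close>, so a uniform bound with a margin is required. It has to be nonnegative
  because \<open>cnorm\<close> inserts 0.\<close>

lemma elem_nbhdI:
  assumes h: "h \<in> smooth_maps TM \<A>M TX \<A>X" and hA: "h ` A \<subseteq> V" and M: "0 \<le> M" "M < \<epsilon>"
    and le: "\<And>y \<alpha>. y \<in> \<phi> ` A \<Longrightarrow> set \<alpha> \<subseteq> B \<Longrightarrow> length \<alpha> \<le> r \<Longrightarrow>
      p (dk (\<psi> \<circ> h \<circ> inv_into U \<phi>) \<alpha> y - dk (\<psi> \<circ> f \<circ> inv_into U \<phi>) \<alpha> y) \<le> M"
  shows "h \<in> elem_nbhd TM \<A>M B TX \<A>X f A (U, \<phi>) (V, \<psi>) p r \<epsilon>"
proof -
  obtain S where S: "\<phi> ` A \<subseteq> S \<and> smooth_on S (\<lambda>y. \<psi> (h (inv_into U \<phi> y)) - \<psi> (f (inv_into U \<phi> y))) \<and>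
    (\<forall>\<alpha>. \<forall>y\<in>S. dk (\<lambda>y. \<psi> (h (inv_into U \<phi> y)) - \<psi> (f (inv_into U \<phi> y))) \<alpha> y
      = dk (\<psi> \<circ> h \<circ> inv_into U \<phi>) \<alpha> y - dk (\<psi> \<circ> f \<circ> inv_into U \<phi>) \<alpha> y)"
    using local_representative_diff[OF h hA] ..
  have "cnorm B (\<lambda>y. \<psi> (h (inv_into U \<phi> y)) - \<psi> (f (inv_into U \<phi> y))) r (\<phi> ` A) p \<le> M"
  proof (rule cnorm_le[OF M(1)])
    fix y \<alpha> assume y: "y \<in> \<phi> ` A" and \<alpha>: "set \<alpha> \<subseteq> B" "length \<alpha> \<le> r"
    show "p (dk (\<lambda>y. \<psi> (h (inv_into U \<phi> y)) - \<psi> (f (inv_into U \<phi> y))) \<alpha> y) \<le> M"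
      using le[OF y \<alpha>] S y by auto
  qed
  then show ?thesis
    using h hA M(2) by (simp add: elem_nbhd_def)
qed

end

lemma fd_manifoldD:
  assumes "fd_manifold T \<A> B"
  shows "manifold T \<A>" "finite_basis B" "Hausdorff_space T"
  using assms by (auto simp: fd_manifold_def)

lemma finite_basis_imp_finite: "finite_basis B \<Longrightarrow> finite B"
  by (simp add: finite_basis_def)

lemma elem_nbhd_compose_uniform:
  fixes \<A>M :: "('m set \<times> ('m \<Rightarrow> 'a::{real_vector,topological_space})) set"
    and \<A>N :: "('n set \<times> ('n \<Rightarrow> 'b::{real_vector,topological_space})) set"
    and \<A>X :: "('x set \<times> ('x \<Rightarrow> 'e::{real_vector,topological_space})) set"
  assumes M: "manifold TM \<A>M" "finite Bm" and N: "manifold TN \<A>N" "finite_basis Bn" and X: "manifold TX \<A>X"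
    and f: "f \<in> smooth_maps TM \<A>M TN \<A>N" and h: "h \<in> smooth_maps TN \<A>N TX \<A>X"
    and c: "(U, \<phi>) \<in> charts_of TM \<A>M" and d: "(W, \<xi>) \<in> charts_of TN \<A>N" and e: "(V, \<psi>) \<in> charts_of TX \<A>X"
    and A: "compactin TM A" "A \<subseteq> U" and Q: "openin TN Q" "f ` A \<subseteq> Q" "Q \<subseteq> L"
    and L: "compactin TN L" "L \<subseteq> W" "h ` L \<subseteq> V"
    and p: "p \<in> cont_seminorms" and \<epsilon>: "0 < \<epsilon>"
  shows "\<exists>\<delta>>0. \<forall>f'\<in>elem_nbhd TM \<A>M Bm TN \<A>N f A (U, \<phi>) (W, \<xi>) (supnorm Bn) r \<delta>.
    \<forall>h'\<in>elem_nbhd TN \<A>N Bn TX \<A>X h L (W, \<xi>) (V, \<psi>) p r \<delta>. f' ` A \<subseteq> L \<and>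
      (\<forall>\<alpha>. set \<alpha> \<subseteq> Bm \<and> length \<alpha> \<le> r \<longrightarrow> (\<forall>y\<in>\<phi> ` A.
        p (dk (\<psi> \<circ> restrict (h' \<circ> f') (topspace TM) \<circ> inv_into U \<phi>) \<alpha> y
          - dk (\<psi> \<circ> restrict (h \<circ> f) (topspace TM) \<circ> inv_into U \<phi>) \<alpha> y) < \<epsilon>))"
    (is "\<exists>\<delta>>0. \<forall>f'\<in>?Nf \<delta>. \<forall>h'\<in>?Nh \<delta>. ?good f' h'")
proof (rule ccontr)
  assume neg: "\<not> (\<exists>\<delta>>0. \<forall>f'\<in>?Nf \<delta>. \<forall>h'\<in>?Nh \<delta>. ?good f' h')"
  define Nf where "Nf \<delta> = ?Nf \<delta>" for \<delta>
  define Nh where "Nh \<delta> = ?Nh \<delta>" for \<delta>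
  define good where "good f' h' \<longleftrightarrow> ?good f' h'" for f' h'
  have neg': "\<not> (\<exists>\<delta>>0. \<forall>f'\<in>Nf \<delta>. \<forall>h'\<in>Nh \<delta>. good f' h')"
    using neg unfolding Nf_def Nh_def good_def .
  note lcs = manifold_lcs[OF M(1)] manifold_lcs[OF N(1)] manifold_lcs[OF X]
  note cch = charts_of_is_chart[OF c] and dch = charts_of_is_chart[OF d]
  note sn = supnorm_cont_seminorm[OF lcs(2) N(2)]
  have fA: "f ` A \<subseteq> W" and fAL: "f ` A \<subseteq> L"
    using Q L by blast+
  have QW: "Q \<subseteq> W"
    using Q L by blast
  define A' where "A' = \<phi> ` A"
  define L' where "L' = \<xi> ` L"
  have A': "compact A'"
    using chart_compact_image_iff[OF cch A(2)] A(1) by (simp add: A'_def)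
  have L': "compact L'"
    using chart_compact_image_iff[OF dch L(2)] L(1) by (simp add: L'_def)
  have openQ: "open (\<xi> ` Q)"
    using chart_open_image_iff[OF dch QW] Q(1) by simp
  have inv: "inv_into U \<phi> (\<phi> x) = x" if "x \<in> U" for x
    using chart_inv[OF cch that] .
  have invA: "inv_into U \<phi> (\<phi> x) = x" if "x \<in> A" for x
    using that A(2) inv by blast
  have inv': "inv_into W \<xi> (\<xi> x) = x" if "x \<in> W" for x
    using chart_inv[OF dch that] .
  define F where "F g = \<xi> \<circ> g \<circ> inv_into U \<phi>" for g
  define H where "H k = \<psi> \<circ> k \<circ> inv_into W \<xi>" for k
  have F_smooth: "smooth_on (\<phi> ` (U \<inter> g -` W)) (F g)" if "g \<in> smooth_maps TM \<A>M TN \<A>N" for g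
    using smooth_maps_charts[OF M(1) N(1) that c d] by (simp add: chart_smooth_def F_def)
  have H_smooth: "smooth_on (\<xi> ` (W \<inter> k -` V)) (H k)" if "k \<in> smooth_maps TN \<A>N TX \<A>X" for k
    using smooth_maps_charts[OF N(1) X that d e] by (simp add: chart_smooth_def H_def)
  have comp: "dk (\<psi> \<circ> restrict (k \<circ> g) (topspace TM) \<circ> inv_into U \<phi>) \<alpha> y = dk (H k \<circ> F g) \<alpha> y"
    if g: "g \<in> smooth_maps TM \<A>M TN \<A>N" and gA: "g ` A \<subseteq> W" and y: "y \<in> A'" for g k \<alpha> y
  proof (rule dk_cong_open[OF lcs(1) smooth_on_open[OF F_smooth[OF g]]])
    show "y \<in> \<phi> ` (U \<inter> g -` W)"
      using y gA A(2) by (auto simp: A'_def)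
    fix z assume "z \<in> \<phi> ` (U \<inter> g -` W)"
    then show "(\<psi> \<circ> restrict (k \<circ> g) (topspace TM) \<circ> inv_into U \<phi>) z = (H k \<circ> F g) z"
      using chart_subset_topspace[OF cch] by (auto simp: F_def H_def inv inv')
  qed
  have A'_sub: "A' \<subseteq> \<phi> ` (U \<inter> g -` W)" if "g ` A \<subseteq> W" for g
    using that A(2) unfolding A'_def by blast
  have "continuous_on A' (F f)"
    using continuous_on_subset[OF smooth_on_dk_continuous_on[OF F_smooth[OF f], of "[]"] A'_sub[OF fA]] by simp
  then have "compact (F f ` A')"
    using A' by (rule compact_continuous_image)
  moreover have "F f ` A' \<subseteq> \<xi> ` Q"
    using Q(2) by (auto simp: A'_def F_def invA)
  ultimately obtain \<delta>0 where \<delta>0: "0 < \<delta>0" "\<And>k y. k \<in> F f ` A' \<Longrightarrow> supnorm Bn (y - k) < \<delta>0 \<Longrightarrow> y \<in> \<xi> ` Q"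
    using compact_supnorm_neighbourhood[OF lcs(2) N(2) _ openQ] by metis
  define \<delta> where "\<delta> n = min \<delta>0 (1 / real (Suc n))" for n
  have "0 < \<delta> n" for n
    using \<delta>0 by (simp add: \<delta>_def)
  with neg' have "\<exists>f' h'. f' \<in> Nf (\<delta> n) \<and> h' \<in> Nh (\<delta> n) \<and> \<not> good f' h'" for n
    by blast
  then obtain fn hn where fn_Nf: "\<And>n. fn n \<in> Nf (\<delta> n)" and hn_Nh: "\<And>n. hn n \<in> Nh (\<delta> n)"
    and bad: "\<And>n. \<not> good (fn n) (hn n)"
    by metis
  note fn = fn_Nf[unfolded Nf_def] and hn = hn_Nh[unfolded Nh_def]
  have fn_smooth: "fn n \<in> smooth_maps TM \<A>M TN \<A>N" and fnA: "fn n ` A \<subseteq> W" for n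
    using fn[of n] by (auto simp: elem_nbhd_def)
  have hn_smooth: "hn n \<in> smooth_maps TN \<A>N TX \<A>X" and hnL: "hn n ` L \<subseteq> V" for n
    using hn[of n] by (auto simp: elem_nbhd_def)
  have fn_less: "supnorm Bn (dk (F (fn n)) \<alpha> y - dk (F f) \<alpha> y) < \<delta> n"
    if "y \<in> A'" "set \<alpha> \<subseteq> Bm" "length \<alpha> \<le> r" for n \<alpha> y
    using elem_nbhd_dk_less[OF M(1) N(1) f c d A fA fn M(2) sn] that by (simp add: F_def A'_def)
  have hn_less: "p (dk (H (hn n)) \<beta> y - dk (H h) \<beta> y) < \<delta> n"
    if "y \<in> L'" "set \<beta> \<subseteq> Bn" "length \<beta> \<le> r" for n \<beta> y
    using elem_nbhd_dk_less[OF N(1) X h d e L hn finite_basis_imp_finite[OF N(2)] p] that by (simp add: H_def L'_def)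
  have small: "\<forall>\<^sub>F n in sequentially. \<delta> n < \<eta>" if "0 < \<eta>" for \<eta>
  proof -
    have "\<forall>\<^sub>F n in sequentially. 1 / real (Suc n) < \<eta>"
      using order_tendstoD(2)[OF LIMSEQ_Suc[OF lim_1_over_n] that] by simp
    then show ?thesis
      by eventually_elim (simp add: \<delta>_def min_less_iff_disj)
  qed
  have fnL: "fn n ` A \<subseteq> L" for n
  proof
    fix z assume "z \<in> fn n ` A"
    then obtain x where x: "x \<in> A" "z = fn n x"
      by blast
    have "supnorm Bn (F (fn n) (\<phi> x) - F f (\<phi> x)) < \<delta>0"
      using fn_less[of "\<phi> x" "[]" n] x by (simp add: A'_def \<delta>_def)
    then have "F (fn n) (\<phi> x) \<in> \<xi> ` Q"
      by (rule \<delta>0(2)[rotated]) (use x in \<open>simp add: A'_def\<close>)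
    then have "\<xi> z \<in> \<xi> ` Q"
      using x by (simp add: F_def invA)
    moreover have "z \<in> W"
      using fnA x by blast
    ultimately have "z \<in> Q"
      using inj_on_image_mem_iff[OF chart_inj_on[OF dch] _ QW] by blast
    then show "z \<in> L"
      using Q by blast
  qed
  have conv: "unif_tendsto p A' (\<lambda>n. dk (H (hn n) \<circ> F (fn n)) \<alpha>) (dk (H h \<circ> F f) \<alpha>) sequentially"
    if \<alpha>: "set \<alpha> \<subseteq> Bm" "length \<alpha> \<le> r" for \<alpha>
  proof (rule unif_tendsto_dk_compose[OF lcs N(2) p A' L' F_smooth[OF f] _ _ H_smooth[OF h] _
        F_smooth[OF fn_smooth] _ _ H_smooth[OF hn_smooth] _ _ _ \<alpha>])
    show "A' \<subseteq> \<phi> ` (U \<inter> f -` W)" "A' \<subseteq> \<phi> ` (U \<inter> fn n -` W)" for n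
      using A'_sub[OF fA] A'_sub[OF fnA] .
    show "F f ` A' \<subseteq> L'" "F (fn n) ` A' \<subseteq> L'" for n
      using fAL fnL[of n] by (auto simp: A'_def L'_def F_def invA)
    show "L' \<subseteq> \<xi> ` (W \<inter> h -` V)" "L' \<subseteq> \<xi> ` (W \<inter> hn n -` V)" for n
      using L(2,3) hnL[of n] unfolding L'_def by blast+
    show "unif_tendsto (supnorm Bn) A' (\<lambda>n. dk (F (fn n)) \<alpha>) (dk (F f) \<alpha>) sequentially"
      if "set \<alpha> \<subseteq> Bm" "length \<alpha> \<le> r" for \<alpha>
      unfolding unif_tendsto_def
    proof (intro allI impI)
      fix \<eta> :: real assume "0 < \<eta>"
      from small[OF this] show "\<forall>\<^sub>F n in sequentially. \<forall>a\<in>A'. supnorm Bn (dk (F (fn n)) \<alpha> a - dk (F f) \<alpha> a) < \<eta>"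
        by eventually_elim (use fn_less that in \<open>blast intro: less_trans\<close>)
    qed
    show "unif_tendsto p L' (\<lambda>n. dk (H (hn n)) \<beta>) (dk (H h) \<beta>) sequentially"
      if "set \<beta> \<subseteq> Bn" "length \<beta> \<le> r" for \<beta>
      unfolding unif_tendsto_def
    proof (intro allI impI)
      fix \<eta> :: real assume "0 < \<eta>"
      from small[OF this] show "\<forall>\<^sub>F n in sequentially. \<forall>a\<in>L'. p (dk (H (hn n)) \<beta> a - dk (H h) \<beta> a) < \<eta>"
        by eventually_elim (use hn_less that in \<open>blast intro: less_trans\<close>)
    qed
  qed
  let ?S = "{\<alpha>. set \<alpha> \<subseteq> Bm \<and> length \<alpha> \<le> r}"
  have "finite ?S"
    by (rule finite_lists_length_le[OF M(2)])
  \<comment> \<open>Finitely many lists of directions occur, so one index \<open>n\<close> serves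
    all of them, which contradicts that the pair at \<open>n\<close> is bad.\<close>
  then have "\<forall>\<^sub>F n in sequentially. \<forall>\<alpha>\<in>?S. \<forall>y\<in>A'. p (dk (H (hn n) \<circ> F (fn n)) \<alpha> y - dk (H h \<circ> F f) \<alpha> y) < \<epsilon>"
    using unif_tendstoD[OF conv \<epsilon>] by (intro eventually_ball_finite) auto
  then obtain n where n: "\<forall>\<alpha>\<in>?S. \<forall>y\<in>A'. p (dk (H (hn n) \<circ> F (fn n)) \<alpha> y - dk (H h \<circ> F f) \<alpha> y) < \<epsilon>"
    using eventually_happens'[OF sequentially_bot] by blast
  have "good (fn n) (hn n)"
    unfolding good_def
  proof (intro conjI allI impI ballI)
    show "fn n ` A \<subseteq> L" by (fact fnL)
    fix \<alpha> y assume "set \<alpha> \<subseteq> Bm \<and> length \<alpha> \<le> r" "y \<in> \<phi> ` A"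
    then have "y \<in> A'" "\<alpha> \<in> ?S"
      by (auto simp: A'_def)
    then show "p (dk (\<psi> \<circ> restrict (hn n \<circ> fn n) (topspace TM) \<circ> inv_into U \<phi>) \<alpha> y
        - dk (\<psi> \<circ> restrict (h \<circ> f) (topspace TM) \<circ> inv_into U \<phi>) \<alpha> y) < \<epsilon>"
      using n comp[OF fn_smooth fnA] comp[OF f fA] by simp
  qed
  with bad show False
    by blast
qed

section \<open>Compact neighbourhoods and local finiteness\<close>

lemma compactin_finite_subcover_image:
  assumes "compactin T K" "\<And>x. x \<in> K \<Longrightarrow> openin T (Q x)" "\<And>x. x \<in> K \<Longrightarrow> x \<in> Q x"
  obtains D where "finite D" "D \<subseteq> K" "K \<subseteq> (\<Union>x\<in>D. Q x)"
proof -
  have "(\<forall>U\<in>Q ` K. openin T U) \<and> K \<subseteq> \<Union>(Q ` K)"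
    using assms(2,3) by blast
  then have "\<exists>\<F>. finite \<F> \<and> \<F> \<subseteq> Q ` K \<and> K \<subseteq> \<Union>\<F>"
    using assms(1) unfolding compactin_def by simp
  then obtain \<F> where \<F>: "finite \<F>" "\<F> \<subseteq> Q ` K" "K \<subseteq> \<Union>\<F>"
    by blast
  then obtain D where "D \<subseteq> K" "finite D" "\<F> = Q ` D"
    by (meson finite_subset_image)
  with \<F> that show thesis
    by blast
qed

lemma chart_compact_neighbourhood:
  fixes \<phi> :: "'m \<Rightarrow> 'a::{real_vector,topological_space}" and B :: "'a set"
  assumes lcs: "lcs TYPE('a)" and B: "finite_basis B" and c: "is_chart T (U, \<phi>)"
    and O: "openin T O'" "x \<in> O'" "x \<in> U"
  obtains Q K where "openin T Q" "x \<in> Q" "Q \<subseteq> K" "compactin T K" "K \<subseteq> O' \<inter> U"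
proof -
  note sn = supnorm_cont_seminorm[OF lcs B]
  have "open (\<phi> ` (O' \<inter> U))"
    using chart_open_image_iff[OF c, of "O' \<inter> U"] O(1) chart_openin[OF c] by blast
  then obtain e where e: "0 < e" "{y. supnorm B (y - \<phi> x) < e} \<subseteq> \<phi> ` (O' \<inter> U)"
    using open_contains_supnorm_ball[OF lcs B] O by blast
  define C where "C = {y. supnorm B (y - \<phi> x) \<le> e / 2}"
  define D where "D = {y. supnorm B (y - \<phi> x) < e / 2}"
  have C: "compact C" "C \<subseteq> \<phi> ` (O' \<inter> U)"
    using compact_supnorm_cball[OF lcs B, of "\<phi> x" "e / 2"] e by (auto simp: C_def)
  have D: "open D" "D \<subseteq> C" "\<phi> x \<in> D"
    using lcs_open_ball[OF lcs sn, of "\<phi> x" "e / 2"] e seminorm_zero[OF cont_seminorms_imp_seminorm[OF sn]]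
    by (auto simp: C_def D_def)
  let ?K = "U \<inter> \<phi> -` C" and ?Q = "U \<inter> \<phi> -` D"
  have im: "\<phi> ` ?K = C" "\<phi> ` ?Q = D"
    using C D by blast+
  show thesis
  proof
    show "openin T ?Q"
      using chart_open_image_iff[OF c, of ?Q] im(2) D(1) by simp
    show "compactin T ?K"
      using chart_compact_image_iff[OF c, of ?K] im(1) C(1) by simp
    show "?K \<subseteq> O' \<inter> U"
      using C(2) chart_inj_on[OF c] by (auto dest: inj_onD)
  qed (use O D in auto)
qed

text \<open>The compact sets that witness sigma-compactness need not have interiors covering the
  manifold. Each is enlarged by finitely many compact chart neighbourhoods, and only the compact
  sets are then made increasing, by finite unions.\<close>

lemma fd_manifold_precompact_cover:
  assumes M: "fd_manifold T \<A> B"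
  obtains Q C where "\<And>n::nat. openin T (Q n)" "\<And>n. Q n \<subseteq> C n" "\<And>n. compactin T (C n)" "incseq C"
    "(\<Union>n. Q n) = topspace T"
proof -
  note m = fd_manifoldD[OF M]
  obtain K :: "nat \<Rightarrow> _" where K: "\<And>n. compactin T (K n)" "(\<Union>n. K n) = topspace T"
    using M unfolding fd_manifold_def by blast
  have pt: "\<exists>Q C. openin T Q \<and> x \<in> Q \<and> Q \<subseteq> C \<and> compactin T C" if x: "x \<in> topspace T" for x
  proof -
    obtain U \<phi> where U: "(U, \<phi>) \<in> \<A>" "x \<in> U" "is_chart T (U, \<phi>)"
      using manifold_chart_at[OF m(1) x] by blast
    show ?thesis
      using chart_compact_neighbourhood[OF manifold_lcs[OF m(1)] m(2) U(3) openin_topspace x U(2)] by metis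
  qed
  then obtain q c where qc: "\<And>x. x \<in> topspace T \<Longrightarrow> openin T (q x) \<and> x \<in> q x \<and> q x \<subseteq> c x \<and> compactin T (c x)"
    by metis
  have "\<exists>Q C. openin T Q \<and> K n \<subseteq> Q \<and> Q \<subseteq> C \<and> compactin T C" for n
  proof -
    have sub: "K n \<subseteq> topspace T"
      using K(1) by (rule compactin_subset_topspace)
    obtain D where D: "finite D" "D \<subseteq> K n" "K n \<subseteq> (\<Union>x\<in>D. q x)"
      using compactin_finite_subcover_image[OF K(1), of n q] qc sub by blast
    then have "compactin T (\<Union>x\<in>D. c x)" "openin T (\<Union>x\<in>D. q x)"
      using qc sub by (auto intro!: compactin_Union openin_Union)
    moreover have "(\<Union>x\<in>D. q x) \<subseteq> (\<Union>x\<in>D. c x)"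
      using qc sub D by blast
    ultimately show ?thesis
      using D(3) by blast
  qed
  then obtain Q C where QC: "\<And>n. openin T (Q n) \<and> K n \<subseteq> Q n \<and> Q n \<subseteq> C n \<and> compactin T (C n)"
    by metis
  show thesis
  proof
    show "openin T (Q n)" "Q n \<subseteq> (\<Union>k\<le>n. C k)" "compactin T (\<Union>k\<le>n. C k)" for n
      using QC by (auto intro!: compactin_Union)
    show "incseq (\<lambda>n. \<Union>k\<le>n. C k)"
      by (intro monoI UN_mono) auto
    show "(\<Union>n. Q n) = topspace T"
    proof
      show "(\<Union>n. Q n) \<subseteq> topspace T"
        using QC by (intro UN_least openin_subset) simp
      show "topspace T \<subseteq> (\<Union>n. Q n)"
        unfolding K(2)[symmetric] using QC by (intro UN_mono) auto
    qed
  qed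
qed

lemma locally_finite_in_compact:
  assumes "locally_finite_in T I A" "compactin T K"
  shows "finite {i\<in>I. A i \<inter> K \<noteq> {}}"
proof -
  have "\<exists>W. openin T W \<and> x \<in> W \<and> finite {i\<in>I. A i \<inter> W \<noteq> {}}" if "x \<in> K" for x
    using assms that compactin_subset_topspace unfolding locally_finite_in_def by blast
  then obtain W where W: "\<And>x. x \<in> K \<Longrightarrow> openin T (W x) \<and> x \<in> W x \<and> finite {i\<in>I. A i \<inter> W x \<noteq> {}}"
    by metis
  have op: "openin T (W x)" and mem: "x \<in> W x" if "x \<in> K" for x
    using W[OF that] by blast+
  obtain D where D: "finite D" "D \<subseteq> K" "K \<subseteq> (\<Union>x\<in>D. W x)"
    using compactin_finite_subcover_image[OF assms(2) op mem] by blast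
  have "{i\<in>I. A i \<inter> K \<noteq> {}} \<subseteq> (\<Union>x\<in>D. {i\<in>I. A i \<inter> W x \<noteq> {}})"
    using D(3) by blast
  moreover have "finite (\<Union>x\<in>D. {i\<in>I. A i \<inter> W x \<noteq> {}})"
    using D(1,2) W by (intro finite_UN_I) auto
  ultimately show ?thesis
    by (rule finite_subset)
qed

section \<open>Continuity of composition\<close>

lemma elem_data_subset_topspace: "elem_data TM \<A>M TX \<A>X P f D \<Longrightarrow> fst D \<subseteq> topspace TM"
  by (auto simp: elem_data_def split: prod.splits dest: compactin_subset_topspace)

lemma elem_nbhd_centre:
  assumes M: "manifold TM \<A>M" and X: "manifold TX \<A>X" and f: "f \<in> smooth_maps TM \<A>M TX \<A>X"
    and P: "P \<subseteq> cont_seminorms" and D: "elem_data TM \<A>M TX \<A>X P f (A, c, d, p, r, \<epsilon>)"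
  shows "f \<in> elem_nbhd TM \<A>M B TX \<A>X f A c d p r \<epsilon>"
proof -
  obtain U \<phi> V \<psi> where cd: "c = (U, \<phi>)" "d = (V, \<psi>)"
    by (cases c, cases d)
  have "p 0 = 0"
    using D P by (auto simp: elem_data_def cd intro!: seminorm_zero cont_seminorms_imp_seminorm)
  then show ?thesis
    using D unfolding cd elem_data_def prod.case
    by (intro elem_nbhdI[OF M X f, where M = 0]) (auto intro: f)
qed

context
  fixes TM :: "'m topology" and \<A>M :: "('m set \<times> ('m \<Rightarrow> 'a::{real_vector,topological_space})) set"
    and Bm :: "'a set"
    and TN :: "'n topology" and \<A>N :: "('n set \<times> ('n \<Rightarrow> 'b::{real_vector,topological_space})) set"
    and Bn :: "'b set"
    and TX :: "'x topology" and \<A>X :: "('x set \<times> ('x \<Rightarrow> 'e::{real_vector,topological_space})) set"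
    and f h
  assumes M: "fd_manifold TM \<A>M Bm" and N: "fd_manifold TN \<A>N Bn" and X: "manifold TX \<A>X"
    and f: "f \<in> smooth_maps TM \<A>M TN \<A>N" and h: "h \<in> smooth_maps TN \<A>N TX \<A>X"
begin

lemma compose_neighbourhood_piece:
  assumes c: "(U, \<phi>) \<in> charts_of TM \<A>M" and e: "(V, \<psi>) \<in> charts_of TX \<A>X"
    and A: "compactin TM A" "A \<subseteq> U" "h ` f ` A \<subseteq> V" and Z: "closedin TN Z" "f ` A \<inter> Z = {}"
    and p: "p \<in> cont_seminorms" and \<epsilon>: "0 < \<epsilon>" and a: "a \<in> A"
  shows "\<exists>Q A' d L \<delta>. openin TM Q \<and> a \<in> Q \<and> A \<inter> Q \<subseteq> A' \<and> A' \<subseteq> A \<and>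
    elem_data TM \<A>M TN \<A>N {supnorm Bn} f (A', (U, \<phi>), d, supnorm Bn, r, \<delta>) \<and>
    elem_data TN \<A>N TX \<A>X cont_seminorms h (L, d, (V, \<psi>), p, r, \<delta>) \<and> L \<inter> Z = {} \<and>
    (\<forall>f'\<in>elem_nbhd TM \<A>M Bm TN \<A>N f A' (U, \<phi>) d (supnorm Bn) r \<delta>.
      \<forall>h'\<in>elem_nbhd TN \<A>N Bn TX \<A>X h L d (V, \<psi>) p r \<delta>. h' ` f' ` A' \<subseteq> V \<and>
        (\<forall>\<alpha>. set \<alpha> \<subseteq> Bm \<and> length \<alpha> \<le> r \<longrightarrow> (\<forall>y\<in>\<phi> ` A'.
          p (dk (\<psi> \<circ> restrict (h' \<circ> f') (topspace TM) \<circ> inv_into U \<phi>) \<alpha> y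
            - dk (\<psi> \<circ> restrict (h \<circ> f) (topspace TM) \<circ> inv_into U \<phi>) \<alpha> y) < \<epsilon>)))"
proof -
  note m = fd_manifoldD[OF M] and n = fd_manifoldD[OF N]
  note cch = charts_of_is_chart[OF c] and ech = charts_of_is_chart[OF e]
  note contf = smooth_maps_continuous_map[OF f] and conth = smooth_maps_continuous_map[OF h]
  have aU: "a \<in> U" and aT: "a \<in> topspace TM"
    using a A(2) chart_subset_topspace[OF cch] by blast+
  have faT: "f a \<in> topspace TN"
    using smooth_maps_in_topspace[OF f aT] .
  obtain W \<xi> where W: "(W, \<xi>) \<in> \<A>N" "f a \<in> W" "is_chart TN (W, \<xi>)"
    using manifold_chart_at[OF n(1) faT] by blast
  have d: "(W, \<xi>) \<in> charts_of TN \<A>N"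
    using manifold_atlas_subset[OF n(1)] W(1) by blast
  let ?O = "{y \<in> topspace TN. h y \<in> V} \<inter> (topspace TN - Z)"
  have "openin TN ?O"
    using openin_continuous_map_preimage[OF conth chart_openin[OF ech]] Z(1) by (intro openin_Int) auto
  moreover have "f a \<in> ?O"
    using a A(3) Z(2) faT by blast
  ultimately obtain O' L where L: "openin TN O'" "f a \<in> O'" "O' \<subseteq> L" "compactin TN L" "L \<subseteq> ?O \<inter> W"
    using chart_compact_neighbourhood[OF manifold_lcs[OF n(1)] n(2) W(3) _ _ W(2)] by blast
  have "openin TM {x \<in> topspace TM. f x \<in> O'}"
    using openin_continuous_map_preimage[OF contf L(1)] .
  moreover have "a \<in> {x \<in> topspace TM. f x \<in> O'}"
    using aT L(2) by blast
  ultimately obtain Q K where K: "openin TM Q" "a \<in> Q" "Q \<subseteq> K" "compactin TM K"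
      "K \<subseteq> {x \<in> topspace TM. f x \<in> O'} \<inter> U"
    using chart_compact_neighbourhood[OF manifold_lcs[OF m(1)] m(2) cch _ _ aU] by blast
  \<comment> \<open>The piece must remain inside \<open>A\<close>, for local finiteness, and be
    compact; since the manifold is Hausdorff, \<open>A\<close> is closed and the intersection is
    compact.\<close>
  define A' where "A' = A \<inter> K"
  have A'_compact: "compactin TM A'"
    unfolding A'_def using compactin_imp_closedin[OF m(3) A(1)] K(4) by (rule closed_Int_compactin)
  have A': "A' \<subseteq> U" "f ` A' \<subseteq> O'" "A' \<subseteq> A" "A \<inter> Q \<subseteq> A'"
    using A(2) K(3,5) by (auto simp: A'_def)
  have L': "L \<subseteq> W" "h ` L \<subseteq> V" "L \<inter> Z = {}"
    using L(5) by auto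
  obtain \<delta> where \<delta>: "0 < \<delta>" "\<forall>f'\<in>elem_nbhd TM \<A>M Bm TN \<A>N f A' (U, \<phi>) (W, \<xi>) (supnorm Bn) r \<delta>.
      \<forall>h'\<in>elem_nbhd TN \<A>N Bn TX \<A>X h L (W, \<xi>) (V, \<psi>) p r \<delta>. f' ` A' \<subseteq> L \<and>
        (\<forall>\<alpha>. set \<alpha> \<subseteq> Bm \<and> length \<alpha> \<le> r \<longrightarrow> (\<forall>y\<in>\<phi> ` A'.
          p (dk (\<psi> \<circ> restrict (h' \<circ> f') (topspace TM) \<circ> inv_into U \<phi>) \<alpha> y
            - dk (\<psi> \<circ> restrict (h \<circ> f) (topspace TM) \<circ> inv_into U \<phi>) \<alpha> y) < \<epsilon>))"
    using elem_nbhd_compose_uniform[OF m(1) finite_basis_imp_finite[OF m(2)] n(1,2) X f h c d e A'_compact A'(1)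
        L(1) A'(2) L(3,4) L'(1,2) p \<epsilon>] by blast
  have sub: "h' ` f' ` A' \<subseteq> V"
    if "f' ` A' \<subseteq> L" "h' \<in> elem_nbhd TN \<A>N Bn TX \<A>X h L (W, \<xi>) (V, \<psi>) p r \<delta>" for f' h'
    using that by (auto simp: elem_nbhd_def)
  have 1: "elem_data TM \<A>M TN \<A>N {supnorm Bn} f (A', (U, \<phi>), (W, \<xi>), supnorm Bn, r, \<delta>)"
    using c d A'_compact A' \<delta>(1) L(3) L' by (auto simp: elem_data_def)
  have 2: "elem_data TN \<A>N TX \<A>X cont_seminorms h (L, (W, \<xi>), (V, \<psi>), p, r, \<delta>)"
    using d e L(4) L' p \<delta>(1) by (simp add: elem_data_def)
  show ?thesis
    by (rule exI[of _ Q], rule exI[of _ A'], rule exI[of _ "(W, \<xi>)"], rule exI[of _ L], rule exI[of _ \<delta>])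
      (intro conjI ballI K(1,2) A'(3,4) 1 2 L'(3); use \<delta>(2) sub in \<open>blast\<close>)
qed

text \<open>Finitely many pieces are glued into one condition on the whole of \<open>A\<close>. The
  neighbourhood is centred at \<open>g\<close>, so the pieces are made small relative to the gap
  left by \<open>h \<circ> f\<close>.\<close>

lemma compose_neighbourhood:
  assumes g: "g \<in> smooth_maps TM \<A>M TX \<A>X"
    and D: "elem_data TM \<A>M TX \<A>X cont_seminorms g (A, c, d, p, r, \<epsilon>)"
    and hf: "restrict (h \<circ> f) (topspace TM) \<in> elem_nbhd TM \<A>M Bm TX \<A>X g A c d p r \<epsilon>"
    and Z: "closedin TN Z" "f ` A \<inter> Z = {}"
  shows "\<exists>\<Lambda>1 \<Lambda>2. finite \<Lambda>1 \<and> finite \<Lambda>2 \<and>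
    (\<forall>D\<in>\<Lambda>1. elem_data TM \<A>M TN \<A>N {supnorm Bn} f D \<and> fst D \<subseteq> A) \<and>
    (\<forall>D\<in>\<Lambda>2. elem_data TN \<A>N TX \<A>X cont_seminorms h D \<and> fst D \<inter> Z = {}) \<and>
    (\<forall>f'\<in>smooth_maps TM \<A>M TN \<A>N. \<forall>h'\<in>smooth_maps TN \<A>N TX \<A>X.
      (\<forall>(A, c, d, p, r, \<epsilon>)\<in>\<Lambda>1. f' \<in> elem_nbhd TM \<A>M Bm TN \<A>N f A c d p r \<epsilon>) \<longrightarrow>
      (\<forall>(A, c, d, p, r, \<epsilon>)\<in>\<Lambda>2. h' \<in> elem_nbhd TN \<A>N Bn TX \<A>X h A c d p r \<epsilon>) \<longrightarrow>
      restrict (h' \<circ> f') (topspace TM) \<in> elem_nbhd TM \<A>M Bm TX \<A>X g A c d p r \<epsilon>)"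
proof -
  note m = fd_manifoldD[OF M] and n = fd_manifoldD[OF N]
  obtain U \<phi> V \<psi> where cd: "c = (U, \<phi>)" "d = (V, \<psi>)"
    by (cases c, cases d)
  have c: "(U, \<phi>) \<in> charts_of TM \<A>M" and e: "(V, \<psi>) \<in> charts_of TX \<A>X" and A: "compactin TM A" "A \<subseteq> U"
    and gA: "g ` A \<subseteq> V" and p: "p \<in> cont_seminorms"
    using D by (auto simp: elem_data_def cd)
  note pn = cont_seminorms_imp_seminorm[OF p]
  let ?k = "\<lambda>f h. restrict (h \<circ> f) (topspace TM)"
  let ?R = "\<lambda>k. \<psi> \<circ> k \<circ> inv_into U \<phi>"
  \<comment> \<open>The distance from \<open>h \<circ> f\<close> to the centre. The maximum with 0
    yields the nonnegativity asked for by \<open>elem_nbhdI\<close> directly.\<close>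
  define N0 where "N0 = max 0 (cnorm Bm (\<lambda>y. \<psi> (?k f h (inv_into U \<phi> y)) - \<psi> (g (inv_into U \<phi> y))) r (\<phi> ` A) p)"
  have hfV: "?k f h ` A \<subseteq> V" and N0: "N0 < \<epsilon>"
    using hf D by (auto simp: elem_nbhd_def elem_data_def cd N0_def)
  have AT: "A \<subseteq> topspace TM"
    using A(1) by (rule compactin_subset_topspace)
  then have hfA: "h ` f ` A \<subseteq> V"
    using hfV by (auto simp: image_subset_iff)
  have k_smooth: "?k f h \<in> smooth_maps TM \<A>M TX \<A>X"
    by (rule smooth_maps_compose[OF m(1) n(1) X f h])
  \<comment> \<open>Half of the gap, so that \<open>N0 + \<eta>\<close> remains strictly below
    \<open>\<epsilon>\<close>.\<close>
  define \<eta> where "\<eta> = (\<epsilon> - N0) / 2"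
  have \<eta>: "0 < \<eta>"
    using N0 by (simp add: \<eta>_def)
  have N0_le: "p (dk (?R (?k f h)) \<alpha> y - dk (?R g) \<alpha> y) \<le> N0"
    if "y \<in> \<phi> ` A" "set \<alpha> \<subseteq> Bm" "length \<alpha> \<le> r" for \<alpha> y
    unfolding N0_def
    by (rule max.coboundedI2)
      (rule elem_nbhd_le_cnorm[OF m(1) X g c e A gA k_smooth hfV finite_basis_imp_finite[OF m(2)] p that])
  define good where "good A' f' h' \<longleftrightarrow> h' ` f' ` A' \<subseteq> V \<and> (\<forall>\<alpha>. set \<alpha> \<subseteq> Bm \<and> length \<alpha> \<le> r \<longrightarrow>
    (\<forall>y\<in>\<phi> ` A'. p (dk (?R (?k f' h')) \<alpha> y - dk (?R (?k f h)) \<alpha> y) < \<eta>))"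
    for A' and f' :: "'m \<Rightarrow> 'n" and h' :: "'n \<Rightarrow> 'x"
  have "\<forall>a\<in>A. \<exists>Q A' d L \<delta>. openin TM Q \<and> a \<in> Q \<and> A \<inter> Q \<subseteq> A' \<and> A' \<subseteq> A \<and>
    elem_data TM \<A>M TN \<A>N {supnorm Bn} f (A', (U, \<phi>), d, supnorm Bn, r, \<delta>) \<and>
    elem_data TN \<A>N TX \<A>X cont_seminorms h (L, d, (V, \<psi>), p, r, \<delta>) \<and> L \<inter> Z = {} \<and>
    (\<forall>f'\<in>elem_nbhd TM \<A>M Bm TN \<A>N f A' (U, \<phi>) d (supnorm Bn) r \<delta>.
      \<forall>h'\<in>elem_nbhd TN \<A>N Bn TX \<A>X h L d (V, \<psi>) p r \<delta>. good A' f' h')"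
    unfolding good_def using compose_neighbourhood_piece[OF c e A hfA Z p \<eta>] by blast
  then obtain Q A' d' L \<delta> where piece: "\<And>a. a \<in> A \<Longrightarrow> openin TM (Q a) \<and> a \<in> Q a \<and> A \<inter> Q a \<subseteq> A' a \<and> A' a \<subseteq> A \<and>
    elem_data TM \<A>M TN \<A>N {supnorm Bn} f (A' a, (U, \<phi>), d' a, supnorm Bn, r, \<delta> a) \<and>
    elem_data TN \<A>N TX \<A>X cont_seminorms h (L a, d' a, (V, \<psi>), p, r, \<delta> a) \<and> L a \<inter> Z = {} \<and>
    (\<forall>f'\<in>elem_nbhd TM \<A>M Bm TN \<A>N f (A' a) (U, \<phi>) (d' a) (supnorm Bn) r (\<delta> a).
      \<forall>h'\<in>elem_nbhd TN \<A>N Bn TX \<A>X h (L a) (d' a) (V, \<psi>) p r (\<delta> a). good (A' a) f' h')"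
    by metis
  have op: "openin TM (Q a)" and mem: "a \<in> Q a" if "a \<in> A" for a
    using piece[OF that] by blast+
  obtain I where I: "finite I" "I \<subseteq> A" "A \<subseteq> (\<Union>a\<in>I. Q a)"
    using compactin_finite_subcover_image[OF A(1) op mem] by blast
  have cover: "\<exists>a\<in>I. x \<in> A' a" if x: "x \<in> A" for x
  proof -
    obtain a where a: "a \<in> I" "x \<in> Q a"
      using I(3) x by blast
    then have "A \<inter> Q a \<subseteq> A' a"
      using piece I(2) by blast
    with a x show ?thesis
      by blast
  qed
  define \<Lambda>1 where "\<Lambda>1 = (\<lambda>a. (A' a, (U, \<phi>), d' a, supnorm Bn, r, \<delta> a)) ` I"
  define \<Lambda>2 where "\<Lambda>2 = (\<lambda>a. (L a, d' a, (V, \<psi>), p, r, \<delta> a)) ` I"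
  have "restrict (h' \<circ> f') (topspace TM) \<in> elem_nbhd TM \<A>M Bm TX \<A>X g A (U, \<phi>) (V, \<psi>) p r \<epsilon>"
    if f': "f' \<in> smooth_maps TM \<A>M TN \<A>N" and h': "h' \<in> smooth_maps TN \<A>N TX \<A>X"
      and f'1: "\<forall>(A, c, d, p, r, \<epsilon>)\<in>\<Lambda>1. f' \<in> elem_nbhd TM \<A>M Bm TN \<A>N f A c d p r \<epsilon>"
      and h'2: "\<forall>(A, c, d, p, r, \<epsilon>)\<in>\<Lambda>2. h' \<in> elem_nbhd TN \<A>N Bn TX \<A>X h A c d p r \<epsilon>" for f' h'
  proof (rule elem_nbhdI[OF m(1) X g c e A gA])
    have good: "good (A' a) f' h'" if "a \<in> I" for a
    proof -
      have "f' \<in> elem_nbhd TM \<A>M Bm TN \<A>N f (A' a) (U, \<phi>) (d' a) (supnorm Bn) r (\<delta> a)"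
        using f'1 that by (simp add: \<Lambda>1_def)
      moreover have "h' \<in> elem_nbhd TN \<A>N Bn TX \<A>X h (L a) (d' a) (V, \<psi>) p r (\<delta> a)"
        using h'2 that by (simp add: \<Lambda>2_def)
      ultimately show ?thesis
        using piece[OF subsetD[OF I(2) that]] by blast
    qed
    show "?k f' h' \<in> smooth_maps TM \<A>M TX \<A>X"
      by (rule smooth_maps_compose[OF m(1) n(1) X f' h'])
    show "?k f' h' ` A \<subseteq> V"
    proof
      fix z assume "z \<in> ?k f' h' ` A"
      then obtain x where x: "x \<in> A" "z = h' (f' x)"
        using AT by auto
      with cover good show "z \<in> V"
        unfolding good_def by blast
    qed
    have "0 \<le> N0"
      by (simp add: N0_def)
    show "0 \<le> N0 + \<eta>" "N0 + \<eta> < \<epsilon>"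
      using \<open>0 \<le> N0\<close> \<eta> N0 by (auto simp: \<eta>_def field_simps)
    fix y \<alpha> assume y: "y \<in> \<phi> ` A" and \<alpha>: "set \<alpha> \<subseteq> Bm" "length \<alpha> \<le> r"
    obtain a where "a \<in> I" "y \<in> \<phi> ` A' a"
      using y cover by blast
    then have "p (dk (?R (?k f' h')) \<alpha> y - dk (?R (?k f h)) \<alpha> y) < \<eta>"
      using good \<alpha> unfolding good_def by blast
    then show "p (dk (?R (?k f' h')) \<alpha> y - dk (?R g) \<alpha> y) \<le> N0 + \<eta>"
      using N0_le[OF y \<alpha>] seminorm_diff_triangle[OF pn, of "dk (?R (?k f' h')) \<alpha> y" "dk (?R g) \<alpha> y" "dk (?R (?k f h)) \<alpha> y"]
      by linarith
  qed
  moreover have "finite \<Lambda>1" "finite \<Lambda>2"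
    using I(1) by (simp_all add: \<Lambda>1_def \<Lambda>2_def)
  moreover have "elem_data TM \<A>M TN \<A>N {supnorm Bn} f D \<and> fst D \<subseteq> A" if D: "D \<in> \<Lambda>1" for D
  proof -
    obtain a where a: "a \<in> I" "D = (A' a, (U, \<phi>), d' a, supnorm Bn, r, \<delta> a)"
      using D by (auto simp: \<Lambda>1_def)
    then show ?thesis
      using piece[OF subsetD[OF I(2) a(1)]] by simp
  qed
  moreover have "elem_data TN \<A>N TX \<A>X cont_seminorms h D \<and> fst D \<inter> Z = {}" if D: "D \<in> \<Lambda>2" for D
  proof -
    obtain a where a: "a \<in> I" "D = (L a, d' a, (V, \<psi>), p, r, \<delta> a)"
      using D by (auto simp: \<Lambda>2_def)
    then show ?thesis
      using piece[OF subsetD[OF I(2) a(1)]] by simp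
  qed
  ultimately show ?thesis
    unfolding cd by (intro exI[of _ \<Lambda>1] exI[of _ \<Lambda>2] conjI ballI impI) blast+
qed

end

section \<open>Basic neighbourhoods as a subbase, and the theorem\<close>

lemma smooth_maps_in_basic_nbhds:
  assumes "f \<in> smooth_maps TM \<A>M TX \<A>X"
  shows "smooth_maps TM \<A>M TX \<A>X \<in> basic_nbhds TM \<A>M B TX \<A>X P"
  unfolding basic_nbhds_def mem_Collect_eq
  by (rule exI[of _ f], rule exI[of _ "{}"]) (simp add: assms locally_finite_in_def exI[of _ "topspace TM"])

lemma Union_basic_nbhds: "\<Union>(basic_nbhds TM \<A>M B TX \<A>X P) = smooth_maps TM \<A>M TX \<A>X"
proof
  show "\<Union>(basic_nbhds TM \<A>M B TX \<A>X P) \<subseteq> smooth_maps TM \<A>M TX \<A>X"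
    by (auto simp: basic_nbhds_def)
  show "smooth_maps TM \<A>M TX \<A>X \<subseteq> \<Union>(basic_nbhds TM \<A>M B TX \<A>X P)"
    using smooth_maps_in_basic_nbhds by fast
qed

lemma topspace_vS_top: "topspace (vS_top TM \<A>M B TX \<A>X P) = smooth_maps TM \<A>M TX \<A>X"
  by (simp add: vS_top_def Union_basic_nbhds)

lemma openin_vS_top_basic:
  assumes "f \<in> smooth_maps TM \<A>M TX \<A>X" "\<forall>D\<in>\<Lambda>. elem_data TM \<A>M TX \<A>X P f D" "locally_finite_in TM \<Lambda> fst"
  shows "openin (vS_top TM \<A>M B TX \<A>X P)
    (smooth_maps TM \<A>M TX \<A>X \<inter> (\<Inter>(A, c, d, p, r, \<epsilon>)\<in>\<Lambda>. elem_nbhd TM \<A>M B TX \<A>X f A c d p r \<epsilon>))"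
  unfolding vS_top_def
  by (rule topology_generated_by_Basis) (use assms in \<open>auto simp: basic_nbhds_def\<close>)

theorem theorem2p6:
  fixes TM :: "'m topology" and \<A>M :: "('m set \<times> ('m \<Rightarrow> 'a::{real_vector,topological_space})) set"
    and Bm :: "'a set"
    and TN :: "'n topology" and \<A>N :: "('n set \<times> ('n \<Rightarrow> 'b::{real_vector,topological_space})) set"
    and Bn :: "'b set"
    and TX :: "'x topology" and \<A>X :: "('x set \<times> ('x \<Rightarrow> 'e::{real_vector,topological_space})) set"
  assumes "fd_manifold TM \<A>M Bm"
    and "fd_manifold TN \<A>N Bn"
    and "manifold TX \<A>X"
  shows "continuous_map
           (prod_topology
              (subtopology (vS_top TM \<A>M Bm TN \<A>N {supnorm Bn}) (proper_smooth_maps TM \<A>M TN \<A>N))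
              (vS_top TN \<A>N Bn TX \<A>X cont_seminorms))
           (vS_top TM \<A>M Bm TX \<A>X cont_seminorms)
           (\<lambda>(f, h). restrict (h \<circ> f) (topspace TM))"
proof -
  note M = assms(1) and N = assms(2) and X = assms(3)
  note m = fd_manifoldD[OF M] and n = fd_manifoldD[OF N]
  let ?\<Gamma> = "\<lambda>(f::'m \<Rightarrow> 'n, h::'n \<Rightarrow> 'x). restrict (h \<circ> f) (topspace TM)"
  let ?SN = "smooth_maps TM \<A>M TN \<A>N" and ?SX = "smooth_maps TN \<A>N TX \<A>X"
  let ?Prop = "proper_smooth_maps TM \<A>M TN \<A>N"
  let ?T = "prod_topology (subtopology (vS_top TM \<A>M Bm TN \<A>N {supnorm Bn}) ?Prop)
    (vS_top TN \<A>N Bn TX \<A>X cont_seminorms)"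
  have Prop: "?Prop \<subseteq> ?SN"
    by (auto simp: proper_smooth_maps_def)
  have topT: "topspace ?T = ?Prop \<times> ?SX"
    using Prop by (simp add: topspace_vS_top inf.absorb2)
  \<comment> \<open>The convention for finite-dimensional targets, with the sup norm as only
    seminorm, becomes a case of the general lemmas.\<close>
  have sn: "{supnorm Bn} \<subseteq> cont_seminorms"
    using supnorm_cont_seminorm[OF manifold_lcs[OF n(1)] n(2)] by simp
  obtain Q C where Q: "\<And>i::nat. openin TN (Q i)" "\<And>i. Q i \<subseteq> C i" "(\<Union>i. Q i) = topspace TN"
    and C: "\<And>i. compactin TN (C i)" "incseq C"
    using fd_manifold_precompact_cover[OF N] by metis
  \<comment> \<open>A union of infinitely many closed sets might fail to be closed; here a point of
    \<open>Y\<close> lies in some \<open>C k\<close>, and by monotonicity only indices below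
    \<open>k\<close> remain. If \<open>Y\<close> is empty, as happens for data with empty
    \<open>A\<close>, the union is the whole space.\<close>
  have Z_closed: "closedin TN (\<Union>{C i |i. C i \<inter> Y = {}})" if Y: "Y \<subseteq> topspace TN" for Y
  proof (cases "Y = {}")
    case True
    have "(\<Union>i. C i) = topspace TN"
    proof
      show "(\<Union>i. C i) \<subseteq> topspace TN"
        by (intro UN_least compactin_subset_topspace C(1))
      show "topspace TN \<subseteq> (\<Union>i. C i)"
        unfolding Q(3)[symmetric] by (intro UN_mono Q(2) order_refl)
    qed
    then show ?thesis
      using True by (simp add: full_SetCompr_eq)
  next
    case False
    then obtain y where "y \<in> Y" "y \<in> (\<Union>i. Q i)"
      unfolding Q(3) using Y by blast
    then obtain k where "y \<in> Q k"
      by blast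
    then have "y \<in> C k"
      using Q(2) by blast
    with \<open>y \<in> Y\<close> have "i < k" if "C i \<inter> Y = {}" for i
      using that incseqD[OF C(2), of k i] by (meson disjoint_iff not_le_imp_less subsetD)
    then have "{C i |i. C i \<inter> Y = {}} \<subseteq> C ` {..<k}"
      by auto
    then have "finite {C i |i. C i \<inter> Y = {}}"
      by (rule finite_subset) simp
    then show ?thesis
      using compactin_imp_closedin[OF n(3) C(1)] by (intro closedin_Union) auto
  qed
  \<comment> \<open>As the topology is generated by the basic neighbourhoods, their preimages
    suffice, and openness of these is checked point by point.\<close>
  have "openin ?T (?\<Gamma> -` O' \<inter> topspace ?T)" if O': "O' \<in> basic_nbhds TM \<A>M Bm TX \<A>X cont_seminorms" for O'
  proof (subst openin_subopen, intro ballI)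
    obtain g \<Lambda> where g: "g \<in> smooth_maps TM \<A>M TX \<A>X"
      and \<Lambda>: "\<forall>D\<in>\<Lambda>. elem_data TM \<A>M TX \<A>X cont_seminorms g D" "locally_finite_in TM \<Lambda> fst"
      and O'_eq: "O' = smooth_maps TM \<A>M TX \<A>X \<inter>
        (\<Inter>(A, c, d, p, r, \<epsilon>)\<in>\<Lambda>. elem_nbhd TM \<A>M Bm TX \<A>X g A c d p r \<epsilon>)"
      using O' unfolding basic_nbhds_def by blast
    fix z assume z: "z \<in> ?\<Gamma> -` O' \<inter> topspace ?T"
    obtain f h where fh: "z = (f, h)"
      by (cases z)
    have fP: "f \<in> ?Prop" and h: "h \<in> ?SX" and hf: "restrict (h \<circ> f) (topspace TM) \<in> O'"
      using z unfolding topT fh by auto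
    have f: "f \<in> ?SN"
      using fP Prop by blast
    define Z where "Z D = \<Union>{C i |i. C i \<inter> f ` fst D = {}}"
      for D :: "'m set \<times> ('m set \<times> ('m \<Rightarrow> 'a)) \<times> ('x set \<times> ('x \<Rightarrow> 'e)) \<times> ('e \<Rightarrow> real) \<times> nat \<times> real"
    define ok where "ok D f' h' \<longleftrightarrow> (case D of (A, c, d, p, r, \<epsilon>) \<Rightarrow>
      restrict (h' \<circ> f') (topspace TM) \<in> elem_nbhd TM \<A>M Bm TX \<A>X g A c d p r \<epsilon>)"
      for D and f' :: "'m \<Rightarrow> 'n" and h'
    define near1 where "near1 D f' \<longleftrightarrow> (case D of (A, c, d, p, r, \<epsilon>) \<Rightarrow> f' \<in> elem_nbhd TM \<A>M Bm TN \<A>N f A c d p r \<epsilon>)"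
      for D f'
    define near2 where "near2 D h' \<longleftrightarrow> (case D of (A, c, d, p, r, \<epsilon>) \<Rightarrow> h' \<in> elem_nbhd TN \<A>N Bn TX \<A>X h A c d p r \<epsilon>)"
      for D h'
    define pieces where "pieces D \<Lambda>1 \<Lambda>2 \<longleftrightarrow> finite \<Lambda>1 \<and> finite \<Lambda>2 \<and>
      (\<forall>E\<in>\<Lambda>1. elem_data TM \<A>M TN \<A>N {supnorm Bn} f E \<and> fst E \<subseteq> fst D) \<and>
      (\<forall>E\<in>\<Lambda>2. elem_data TN \<A>N TX \<A>X cont_seminorms h E \<and> fst E \<inter> Z D = {}) \<and>
      (\<forall>f'\<in>?SN. \<forall>h'\<in>?SX. (\<forall>E\<in>\<Lambda>1. near1 E f') \<longrightarrow> (\<forall>E\<in>\<Lambda>2. near2 E h') \<longrightarrow> ok D f' h')" for D \<Lambda>1 \<Lambda>2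
    have "\<exists>\<Lambda>1 \<Lambda>2. pieces D \<Lambda>1 \<Lambda>2" if D: "D \<in> \<Lambda>" for D
    proof -
      obtain A c d p r \<epsilon> where D_eq: "D = (A, c, d, p, r, \<epsilon>)"
        by (cases D)
      have data: "elem_data TM \<A>M TX \<A>X cont_seminorms g (A, c, d, p, r, \<epsilon>)"
        using \<Lambda>(1) D D_eq by blast
      have "A \<subseteq> topspace TM"
        using elem_data_subset_topspace[OF data] by simp
      then have "f ` A \<subseteq> topspace TN"
        using smooth_maps_in_topspace[OF f] by blast
      then have closed: "closedin TN (Z D)"
        unfolding Z_def D_eq by (intro Z_closed) simp
      have disj: "f ` A \<inter> Z D = {}"
        unfolding Z_def D_eq by auto
      have "restrict (h \<circ> f) (topspace TM) \<in> elem_nbhd TM \<A>M Bm TX \<A>X g A c d p r \<epsilon>"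
        using hf D unfolding O'_eq D_eq by blast
      from compose_neighbourhood[OF M N X f h g data this closed disj] show ?thesis
        unfolding pieces_def ok_def near1_def near2_def D_eq by simp
    qed
    then obtain \<Lambda>1 \<Lambda>2 where pieces: "\<And>D. D \<in> \<Lambda> \<Longrightarrow> pieces D (\<Lambda>1 D) (\<Lambda>2 D)"
      by metis
    have fin: "finite (\<Lambda>1 D) \<and> finite (\<Lambda>2 D)" if "D \<in> \<Lambda>" for D
      using pieces[OF that] by (simp add: pieces_def)
    have L1: "elem_data TM \<A>M TN \<A>N {supnorm Bn} f E \<and> fst E \<subseteq> fst D" if "D \<in> \<Lambda>" "E \<in> \<Lambda>1 D" for D E
      using pieces[OF that(1)] that(2) by (simp add: pieces_def)
    have L2: "elem_data TN \<A>N TX \<A>X cont_seminorms h E \<and> fst E \<inter> Z D = {}" if "D \<in> \<Lambda>" "E \<in> \<Lambda>2 D" for D E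
      using pieces[OF that(1)] that(2) by (simp add: pieces_def)
    have ok: "ok D f' h'" if "D \<in> \<Lambda>" "f' \<in> ?SN" "h' \<in> ?SX" "\<forall>E\<in>\<Lambda>1 D. near1 E f'" "\<forall>E\<in>\<Lambda>2 D. near2 E h'" for D f' h'
      using pieces[OF that(1)] that(2-) by (simp add: pieces_def)
    define N1 where "N1 = ?SN \<inter> (\<Inter>(A, c, d, p, r, \<epsilon>)\<in>(\<Union>D\<in>\<Lambda>. \<Lambda>1 D). elem_nbhd TM \<A>M Bm TN \<A>N f A c d p r \<epsilon>)"
    define N2 where "N2 = ?SX \<inter> (\<Inter>(A, c, d, p, r, \<epsilon>)\<in>(\<Union>D\<in>\<Lambda>. \<Lambda>2 D). elem_nbhd TN \<A>N Bn TX \<A>X h A c d p r \<epsilon>)"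
    have N1_iff: "f' \<in> N1 \<longleftrightarrow> f' \<in> ?SN \<and> (\<forall>D\<in>\<Lambda>. \<forall>E\<in>\<Lambda>1 D. near1 E f')" for f'
      by (auto simp: N1_def near1_def split: prod.splits)
    have N2_iff: "h' \<in> N2 \<longleftrightarrow> h' \<in> ?SX \<and> (\<forall>D\<in>\<Lambda>. \<forall>E\<in>\<Lambda>2 D. near2 E h')" for h'
      by (auto simp: N2_def near2_def split: prod.splits)
    have "locally_finite_in TM (\<Union>D\<in>\<Lambda>. \<Lambda>1 D) fst"
      unfolding locally_finite_in_def
    proof
      fix x assume "x \<in> topspace TM"
      then obtain W where W: "openin TM W" "x \<in> W" "finite {D\<in>\<Lambda>. fst D \<inter> W \<noteq> {}}"
        using \<Lambda>(2) unfolding locally_finite_in_def by blast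
      \<comment> \<open>Pieces of \<open>D\<close> lie in \<open>fst D\<close>, so the neighbourhood
        \<open>W\<close> that is good for \<open>\<Lambda>\<close> is also good for its finite
        refinements.\<close>
      have "{E \<in> (\<Union>D\<in>\<Lambda>. \<Lambda>1 D). fst E \<inter> W \<noteq> {}} \<subseteq> (\<Union>D\<in>{D\<in>\<Lambda>. fst D \<inter> W \<noteq> {}}. \<Lambda>1 D)"
        using L1 by blast
      moreover have "finite (\<Union>D\<in>{D\<in>\<Lambda>. fst D \<inter> W \<noteq> {}}. \<Lambda>1 D)"
        using W(3) fin by (intro finite_UN_I) auto
      ultimately have "finite {E \<in> (\<Union>D\<in>\<Lambda>. \<Lambda>1 D). fst E \<inter> W \<noteq> {}}"
        by (rule finite_subset)
      then show "\<exists>W. openin TM W \<and> x \<in> W \<and> finite {E \<in> (\<Union>D\<in>\<Lambda>. \<Lambda>1 D). fst E \<inter> W \<noteq> {}}"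
        using W(1,2) by blast
    qed
    then have N1_open: "openin (vS_top TM \<A>M Bm TN \<A>N {supnorm Bn}) N1"
      unfolding N1_def using L1 by (intro openin_vS_top_basic[OF f]) auto
    have "locally_finite_in TN (\<Union>D\<in>\<Lambda>. \<Lambda>2 D) fst"
      unfolding locally_finite_in_def
    proof
      fix y assume "y \<in> topspace TN"
      then obtain i where i: "y \<in> Q i"
        unfolding Q(3)[symmetric] by blast
      let ?K = "{x \<in> topspace TM. f x \<in> C i}"
      have "compactin TM ?K"
        using fP C(1) by (simp add: proper_smooth_maps_def)
      from locally_finite_in_compact[OF \<Lambda>(2) this]
      have "finite (\<Union>D\<in>{D\<in>\<Lambda>. fst D \<inter> ?K \<noteq> {}}. \<Lambda>2 D)"
        using fin by (intro finite_UN_I) auto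
      \<comment> \<open>The open set \<open>Q i\<close> is the test neighbourhood, but the pieces
        avoid whole sets \<open>C i\<close>. A piece that meets \<open>Q i\<close> shows that
        \<open>C i\<close> was not forbidden to it, hence that \<open>fst D\<close> meets the
        compact preimage \<open>?K\<close>.\<close>
      moreover have "{E \<in> (\<Union>D\<in>\<Lambda>. \<Lambda>2 D). fst E \<inter> Q i \<noteq> {}} \<subseteq> (\<Union>D\<in>{D\<in>\<Lambda>. fst D \<inter> ?K \<noteq> {}}. \<Lambda>2 D)"
      proof
        fix E assume "E \<in> {E \<in> (\<Union>D\<in>\<Lambda>. \<Lambda>2 D). fst E \<inter> Q i \<noteq> {}}"
        then obtain D where D: "D \<in> \<Lambda>" "E \<in> \<Lambda>2 D" and "fst E \<inter> Q i \<noteq> {}"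
          by blast
        then have "fst E \<inter> C i \<noteq> {}"
          using Q(2) by blast
        then have "\<not> C i \<subseteq> Z D"
          using L2[OF D] by blast
        then have "C i \<inter> f ` fst D \<noteq> {}"
          unfolding Z_def by blast
        moreover have "fst D \<subseteq> topspace TM"
          using \<Lambda>(1) D(1) elem_data_subset_topspace by blast
        ultimately have "fst D \<inter> ?K \<noteq> {}"
          by blast
        with D show "E \<in> (\<Union>D\<in>{D\<in>\<Lambda>. fst D \<inter> ?K \<noteq> {}}. \<Lambda>2 D)"
          by blast
      qed
      ultimately have "finite {E \<in> (\<Union>D\<in>\<Lambda>. \<Lambda>2 D). fst E \<inter> Q i \<noteq> {}}"
        by (rule finite_subset[rotated])
      then show "\<exists>W. openin TN W \<and> y \<in> W \<and> finite {E \<in> (\<Union>D\<in>\<Lambda>. \<Lambda>2 D). fst E \<inter> W \<noteq> {}}"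
        using Q(1) i by blast
    qed
    then have N2_open: "openin (vS_top TN \<A>N Bn TX \<A>X cont_seminorms) N2"
      unfolding N2_def using L2 by (intro openin_vS_top_basic[OF h]) auto
    have "f \<in> N1"
      unfolding N1_iff near1_def
      using f L1 elem_nbhd_centre[OF m(1) n(1) f sn] by (auto split: prod.splits)
    moreover have "h \<in> N2"
      unfolding N2_iff near2_def
      using h L2 elem_nbhd_centre[OF n(1) X h order_refl] by (auto split: prod.splits)
    moreover have "openin ?T ((N1 \<inter> ?Prop) \<times> N2)"
      using N1_open N2_open by (simp add: openin_prod_Times_iff openin_subtopology_Int)
    moreover have "(N1 \<inter> ?Prop) \<times> N2 \<subseteq> ?\<Gamma> -` O' \<inter> topspace ?T"
    proof
      fix w assume "w \<in> (N1 \<inter> ?Prop) \<times> N2"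
      then obtain f' h' where w: "w = (f', h')" "f' \<in> N1" "f' \<in> ?Prop" "h' \<in> N2"
        by blast
      then have S: "f' \<in> ?SN" "h' \<in> ?SX"
        by (auto simp: N1_iff N2_iff)
      have "restrict (h' \<circ> f') (topspace TM) \<in> smooth_maps TM \<A>M TX \<A>X"
        by (rule smooth_maps_compose[OF m(1) n(1) X S])
      moreover have "ok D f' h'" if "D \<in> \<Lambda>" for D
        using ok[OF that S] w that by (auto simp: N1_iff N2_iff)
      ultimately have "restrict (h' \<circ> f') (topspace TM) \<in> O'"
        unfolding O'_eq ok_def by blast
      then show "w \<in> ?\<Gamma> -` O' \<inter> topspace ?T"
        unfolding topT using w S by simp
    qed
    ultimately show "\<exists>W. openin ?T W \<and> z \<in> W \<and> W \<subseteq> ?\<Gamma> -` O' \<inter> topspace ?T"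
      using fP unfolding fh by blast
  qed
  moreover have "?\<Gamma> ` topspace ?T \<subseteq> \<Union>(basic_nbhds TM \<A>M Bm TX \<A>X cont_seminorms)"
    unfolding Union_basic_nbhds topT
    using smooth_maps_compose[OF m(1) n(1) X] Prop by auto
  ultimately show ?thesis
    unfolding vS_top_def[of TM \<A>M Bm TX] by (intro continuous_on_generated_topo)
qed

end
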